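(* There exists a surjective homomorphism of superalgebras $\varphi:Y(Q(1))\to W_\chi$ defined by $$\varphi(T_{1,1}^{(k)})=(-1)^k\pi(e_{n,1}^{(n+k-1)}),\qquad \varphi(T_{-1,1}^{(k)})=(-1)^k\pi(f_{n,1}^{(n+k-1)}),\qquad k=1,2,\dots$$
   Context: $Y(Q(1))$ is the Nazarov–Sergeev super-Yangian: the unital associative superalgebra with generators $T_{i,j}^{(m)}$, $m\ge1$, $i,j\in\{\pm1\}$, of parity $p(i)+p(j)$ ($p(1)=0$, $p(-1)=1$), with $T_{i,j}^{(0)}=\delta_{ij}$, subject to $T_{-i,-j}^{(m)}=(-1)^mT_{i,j}^{(m)}$ and $([T_{i,j}^{(m+1)},T_{k,l}^{(r-1)}]-[T_{i,j}^{(m-1)},T_{k,l}^{(r+1)}])(-1)^{p(i)p(k)+p(i)p(l)+p(k)p(l)}=T_{k,j}^{(m)}T_{i,l}^{(r-1)}+T_{k,j}^{(m-1)}T_{i,l}^{(r)}-T_{k,j}^{(r-1)}T_{i,l}^{(m)}-T_{k,j}^{(r)}T_{i,l}^{(m-1)}+(-1)^{p(k)+p(l)}(-T_{-k,j}^{(m)}T_{-i,l}^{(r-1)}+T_{-k,j}^{(m-1)}T_{-i,l}^{(r)}+T_{k,-j}^{(r-1)}T_{i,-l}^{(m)}-T_{k,-j}^{(r)}T_{i,-l}^{(m-1)})$. On the other side, $\mathfrak g=Q(n)$ with even basis $e_{i,j}$ and odd basis $f_{i,j}$; $\chi(x)=\mathrm{otr}(xE)$ with $E=\sum_{i=1}^{n-1}f_{i,i+1}$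 regular nilpotent; $\mathfrak m$ is spanned by $e_{i,j},f_{i,j}$ with $i>j$, $\chi(e_{i+1,i})=1$ and $\chi$ vanishes on the other basis vectors of $\mathfrak m$; $I_\chi$ is the left ideal generated by $a-\chi(a)$, $a\in\mathfrak m$; $\pi:U(\mathfrak g)\to U(\mathfrak g)/I_\chi$; $W_\chi=\{\pi(y):\mathrm{ad}(a)y\in I_\chi\ \forall a\in\mathfrak m\}$. Sergeev's elements of $U(Q(n))$ are $e_{i,j}^{(1)}=e_{i,j}$, $f_{i,j}^{(1)}=f_{i,j}$, and $e_{i,j}^{(m)}=\sum_k e_{i,k}e_{k,j}^{(m-1)}+(-1)^{m+1}\sum_k f_{i,k}f_{k,j}^{(m-1)}$, $f_{i,j}^{(m)}=\sum_k e_{i,k}f_{k,j}^{(m-1)}+(-1)^{m+1}\sum_k f_{i,k}e_{k,j}^{(m-1)}$. *)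

theory Defs
  imports Complex_Main "HOL-Library.Function_Algebras"
begin

text \<open>An element of the free associative algebra on a generator type 'x is a
finitely supported function from words (lists of generators) to coefficients.
Addition, subtraction, zero and finite sums are pointwise (Function_Algebras);
the algebra multiplication is concatenation-convolution (NOT pointwise times,
which is never used below).\<close>

type_synonym 'x fa = "'x list \<Rightarrow> complex"

definition fa_supp :: "'x fa \<Rightarrow> 'x list set" where
  "fa_supp p = {w. p w \<noteq> 0}"

definition FA :: "'x set \<Rightarrow> 'x fa set" where
  "FA X = {p. finite (fa_supp p) \<and> (\<forall>w\<in>fa_supp p. set w \<subseteq> X)}"

definition fa_mul :: "'x fa \<Rightarrow> 'x fa \<Rightarrow> 'x fa" (infixl "\<odot>" 70) where
  "p \<odot> q = (\<lambda>w. \<Sum>i\<le>length w. p (take i w) * q (drop i w))"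

definition fa_smul :: "complex \<Rightarrow> 'x fa \<Rightarrow> 'x fa" (infixr "*\<^sub>f" 75) where
  "c *\<^sub>f p = (\<lambda>w. c * p w)"

definition fa_scal :: "complex \<Rightarrow> 'x fa" where
  "fa_scal c = (\<lambda>w. if w = [] then c else 0)"

definition fa_gen :: "'x \<Rightarrow> 'x fa" where
  "fa_gen x = (\<lambda>w. if w = [x] then 1 else 0)"

definition fa_prodl :: "'x fa list \<Rightarrow> 'x fa" where
  "fa_prodl xs = foldr fa_mul xs (fa_scal 1)"

definition fa_eval :: "('x \<Rightarrow> 'y fa) \<Rightarrow> 'x fa \<Rightarrow> 'y fa" where
  "fa_eval img p = (\<lambda>v. \<Sum>w\<in>fa_supp p. p w * fa_prodl (map img w) v)"

definition word_odd :: "('x \<Rightarrow> bool) \<Rightarrow> 'x list \<Rightarrow> bool" where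
  "word_odd par w = odd (length (filter par w))"

definition homog :: "('x \<Rightarrow> bool) \<Rightarrow> bool \<Rightarrow> 'x fa \<Rightarrow> bool" where
  "homog par s p = (\<forall>w. p w \<noteq> 0 \<longrightarrow> word_odd par w = s)"

definition fa_ev :: "('x \<Rightarrow> bool) \<Rightarrow> 'x fa \<Rightarrow> 'x fa" where
  "fa_ev par p = (\<lambda>w. if word_odd par w then 0 else p w)"

definition fa_od :: "('x \<Rightarrow> bool) \<Rightarrow> 'x fa \<Rightarrow> 'x fa" where
  "fa_od par p = (\<lambda>w. if word_odd par w then p w else 0)"

definition fa_par :: "('x \<Rightarrow> bool) \<Rightarrow> 'x fa \<Rightarrow> 'x fa" where
  "fa_par par p = (\<lambda>w. if word_odd par w then - p w else p w)"

text \<open>Supercommutator [a,y] = ad(a) y, extended bilinearly from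
 [a,y] = a y - (-1)^{|a||y|} y a for homogeneous a, y.\<close>
definition scomm :: "('x \<Rightarrow> bool) \<Rightarrow> 'x fa \<Rightarrow> 'x fa \<Rightarrow> 'x fa" where
  "scomm par a y = a \<odot> y - y \<odot> fa_ev par a - fa_par par y \<odot> fa_od par a"

inductive_set lideal :: "'x set \<Rightarrow> 'x fa set \<Rightarrow> 'x fa set" for X G where
  lid_zero: "0 \<in> lideal X G"
| lid_gen: "g \<in> G \<Longrightarrow> g \<in> lideal X G"
| lid_add: "a \<in> lideal X G \<Longrightarrow> b \<in> lideal X G \<Longrightarrow> a + b \<in> lideal X G"
| lid_smul: "a \<in> lideal X G \<Longrightarrow> c *\<^sub>f a \<in> lideal X G"
| lid_lmul: "a \<in> lideal X G \<Longrightarrow> u \<in> FA X \<Longrightarrow> u \<odot> a \<in> lideal X G"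

inductive_set tideal :: "'x set \<Rightarrow> 'x fa set \<Rightarrow> 'x fa set" for X G where
  tid_zero: "0 \<in> tideal X G"
| tid_gen: "g \<in> G \<Longrightarrow> g \<in> tideal X G"
| tid_add: "a \<in> tideal X G \<Longrightarrow> b \<in> tideal X G \<Longrightarrow> a + b \<in> tideal X G"
| tid_smul: "a \<in> tideal X G \<Longrightarrow> c *\<^sub>f a \<in> tideal X G"
| tid_lmul: "a \<in> tideal X G \<Longrightarrow> u \<in> FA X \<Longrightarrow> u \<odot> a \<in> tideal X G"
| tid_rmul: "a \<in> tideal X G \<Longrightarrow> u \<in> FA X \<Longrightarrow> a \<odot> u \<in> tideal X G"

text \<open>Basis of Q(n): Ee i j = e_{i,j} (even), Ff i j = f_{i,j} (odd), 1 \<le> i,j \<le> n.\<close>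
datatype qg = Ee nat nat | Ff nat nat

fun qpar :: "qg \<Rightarrow> bool" where
  "qpar (Ee _ _) = False"
| "qpar (Ff _ _) = True"

definition qvalid :: "nat \<Rightarrow> qg set" where
  "qvalid n = {Ee i j | i j. 1 \<le> i \<and> i \<le> n \<and> 1 \<le> j \<and> j \<le> n}
            \<union> {Ff i j | i j. 1 \<le> i \<and> i \<le> n \<and> 1 \<le> j \<and> j \<le> n}"

definition dlt :: "nat \<Rightarrow> nat \<Rightarrow> complex" where
  "dlt a b = (if a = b then 1 else 0)"

text \<open>Super Lie bracket of Q(n) (e_{ij} = E_{ij}+E_{-i,-j}, f_{ij} = E_{i,-j}+E_{-i,j}).\<close>
fun qbr :: "qg \<Rightarrow> qg \<Rightarrow> qg fa" where
  "qbr (Ee i j) (Ee k l) = dlt j k *\<^sub>f fa_gen (Ee i l) - dlt l i *\<^sub>f fa_gen (Ee k j)"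
| "qbr (Ee i j) (Ff k l) = dlt j k *\<^sub>f fa_gen (Ff i l) - dlt l i *\<^sub>f fa_gen (Ff k j)"
| "qbr (Ff i j) (Ee k l) = dlt j k *\<^sub>f fa_gen (Ff i l) - dlt l i *\<^sub>f fa_gen (Ff k j)"
| "qbr (Ff i j) (Ff k l) = dlt j k *\<^sub>f fa_gen (Ee i l) + dlt l i *\<^sub>f fa_gen (Ee k j)"

definition Ugens :: "nat \<Rightarrow> qg fa set" where
  "Ugens n = {fa_gen x \<odot> fa_gen y
               - (if qpar x \<and> qpar y then -1 else 1) *\<^sub>f (fa_gen y \<odot> fa_gen x)
               - qbr x y | x y. x \<in> qvalid n \<and> y \<in> qvalid n}"

definition mgens :: "nat \<Rightarrow> qg set" where
  "mgens n = {Ee i j | i j. j < i \<and> Ee i j \<in> qvalid n} \<union> {Ff i j | i j. j < i \<and> Ff i j \<in> qvalid n}"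

definition msp :: "nat \<Rightarrow> qg fa set" where
  "msp n = {a \<in> FA (mgens n). \<forall>w. length w \<noteq> 1 \<longrightarrow> a w = 0}"

definition chigens :: "nat \<Rightarrow> qg fa set" where
  "chigens n = {fa_gen x - fa_scal (if (\<exists>j. x = Ee (Suc j) j) then 1 else 0) | x. x \<in> mgens n}"

text \<open>Preimage of I_chi in the free algebra: the left ideal generated by the
 two-sided ideal of the U(Q(n)) relations together with the a - chi(a).
 So U(Q(n))/I_chi = FA(qvalid n) / Kpre n and pi is the class map.\<close>
definition Kpre :: "nat \<Rightarrow> qg fa set" where
  "Kpre n = lideal (qvalid n) (tideal (qvalid n) (Ugens n) \<union> chigens n)"

text \<open>Representatives y with pi(y) \<in> W_chi.\<close>
definition Wpre :: "nat \<Rightarrow> qg fa set" where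
  "Wpre n = {y \<in> FA (qvalid n). \<forall>a\<in>msp n. scomm qpar a y \<in> Kpre n}"

text \<open>Sergeev's elements: serg n s i j = (e_{ij}^{(s+1)}, f_{ij}^{(s+1)}).\<close>
fun serg :: "nat \<Rightarrow> nat \<Rightarrow> nat \<Rightarrow> nat \<Rightarrow> qg fa \<times> qg fa" where
  "serg n 0 i j = (fa_gen (Ee i j), fa_gen (Ff i j))"
| "serg n (Suc s) i j =
     ((\<Sum>k\<in>{1..n}. fa_gen (Ee i k) \<odot> fst (serg n s k j)
                    + ((-1)^(Suc s+2)) *\<^sub>f (fa_gen (Ff i k) \<odot> snd (serg n s k j))),
      (\<Sum>k\<in>{1..n}. fa_gen (Ee i k) \<odot> snd (serg n s k j)
                    + ((-1)^(Suc s+2)) *\<^sub>f (fa_gen (Ff i k) \<odot> fst (serg n s k j))))"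

definition sE :: "nat \<Rightarrow> nat \<Rightarrow> nat \<Rightarrow> nat \<Rightarrow> qg fa" where
  "sE n m i j = fst (serg n (m - 1) i j)"
definition sF :: "nat \<Rightarrow> nat \<Rightarrow> nat \<Rightarrow> nat \<Rightarrow> qg fa" where
  "sF n m i j = snd (serg n (m - 1) i j)"

text \<open>Indices i \<in> {1,-1}: Pl = 1, Mi = -1.\<close>
datatype sg = Pl | Mi

fun sneg :: "sg \<Rightarrow> sg" where "sneg Pl = Mi" | "sneg Mi = Pl"
fun spar :: "sg \<Rightarrow> bool" where "spar Pl = False" | "spar Mi = True"

text \<open>Generator (s, i, j) stands for T_{i,j}^{(s+1)}.\<close>
type_synonym yg = "nat \<times> sg \<times> sg"

fun ypar :: "yg \<Rightarrow> bool" where "ypar (s, i, j) = (spar i \<noteq> spar j)"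

definition sgc :: "bool \<Rightarrow> complex" where "sgc b = (if b then -1 else 1)"

definition Tel :: "nat \<Rightarrow> sg \<Rightarrow> sg \<Rightarrow> yg fa" where
  "Tel m i j = (if m = 0 then fa_scal (if i = j then 1 else 0) else fa_gen (m - 1, i, j))"

definition yrel :: "sg \<Rightarrow> sg \<Rightarrow> sg \<Rightarrow> sg \<Rightarrow> nat \<Rightarrow> nat \<Rightarrow> yg fa" where
  "yrel i j k l m r =
     sgc (((spar i \<and> spar k) \<noteq> (spar i \<and> spar l)) \<noteq> (spar k \<and> spar l)) *\<^sub>f
       (scomm ypar (Tel (m+1) i j) (Tel (r-1) k l) - scomm ypar (Tel (m-1) i j) (Tel (r+1) k l))
     - (Tel m k j \<odot> Tel (r-1) i l + Tel (m-1) k j \<odot> Tel r i l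
        - Tel (r-1) k j \<odot> Tel m i l - Tel r k j \<odot> Tel (m-1) i l
        + sgc (spar k \<noteq> spar l) *\<^sub>f
            (- (Tel m (sneg k) j \<odot> Tel (r-1) (sneg i) l) + Tel (m-1) (sneg k) j \<odot> Tel r (sneg i) l
             + Tel (r-1) k (sneg j) \<odot> Tel m i (sneg l) - Tel r k (sneg j) \<odot> Tel (m-1) i (sneg l)))"

definition yrels :: "yg fa set" where
  "yrels = {yrel i j k l m r | i j k l m r. 1 \<le> m \<and> 1 \<le> r}
         \<union> {Tel m (sneg i) (sneg j) - ((-1)^m) *\<^sub>f Tel m i j | m i j. 1 \<le> m}"

end

theory Submission
  imports Defs
begin

text \<open>Since \<open>[e\<^sub>i\<^sub>j, -]\<close> and \<open>[f\<^sub>i\<^sub>j, -]\<close> permute Sergeev's elements up to sign, those in the last row and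
  first column supercommute with \<open>\<mm>\<close>, and induction on the superscript gives closed quadratic formulas for
  all their supercommutators; the relations of \<open>Y(Q(1))\<close> are differences of two such formulas, with the
  superscripts shifted by \<open>n - 1\<close>.

  Surjectivity needs no PBW theorem. In the associated graded of the Kazhdan filtration the quotient
  \<open>U/I\<close> is generated by first-column elements: \<open>u\<close>'s indexed by a basis of \<open>\<mm>\<close> and the images \<open>z\<close> of the
  Yangian generators. Pairing each \<open>u\<close> with the basis vector \<open>a\<close> of \<open>\<mm>\<close> dual to it, the Euler operator
  \<open>\<Sum> u (a - \<chi>(a))\<close> lies in \<open>I\<close>, kills every \<open>z\<close> and multiplies a word with \<open>k\<close> letters \<open>u\<close> by \<open>k\<close>, up to words
  with more letters \<open>u\<close> and terms of lower degree. It annihilates Whittaker vectors, so their leading terms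
  are polynomials in the \<open>z\<close>'s.\<close>

section \<open>Sergeev's elements and their supercommutators\<close>

text \<open>The shift of the superscripts by \<open>n - 1\<close> comes from
  \<open>cE (n - 1) n\<close>. It equals 1 up to negative degree, so on Whittaker vectors it acts as
  1 and takes the place of \<open>T^{(0)}\<close>. With this stand-in the quadratic relations hold
  exactly in \<open>U\<close>. Because \<open>I\<close> is only a left ideal, putting back the true
  \<open>T^{(0)}\<close> inside a product is legitimate only to the left of a Whittaker vector.

  For surjectivity, what is used about words in the \<open>u\<close> and \<open>z\<close> is that
  they span. If a vector spanned by words with at least \<open>k > 0\<close> letters
  \<open>u\<close> is annihilated by the Euler operator, then \<open>k\<close> times the vector,
  hence the vector itself, is spanned by words with at least \<open>k + 1\<close> such letters. All
  letters have positive degree, so iterating this pushes the vector into lower degree.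

  The duality between the \<open>u\<close> and the basis of \<open>\<mm>\<close> rests on
  \<open>cE m (m + 1)\<close> being 1 to leading order; the signs in \<open>Eu\<close> are those for
  which the odd \<open>u\<close> also get eigenvalue 1.\<close>

definition sgn_if :: "nat \<Rightarrow> 'a::ab_group_add \<Rightarrow> 'a" where
  "sgn_if m x = (if even m then x else - x)"

lemma sgn_if_simps [simp]:
  "sgn_if 0 x = x" "sgn_if (Suc m) x = - sgn_if m x" "sgn_if m 0 = 0"
  "sgn_if m (- x) = - sgn_if m x"
  "sgn_if m (sgn_if m x) = x"
  by (auto simp: sgn_if_def)

lemma sgn_if_add: "sgn_if m (x + y) = sgn_if m x + sgn_if m y"
  and sgn_if_diff: "sgn_if m (x - y) = sgn_if m x - sgn_if m y"
  and sgn_if_sgn_if: "sgn_if m (sgn_if r x) = sgn_if (m + r) x"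
  by (auto simp: sgn_if_def)

lemma sgn_if_sum: "sgn_if m (sum h A) = (\<Sum>a\<in>A. sgn_if m (h a))"
  by (auto simp: sgn_if_def sum_negf)

lemma sgn_if_mult:
  fixes x y :: "'a::ring"
  shows "sgn_if m x * y = sgn_if m (x * y)" "x * sgn_if m y = sgn_if m (x * y)"
  by (auto simp: sgn_if_def)

text \<open>The Kronecker delta acts on an element instead of multiplying it, so no scalar has to be
  moved past noncommuting factors.\<close>

definition dl :: "'i \<Rightarrow> 'i \<Rightarrow> 'a::zero \<Rightarrow> 'a" where
  "dl a b x = (if a = b then x else 0)"

lemma sum_dl [simp]:
  assumes "finite S" "b \<in> S"
  shows "(\<Sum>a\<in>S. dl a b (h a)) = h b" "(\<Sum>a\<in>S. dl b a (h a)) = h b"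
  using assms by (auto simp: dl_def)

lemma dl_mult:
  fixes x y :: "'a::ring"
  shows "dl a b x * y = dl a b (x * y)" "y * dl a b x = dl a b (y * x)"
  by (auto simp: dl_def)

lemma dl_add: "dl a b (x + y) = dl a b x + dl a b (y :: 'a::ab_group_add)"
  and dl_sgn_if: "dl a b (sgn_if m x) = sgn_if m (dl a b (x :: 'a::ab_group_add))"
  by (auto simp: dl_def sgn_if_def)

lemma dl_sum: "dl a b (sum h A) = (\<Sum>i\<in>A. dl a b (h i))"
  by (auto simp: dl_def)

lemma dl_0 [simp]: "dl a b 0 = 0"
  by (simp add: dl_def)

text \<open>A ring with elements satisfying the brackets of Q(n). The closed formulas
  \<open>RTT\<close> follow from these brackets alone, so they are proved before any enveloping
  algebra is built.\<close>

locale queer =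
  fixes S :: "'i set" and e f :: "'i \<Rightarrow> 'i \<Rightarrow> 'a::ring_1"
  assumes finite_S [simp]: "finite S"
    and ee: "\<lbrakk>i \<in> S; j \<in> S; k \<in> S; l \<in> S\<rbrakk> \<Longrightarrow>
      e i j * e k l = e k l * e i j + dl j k (e i l) - dl l i (e k j)"
    and ef: "\<lbrakk>i \<in> S; j \<in> S; k \<in> S; l \<in> S\<rbrakk> \<Longrightarrow>
      e i j * f k l = f k l * e i j + dl j k (f i l) - dl l i (f k j)"
    and ff: "\<lbrakk>i \<in> S; j \<in> S; k \<in> S; l \<in> S\<rbrakk> \<Longrightarrow>
      f i j * f k l = - (f k l * f i j) + dl j k (e i l) + dl l i (e k j)"
begin

lemma fe: "\<lbrakk>i \<in> S; j \<in> S; k \<in> S; l \<in> S\<rbrakk> \<Longrightarrow>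
      f i j * e k l = e k l * f i j + dl j k (f i l) - dl l i (f k j)"
  using ef[of k l i j] by (auto simp: dl_def algebra_simps)

text \<open>Sergeev's elements with the recursion started at superscript 0, at the identity matrix
  and 0. These initial values supply boundary terms in \<open>RTT\<close>.\<close>

primrec EF :: "nat \<Rightarrow> 'i \<Rightarrow> 'i \<Rightarrow> 'a \<times> 'a" where
  "EF 0 i j = (dl i j 1, 0)"
| "EF (Suc m) i j =
    ((\<Sum>k\<in>S. e i k * fst (EF m k j) + sgn_if m (f i k * snd (EF m k j))),
     (\<Sum>k\<in>S. e i k * snd (EF m k j) + sgn_if m (f i k * fst (EF m k j))))"

definition E :: "nat \<Rightarrow> 'i \<Rightarrow> 'i \<Rightarrow> 'a" where "E m i j = fst (EF m i j)"
definition F :: "nat \<Rightarrow> 'i \<Rightarrow> 'i \<Rightarrow> 'a" where "F m i j = snd (EF m i j)"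

lemma E_0: "E 0 i j = dl i j 1" and F_0: "F 0 i j = 0"
  by (simp_all add: E_def F_def)

lemma E_Suc: "E (Suc m) i j = (\<Sum>a\<in>S. e i a * E m a j + sgn_if m (f i a * F m a j))"
  and F_Suc: "F (Suc m) i j = (\<Sum>a\<in>S. e i a * F m a j + sgn_if m (f i a * E m a j))"
  by (simp_all add: E_def F_def)

lemma E_1: "\<lbrakk>i \<in> S; j \<in> S\<rbrakk> \<Longrightarrow> E (Suc 0) i j = e i j"
  and F_1: "\<lbrakk>i \<in> S; j \<in> S\<rbrakk> \<Longrightarrow> F (Suc 0) i j = f i j"
  by (simp_all add: E_Suc F_Suc E_0 F_0 dl_mult)

text \<open>The pairs \<open>(E m, F m)\<close> behave like powers of one matrix, so superscripts
  add; the sign depends on the superscript of the right factor. This collapses the contractions that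
  arise in \<open>comm_Suc\<close>.\<close>

lemma EF_add:
  "(\<Sum>a\<in>S. E r k a * E m a j + sgn_if m (F r k a * F m a j)) = E (r + m) k j \<and>
   (\<Sum>a\<in>S. E r k a * F m a j + sgn_if m (F r k a * E m a j)) = F (r + m) k j" 
  if "k \<in> S"
  using that
proof (induction r arbitrary: k)
  case 0
  then show ?case by (simp add: E_0 F_0 dl_mult)
next
  case (Suc r)
  have exch: "(\<Sum>a\<in>S. (\<Sum>b\<in>S. h b a)) = (\<Sum>b\<in>S. (\<Sum>a\<in>S. h b a))" 
    for h :: "'i \<Rightarrow> 'i \<Rightarrow> 'a"
    by (rule sum.swap)
  have "(\<Sum>a\<in>S. E (Suc r) k a * E m a j + sgn_if m (F (Suc r) k a * F m a j))
     = (\<Sum>b\<in>S. e k b * (\<Sum>a\<in>S. E r b a * E m a j + sgn_if m (F r b a * F m a j))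
        + sgn_if (r + m) (f k b * (\<Sum>a\<in>S. E r b a * F m a j + sgn_if m (F r b a * E m a j))))"
    unfolding E_Suc F_Suc sum_distrib_right sgn_if_sum
    apply (subst sum.distrib[symmetric])
    apply (subst exch)
    by (cases "even m"; cases "even r")
      (simp_all add: sgn_if_def sum_distrib_left sum.distrib sum_subtractf sum_negf algebra_simps)
  also have "\<dots> = E (Suc r + m) k j"
    using Suc by (simp add: E_Suc)
  finally have 1: "(\<Sum>a\<in>S. E (Suc r) k a * E m a j + sgn_if m (F (Suc r) k a * F m a j)) = E (Suc r + m) k j" .
  have "(\<Sum>a\<in>S. E (Suc r) k a * F m a j + sgn_if m (F (Suc r) k a * E m a j))
     = (\<Sum>b\<in>S. e k b * (\<Sum>a\<in>S. E r b a * F m a j + sgn_if m (F r b a * E m a j))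
        + sgn_if (r + m) (f k b * (\<Sum>a\<in>S. E r b a * E m a j + sgn_if m (F r b a * F m a j))))"
    unfolding E_Suc F_Suc sum_distrib_right sgn_if_sum
    apply (subst sum.distrib[symmetric])
    apply (subst exch)
    by (cases "even m"; cases "even r")
      (simp_all add: sgn_if_def sum_distrib_left sum.distrib sum_subtractf sum_negf algebra_simps)
  also have "\<dots> = F (Suc r + m) k j"
    using Suc by (simp add: F_Suc)
  finally show ?case using 1 by blast
qed

text \<open>The four brackets need a joint induction: the recursion for \<open>E\<close> involves
  \<open>F\<close>, and an odd generator exchanges the two. One delta term moves the row index from
  \<open>k\<close> to \<open>i\<close>, the other the column index from \<open>l\<close> to
  \<open>j\<close>; with \<open>f i j\<close> the row term acquires a sign depending on
  \<open>m\<close>, because the recursion alternates the sign of its odd part.\<close>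

lemma gen_comm:
  assumes "i \<in> S" "j \<in> S" "l \<in> S" "k \<in> S"
  shows "e i j * E m k l - E m k l * e i j = dl j k (E m i l) - dl l i (E m k j)
       \<and> e i j * F m k l - F m k l * e i j = dl j k (F m i l) - dl l i (F m k j)
       \<and> f i j * E m k l - E m k l * f i j = - sgn_if m (dl j k (F m i l)) - dl l i (F m k j)
       \<and> f i j * F m k l + F m k l * f i j = - sgn_if m (dl j k (E m i l)) + dl l i (E m k j)"
  using assms(4)
proof (induction m arbitrary: k)
  case 0
  then show ?case by (auto simp: E_0 F_0 dl_def)
next
  case (Suc m)
  note k = Suc.prems
  have IH: "e i j * E m a l = E m a l * e i j + dl j a (E m i l) - dl l i (E m a j)"
           "e i j * F m a l = F m a l * e i j + dl j a (F m i l) - dl l i (F m a j)"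
           "f i j * E m a l = E m a l * f i j - sgn_if m (dl j a (F m i l)) - dl l i (F m a j)"
           "f i j * F m a l = - (F m a l * f i j) - sgn_if m (dl j a (E m i l)) + dl l i (E m a j)"
     if "a \<in> S" for a
    using Suc.IH[OF that] by (auto simp: algebra_simps eq_diff_eq)
  have s: "x * (y * z) = x * y * z" for x y z :: 'a by (simp add: mult.assoc)
  note gens = ee[OF assms(1,2) k] ef[OF assms(1,2) k] ff[OF assms(1,2) k] fe[OF assms(1,2) k]
  \<comment> \<open>Leibniz rule for the eight products produced by the recursion. After summation
    over \<open>a\<close>, the terms with \<open>dl a i\<close> and those with \<open>dl j a\<close>
    cancel against each other.\<close>
  have 1: "e i j * (e k a * E m a l) = e k a * E m a l * e i j + dl j k (e i a * E m a l) - dl a i (e k j * E m a l)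
      + dl j a (e k a * E m i l) - dl l i (e k a * E m a j)"
    "e i j * (f k a * F m a l) = f k a * F m a l * e i j + dl j k (f i a * F m a l) - dl a i (f k j * F m a l)
      + dl j a (f k a * F m i l) - dl l i (f k a * F m a j)"
    "e i j * (e k a * F m a l) = e k a * F m a l * e i j + dl j k (e i a * F m a l) - dl a i (e k j * F m a l)
      + dl j a (e k a * F m i l) - dl l i (e k a * F m a j)"
    "e i j * (f k a * E m a l) = f k a * E m a l * e i j + dl j k (f i a * E m a l) - dl a i (f k j * E m a l)
      + dl j a (f k a * E m i l) - dl l i (f k a * E m a j)"
    "f i j * (e k a * E m a l) = e k a * E m a l * f i j + dl j k (f i a * E m a l) - dl a i (f k j * E m a l)
      - sgn_if m (dl j a (e k a * F m i l)) - dl l i (e k a * F m a j)"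
    "f i j * (f k a * F m a l) = f k a * F m a l * f i j + dl j k (e i a * F m a l) + dl a i (e k j * F m a l)
      + sgn_if m (dl j a (f k a * E m i l)) - dl l i (f k a * E m a j)"
    "f i j * (e k a * F m a l) = - (e k a * F m a l * f i j) + dl j k (f i a * F m a l) - dl a i (f k j * F m a l)
      - sgn_if m (dl j a (e k a * E m i l)) + dl l i (e k a * E m a j)"
    "f i j * (f k a * E m a l) = - (f k a * E m a l * f i j) + dl j k (e i a * E m a l) + dl a i (e k j * E m a l)
      + sgn_if m (dl j a (f k a * F m i l)) + dl l i (f k a * F m a j)"
    if a: "a \<in> S" for a
    unfolding s gens[OF a]
    by (simp_all only: left_diff_distrib distrib_right mult.assoc IH[OF a] minus_mult_left[symmetric])
       (simp_all add: distrib_left right_diff_distrib dl_mult sgn_if_mult dl_add dl_sgn_if mult.assoc)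
  show ?case
    unfolding E_Suc F_Suc sum_distrib_left sum_distrib_right distrib_left distrib_right sgn_if_mult dl_sum dl_add dl_sgn_if
    apply (intro conjI)
       apply (simp_all add: 1 sum.distrib sum_subtractf sgn_if_add sgn_if_diff assms k sum_negf flip: sgn_if_sum dl_sum)
    done
qed

lemma
  assumes "i \<in> S" "j \<in> S" "k \<in> S" "l \<in> S"
  shows e_E: "e i j * E m k l = E m k l * e i j + dl j k (E m i l) - dl l i (E m k j)"
    and e_F: "e i j * F m k l = F m k l * e i j + dl j k (F m i l) - dl l i (F m k j)"
    and f_E: "f i j * E m k l = E m k l * f i j - sgn_if m (dl j k (F m i l)) - dl l i (F m k j)"
    and f_F: "f i j * F m k l = - (F m k l * f i j) - sgn_if m (dl j k (E m i l)) + dl l i (E m k j)"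
  using gen_comm[OF assms(1,2,4,3), of m] by (auto simp: algebra_simps eq_diff_eq)

text \<open>In the closed formulas \<open>RTT\<close> the first factor carries the indices \<open>i\<close>, \<open>l\<close> and the second one
  \<open>k\<close>, \<open>j\<close>: in this order, expanding the first factor reproduces the recursion of the commutator
  without any reordering.\<close>

definition up :: "(nat \<Rightarrow> 'i \<Rightarrow> 'i \<Rightarrow> 'a) \<Rightarrow> (nat \<Rightarrow> 'i \<Rightarrow> 'i \<Rightarrow> 'a) \<Rightarrow> nat \<Rightarrow> nat \<Rightarrow> 'i \<Rightarrow> 'i \<Rightarrow> 'i \<Rightarrow> 'i \<Rightarrow> 'a" where
  "up X Y m r i j k l = (\<Sum>s<m. X (m - Suc s + r) i l * Y s k j)"

definition up' :: "(nat \<Rightarrow> 'i \<Rightarrow> 'i \<Rightarrow> 'a) \<Rightarrow> (nat \<Rightarrow> 'i \<Rightarrow> 'i \<Rightarrow> 'a) \<Rightarrow> nat \<Rightarrow> nat \<Rightarrow> 'i \<Rightarrow> 'i \<Rightarrow> 'i \<Rightarrow> 'i \<Rightarrow> 'a" where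
  "up' X Y m r i j k l = (\<Sum>s<m. sgn_if (r + s) (X (m - Suc s + r) i l * Y s k j))"

definition dn :: "(nat \<Rightarrow> 'i \<Rightarrow> 'i \<Rightarrow> 'a) \<Rightarrow> (nat \<Rightarrow> 'i \<Rightarrow> 'i \<Rightarrow> 'a) \<Rightarrow> nat \<Rightarrow> nat \<Rightarrow> 'i \<Rightarrow> 'i \<Rightarrow> 'i \<Rightarrow> 'i \<Rightarrow> 'a" where
  "dn X Y m r i j k l = (\<Sum>s<m. X s i l * Y (m - Suc s + r) k j)"

definition dn' :: "(nat \<Rightarrow> 'i \<Rightarrow> 'i \<Rightarrow> 'a) \<Rightarrow> (nat \<Rightarrow> 'i \<Rightarrow> 'i \<Rightarrow> 'a) \<Rightarrow> nat \<Rightarrow> nat \<Rightarrow> 'i \<Rightarrow> 'i \<Rightarrow> 'i \<Rightarrow> 'i \<Rightarrow> 'a" where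
  "dn' X Y m r i j k l = (\<Sum>s<m. sgn_if (m + s) (X s i l * Y (m - Suc s + r) k j))"

text \<open>The recursion common to \<open>(E, F)\<close> and \<open>(F, E)\<close>, so that each
  step lemma for the four sums covers both.\<close>

definition shift_pair :: "(nat \<Rightarrow> 'i \<Rightarrow> 'i \<Rightarrow> 'a) \<Rightarrow> (nat \<Rightarrow> 'i \<Rightarrow> 'i \<Rightarrow> 'a) \<Rightarrow> bool" where
  "shift_pair X X' \<longleftrightarrow> (\<forall>m i j. X (Suc m) i j = (\<Sum>a\<in>S. e i a * X m a j + sgn_if m (f i a * X' m a j)))"

lemma shift_pair_EF: "shift_pair E F" "shift_pair F E"
  by (auto simp: shift_pair_def E_Suc F_Suc)

lemma swap_sums:
  fixes h :: "nat \<Rightarrow> 'i \<Rightarrow> 'a"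
  shows "(\<Sum>s<m. (\<Sum>a\<in>S. h s a)) = (\<Sum>a\<in>S. (\<Sum>s<m. h s a))"
  by (rule sum.swap)

lemma sgn_if_parity: "sgn_if (Suc m + Suc s) x = sgn_if (m + s) x"
  by simp

text \<open>The recursion applied to the first factor puts the sign of its own superscript,
  \<open>(-1)^(m - s - 1 + r)\<close>, on the odd part, while the commutator recursion carries
  \<open>(-1)^m\<close>. The quotient \<open>-(-1)^(r + s)\<close> depends on \<open>s\<close>; this
  is what the signed sum \<open>up'\<close> records. The signs in \<open>dn'\<close> arise in the
  same way.\<close>

lemma up_Suc:
  assumes "shift_pair X X'"
  shows "up X Y (Suc m) r i j k l =
    (\<Sum>a\<in>S. e i a * up X Y m r a j k l - sgn_if m (f i a * up' X' Y m r a j k l)) + X r i l * Y m k j"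
proof -
  have *: "(\<Sum>s<m. X (m - s + r) i l * Y s k j) = 
     (\<Sum>s<m. (\<Sum>a\<in>S. e i a * (X (m - Suc s + r) a l * Y s k j) 
        - sgn_if m (f i a * sgn_if (r + s) (X' (m - Suc s + r) a l * Y s k j))))"
  proof (rule sum.cong[OF refl])
    fix s assume s: "s \<in> {..<m}"
    then have 1: "m - s + r = Suc (m - Suc s + r)" by auto
    have 2: "sgn_if (m - Suc s + r) x = - sgn_if m (sgn_if (r + s) x)" for x :: 'a
      using s by (auto simp: sgn_if_def)
    show "X (m - s + r) i l * Y s k j = (\<Sum>a\<in>S. e i a * (X (m - Suc s + r) a l * Y s k j) 
        - sgn_if m (f i a * sgn_if (r + s) (X' (m - Suc s + r) a l * Y s k j)))"
      unfolding 1 assms[unfolded shift_pair_def, rule_format] sum_distrib_right 2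
      by (simp add: algebra_simps sgn_if_mult)
  qed
  show ?thesis
    unfolding up_def up'_def sum.lessThan_Suc diff_Suc_Suc * swap_sums
    by (simp add: sum_distrib_left sgn_if_sum sum_subtractf)
qed

lemma up'_Suc:
  assumes "shift_pair X X'"
  shows "up' X Y (Suc m) r i j k l =
    (\<Sum>a\<in>S. e i a * up' X Y m r a j k l - sgn_if m (f i a * up X' Y m r a j k l)) 
       + sgn_if (m + r) (X r i l * Y m k j)"
proof -
  have *: "(\<Sum>s<m. sgn_if (r + s) (X (m - s + r) i l * Y s k j)) = 
     (\<Sum>s<m. (\<Sum>a\<in>S. e i a * (sgn_if (r + s) (X (m - Suc s + r) a l * Y s k j))
        - sgn_if m (f i a * (X' (m - Suc s + r) a l * Y s k j))))"
  proof (rule sum.cong[OF refl])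
    fix s assume s: "s \<in> {..<m}"
    then have 1: "m - s + r = Suc (m - Suc s + r)" by auto
    have 2: "sgn_if (r + s) (sgn_if (m - Suc s + r) x) = - sgn_if m x" for x :: 'a
      using s by (auto simp: sgn_if_def)
    show "sgn_if (r + s) (X (m - s + r) i l * Y s k j) = (\<Sum>a\<in>S. e i a * (sgn_if (r + s) (X (m - Suc s + r) a l * Y s k j))
        - sgn_if m (f i a * (X' (m - Suc s + r) a l * Y s k j)))"
      unfolding 1 assms[unfolded shift_pair_def, rule_format] sum_distrib_right
      by (simp add: sgn_if_sum sgn_if_add sgn_if_mult distrib_right mult.assoc 2)
  qed
  show ?thesis
    unfolding up_def up'_def sum.lessThan_Suc diff_Suc_Suc * swap_sums
    by (simp add: sum_distrib_left sgn_if_sum sum_subtractf add.commute)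
qed

lemma dn_Suc:
  assumes "shift_pair X X'"
  shows "dn X Y (Suc m) r i j k l =
    (\<Sum>a\<in>S. e i a * dn X Y m r a j k l + sgn_if m (f i a * dn' X' Y m r a j k l)) + X 0 i l * Y (m + r) k j"
proof -
  have *: "(\<Sum>s<m. X (Suc s) i l * Y (m - Suc s + r) k j) = 
     (\<Sum>s<m. (\<Sum>a\<in>S. e i a * (X s a l * Y (m - Suc s + r) k j) 
        + sgn_if m (f i a * sgn_if (m + s) (X' s a l * Y (m - Suc s + r) k j))))"
  proof (rule sum.cong[OF refl])
    fix s assume s: "s \<in> {..<m}"
    have 2: "sgn_if m (sgn_if (m + s) x) = sgn_if s x" for x :: 'a
      using s by (auto simp: sgn_if_def)
    show "X (Suc s) i l * Y (m - Suc s + r) k j = (\<Sum>a\<in>S. e i a * (X s a l * Y (m - Suc s + r) k j) 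
        + sgn_if m (f i a * sgn_if (m + s) (X' s a l * Y (m - Suc s + r) k j)))"
      unfolding assms[unfolded shift_pair_def, rule_format] sum_distrib_right
      by (simp add: algebra_simps sgn_if_mult 2)
  qed
  show ?thesis
    unfolding dn_def dn'_def sum.lessThan_Suc_shift diff_Suc_Suc sgn_if_parity *  swap_sums
    by (simp add: sum_distrib_left sgn_if_sum sum.distrib)
qed

lemma dn'_Suc:
  assumes "shift_pair X X'"
  shows "dn' X Y (Suc m) r i j k l =
    (\<Sum>a\<in>S. e i a * dn' X Y m r a j k l + sgn_if m (f i a * dn X' Y m r a j k l))
      - sgn_if m (X 0 i l * Y (m + r) k j)"
proof -
  have *: "(\<Sum>s<m. sgn_if (m + s) (X (Suc s) i l * Y (m - Suc s + r) k j)) = 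
     (\<Sum>s<m. (\<Sum>a\<in>S. e i a * sgn_if (m + s) (X s a l * Y (m - Suc s + r) k j) 
        + sgn_if m (f i a * (X' s a l * Y (m - Suc s + r) k j))))"
  proof (rule sum.cong[OF refl])
    fix s assume s: "s \<in> {..<m}"
    have 2: "sgn_if (m + s) (sgn_if s x) = sgn_if m x" for x :: 'a
      using s by (auto simp: sgn_if_def)
    show "sgn_if (m + s) (X (Suc s) i l * Y (m - Suc s + r) k j) = (\<Sum>a\<in>S. e i a * sgn_if (m + s) (X s a l * Y (m - Suc s + r) k j) 
        + sgn_if m (f i a * (X' s a l * Y (m - Suc s + r) k j)))"
      unfolding assms[unfolded shift_pair_def, rule_format] sum_distrib_right
      by (simp add: algebra_simps sgn_if_mult 2 sgn_if_sum sgn_if_add)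
  qed
  show ?thesis
    unfolding dn_def dn'_def sum.lessThan_Suc_shift diff_Suc_Suc sgn_if_parity *  swap_sums
    by (simp add: sum_distrib_left sgn_if_sum sum.distrib)
qed

text \<open>Expand the left factor once and apply the super Leibniz rule. The row term of the inner
  bracket leaves a single product; its column term leaves a contraction over \<open>a\<close>, which
  \<open>EF_add\<close> turns into one element of superscript \<open>m + r\<close>.\<close>

lemma comm_Suc:
  assumes "i \<in> S" "j \<in> S" "k \<in> S" "l \<in> S"
  shows "E (Suc m) i j * E r k l - E r k l * E (Suc m) i j =
      (\<Sum>a\<in>S. e i a * (E m a j * E r k l - E r k l * E m a j)
         + sgn_if m (f i a * (F m a j * E r k l - E r k l * F m a j)))
      + E r i l * E m k j - sgn_if (m + r) (F r i l * F m k j) - dl i l (E (m + r) k j)" (is ?EE)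
    and "F (Suc m) i j * E r k l - E r k l * F (Suc m) i j =
      (\<Sum>a\<in>S. e i a * (F m a j * E r k l - E r k l * F m a j)
         + sgn_if m (f i a * (E m a j * E r k l - E r k l * E m a j)))
      + E r i l * F m k j - sgn_if (m + r) (F r i l * E m k j) - dl i l (F (m + r) k j)" (is ?FE)
    and "E (Suc m) i j * F r k l - F r k l * E (Suc m) i j =
      (\<Sum>a\<in>S. e i a * (E m a j * F r k l - F r k l * E m a j)
         + sgn_if m (f i a * (F m a j * F r k l + F r k l * F m a j)))
      + F r i l * E m k j + sgn_if (m + r) (E r i l * F m k j) - sgn_if m (dl i l (F (m + r) k j))" (is ?EF)
    and "F (Suc m) i j * F r k l + F r k l * F (Suc m) i j =
      (\<Sum>a\<in>S. e i a * (F m a j * F r k l + F r k l * F m a j)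
         + sgn_if m (f i a * (E m a j * F r k l - F r k l * E m a j)))
      - F r i l * F m k j - sgn_if (m + r) (E r i l * E m k j) + sgn_if m (dl i l (E (m + r) k j))" (is ?FF)
proof -
  note comm = e_E[OF assms(1) _ assms(3,4), of _ r] e_F[OF assms(1) _ assms(3,4), of _ r]
    f_E[OF assms(1) _ assms(3,4), of _ r] f_F[OF assms(1) _ assms(3,4), of _ r]
  have c: "E r k l * (e i a * x) = e i a * (E r k l * x) - dl a k (E r i l * x) + dl l i (E r k a * x)"
    "F r k l * (e i a * x) = e i a * (F r k l * x) - dl a k (F r i l * x) + dl l i (F r k a * x)"
    "E r k l * (f i a * x) = f i a * (E r k l * x) + sgn_if r (dl a k (F r i l * x)) + dl l i (F r k a * x)"
    "F r k l * (f i a * x) = - (f i a * (F r k l * x)) - sgn_if r (dl a k (E r i l * x)) + dl l i (E r k a * x)"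
    if "a \<in> S" for a x
  proof -
    have h: "E r k l * e i a = e i a * E r k l - dl a k (E r i l) + dl l i (E r k a)"
      "F r k l * e i a = e i a * F r k l - dl a k (F r i l) + dl l i (F r k a)"
      "E r k l * f i a = f i a * E r k l + sgn_if r (dl a k (F r i l)) + dl l i (F r k a)"
      "F r k l * f i a = - (f i a * F r k l) - sgn_if r (dl a k (E r i l)) + dl l i (E r k a)"
      by (simp_all add: comm[OF that])
    show "E r k l * (e i a * x) = e i a * (E r k l * x) - dl a k (E r i l * x) + dl l i (E r k a * x)"
      "F r k l * (e i a * x) = e i a * (F r k l * x) - dl a k (F r i l * x) + dl l i (F r k a * x)"
      "E r k l * (f i a * x) = f i a * (E r k l * x) + sgn_if r (dl a k (F r i l * x)) + dl l i (F r k a * x)"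
      "F r k l * (f i a * x) = - (f i a * (F r k l * x)) - sgn_if r (dl a k (E r i l * x)) + dl l i (E r k a * x)"
      unfolding mult.assoc[symmetric] h
      by (simp_all add: distrib_right left_diff_distrib dl_mult sgn_if_mult)
  qed
  have k: "(\<Sum>a\<in>S. E r k a * E m a j) + sgn_if m (\<Sum>a\<in>S. F r k a * F m a j) = E (m + r) k j"
    "(\<Sum>a\<in>S. E r k a * F m a j) + sgn_if m (\<Sum>a\<in>S. F r k a * E m a j) = F (m + r) k j"
    using EF_add[OF assms(3), of r m j] by (auto simp: sum.distrib sgn_if_sum add.commute)
  have k': "sgn_if m (\<Sum>a\<in>S. E r k a * E m a j) + (\<Sum>a\<in>S. F r k a * F m a j) = sgn_if m (E (m + r) k j)"
    "sgn_if m (\<Sum>a\<in>S. E r k a * F m a j) + (\<Sum>a\<in>S. F r k a * E m a j) = sgn_if m (F (m + r) k j)"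
    using k[THEN arg_cong[of _ _ "sgn_if m"]] by (auto simp: sgn_if_add)
  note s = E_Suc F_Suc sum_distrib_right sum_distrib_left distrib_left distrib_right sgn_if_mult mult.assoc c
    sum.distrib sum_subtractf sgn_if_add sgn_if_diff sgn_if_sgn_if dl_add dl_sgn_if assms right_diff_distrib
    sum_negf
  have d: "dl l i x = dl i l x" for x :: 'a by (auto simp: dl_def)
  show ?EE ?FE ?EF ?FF
    apply (simp_all add: s flip: k k' sgn_if_sum dl_sum)
    apply (simp_all add: d)
    done
qed

text \<open>The counterpart of the expanded RTT relation for the Yangian of gl(N): in every product
  the superscripts add up to \<open>m + r - 1\<close>. The four sums obey the same recursion in
  \<open>m\<close> as the supercommutators, and the boundary terms agree because \<open>E 0\<close>
  is the Kronecker delta and \<open>F 0\<close> vanishes.\<close>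

lemma RTT:
  assumes "i \<in> S" "j \<in> S" "k \<in> S" "l \<in> S"
  shows "E m i j * E r k l - E r k l * E m i j =
      up E E m r i j k l - dn E E m r i j k l - up' F F m r i j k l - dn' F F m r i j k l \<and>
    F m i j * E r k l - E r k l * F m i j =
      up E F m r i j k l - dn E F m r i j k l - up' F E m r i j k l - dn' F E m r i j k l \<and>
    E m i j * F r k l - F r k l * E m i j =
      up F E m r i j k l + up' E F m r i j k l + dn' E F m r i j k l - dn F E m r i j k l \<and>
    F m i j * F r k l + F r k l * F m i j =
      dn F F m r i j k l - up' E E m r i j k l - dn' E E m r i j k l - up F F m r i j k l"
  using assms(1)
proof (induction m arbitrary: i)
  case 0
  then show ?case by (simp add: up_def up'_def dn_def dn'_def E_0 F_0 dl_mult)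
next
  case (Suc m)
  note IH = Suc.IH[THEN conjunct1] Suc.IH[THEN conjunct2, THEN conjunct1]
    Suc.IH[THEN conjunct2, THEN conjunct2, THEN conjunct1] Suc.IH[THEN conjunct2, THEN conjunct2, THEN conjunct2]
  note S = up_Suc[OF shift_pair_EF(1)] up_Suc[OF shift_pair_EF(2)]
    up'_Suc[OF shift_pair_EF(1)] up'_Suc[OF shift_pair_EF(2)]
    dn_Suc[OF shift_pair_EF(1)] dn_Suc[OF shift_pair_EF(2)]
    dn'_Suc[OF shift_pair_EF(1)] dn'_Suc[OF shift_pair_EF(2)]
  show ?case
    unfolding comm_Suc[OF Suc.prems assms(2-4)] S
    by (simp add: IH E_0 F_0 dl_mult sum.distrib sum_subtractf distrib_left right_diff_distrib
        sgn_if_add sgn_if_diff sgn_if_mult)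
qed

end

section \<open>The Kazhdan filtration\<close>

text \<open>The assumptions describe a left ideal containing the elements
  \<open>a - \<chi>(a)\<close>, rather than the ideal they generate, so that \<open>corner\<close>
  can interpret the locale a second time with another ideal.\<close>

locale whittaker = queer S e f for S :: "nat set" and e f :: "nat \<Rightarrow> nat \<Rightarrow> 'a::ring_1" +
  fixes n :: nat and sc :: "complex \<Rightarrow> 'a" and I :: "'a set"
  assumes n: "1 \<le> n"
    and S_def: "S = {1..n}"
    and sc_add: "sc (a + b) = sc a + sc b"
    and sc_mult: "sc (a * b) = sc a * sc b"
    and sc_1: "sc 1 = 1"
    and sc_comm: "x * sc a = sc a * x"
    and I_add: "x \<in> I \<Longrightarrow> y \<in> I \<Longrightarrow> x + y \<in> I"
    and I_mult: "x \<in> I \<Longrightarrow> y * x \<in> I"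
    and I_e: "\<lbrakk>1 \<le> j; j < i; i \<le> n\<rbrakk> \<Longrightarrow> e i j - of_bool (i = Suc j) \<in> I"
    and I_f: "\<lbrakk>1 \<le> j; j < i; i \<le> n\<rbrakk> \<Longrightarrow> f i j \<in> I"
    and I_nonempty: "I \<noteq> {}"
begin

lemma mem_S [simp]: "i \<in> S \<longleftrightarrow> 1 \<le> i \<and> i \<le> n"
  by (simp add: S_def)

lemma sc_0: "sc 0 = 0"
  using sc_add[of 0 0] by simp

lemma sc_minus_1: "sc (- 1) * x = - x"
proof -
  have "sc (- 1) = - 1"
    using sc_add[of "- 1" 1] by (simp add: sc_0 sc_1 eq_neg_iff_add_eq_0)
  then show ?thesis by simp
qed

lemma sc_of_nat: "sc (of_nat k) = of_nat k"
  by (induction k) (simp_all add: sc_0 sc_1 sc_add)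

lemma I_0: "0 \<in> I"
  using I_nonempty I_mult[of _ 0] by auto

lemma I_minus: "x \<in> I \<Longrightarrow> - x \<in> I"
  using I_mult[of x "- 1"] by simp

lemma I_diff: "x \<in> I \<Longrightarrow> y \<in> I \<Longrightarrow> x - y \<in> I"
  using I_add[of x "- y"] I_minus[of y] by simp

lemma I_sum: "(\<And>a. a \<in> A \<Longrightarrow> h a \<in> I) \<Longrightarrow> sum h A \<in> I"
  by (induction A rule: infinite_finite_induct) (auto simp: I_0 I_add)

definition chi :: "nat \<Rightarrow> nat \<Rightarrow> 'a" where "chi i j = of_bool (i = Suc j)"

lemma chi_comm: "x * chi i j = chi i j * x"
  by (simp add: chi_def)

lemma I_e_chi: "\<lbrakk>1 \<le> j; j < i; i \<le> n\<rbrakk> \<Longrightarrow> e i j - chi i j \<in> I"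
  using I_e by (simp add: chi_def)

text \<open>Half of the usual Kazhdan degree. The generators \<open>e i j\<close> with
  \<open>i = Suc j\<close>, on which \<open>\<chi>\<close> is 1, have degree 0.\<close>

definition deg :: "nat \<Rightarrow> nat \<Rightarrow> int" where "deg i j = int j - int i + 1"

text \<open>The preimage of the Kazhdan filtration of \<open>U(Q(n))/I\<^sub>\<chi>\<close>: only the upper triangular
  generators, which have positive degree, are needed to span the quotient.\<close>

inductive G :: "int \<Rightarrow> 'a \<Rightarrow> bool" where
  G_I: "x \<in> I \<Longrightarrow> G d x"
| G_1: "0 \<le> d \<Longrightarrow> G d 1"
| G_e: "\<lbrakk>1 \<le> i; i \<le> j; j \<le> n; G d x\<rbrakk> \<Longrightarrow> G (d + deg i j) (e i j * x)"
| G_f: "\<lbrakk>1 \<le> i; i \<le> j; j \<le> n; G d x\<rbrakk> \<Longrightarrow> G (d + deg i j) (f i j * x)"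
| G_add: "G d x \<Longrightarrow> G d y \<Longrightarrow> G d (x + y)"
| G_sc: "G d x \<Longrightarrow> G d (sc c * x)"

lemma G_mono: "G d x \<Longrightarrow> d \<le> d' \<Longrightarrow> G d' x"
proof (induction arbitrary: d' rule: G.induct)
  case (G_e i j d x)
  then show ?case using G.G_e[of i j "d' - deg i j" x] by simp
next
  case (G_f i j d x)
  then show ?case using G.G_f[of i j "d' - deg i j" x] by simp
qed (auto intro: G.intros)

lemma G_minus: "G d x \<Longrightarrow> G d (- x)"
  using G_sc[of d x "- 1"] by (simp add: sc_minus_1)

lemma G_diff: "G d x \<Longrightarrow> G d y \<Longrightarrow> G d (x - y)"
  using G_add[of d x "- y"] G_minus[of d y] by simp

lemma G_0: "G d 0"
  by (simp add: G_I I_0)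

text \<open>The generators used to build \<open>G\<close> have degree at least 1, so outside
  \<open>I\<close> nothing of negative degree arises. This ends the descending inductions on the
  degree.\<close>

lemma G_neg: "G d x \<Longrightarrow> d < 0 \<Longrightarrow> x \<in> I"
  by (induction rule: G.induct) (auto simp: deg_def I_mult I_add)

text \<open>The conclusion of \<open>G_lower\<close> is a hypothesis here, since the induction
  proving \<open>G_lower\<close> needs this statement for the shorter word \<open>x\<close>.\<close>

lemma G_gen:
  assumes G: "G d x" and IH: "\<forall>i j. 1 \<le> j \<and> j < i \<and> i \<le> n \<longrightarrow>
    G (d + deg i j - 1) ((e i j - chi i j) * x) \<and> G (d + deg i j - 1) (f i j * x)"
    and pq: "1 \<le> p" "p \<le> n" "1 \<le> q" "q \<le> n"
  shows "G (d + deg p q) (e p q * x)" "G (d + deg p q) (f p q * x)"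
proof -
    show "G (d + deg p q) (e p q * x)"
    proof (cases "p \<le> q")
      case False
      then have "G (d + deg p q - 1) ((e p q - chi p q) * x)" using IH pq by auto
      then have "G (d + deg p q) ((e p q - chi p q) * x)" by (rule G_mono) simp
      moreover have "G (d + deg p q) (chi p q * x)"
        using G by (auto simp: chi_def deg_def G_0)
      ultimately show ?thesis using G.G_add by (fastforce simp: left_diff_distrib)
    qed (use pq G in \<open>auto intro: G.G_e\<close>)
    show "G (d + deg p q) (f p q * x)"
    proof (cases "p \<le> q")
      case False
      then have "G (d + deg p q - 1) (f p q * x)" using IH pq by auto
      then show ?thesis by (rule G_mono) simp
    qed (use pq G in \<open>auto intro: G.G_f\<close>)
qed

text \<open>Applied to 1 these elements lie in \<open>I\<close>. Moving them past a generator costs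
  a bracket, whose degree is one less than that of the product. The bracket may contain generators
  of any shape, which \<open>G_gen\<close> handles.\<close>

lemma G_lower:
  assumes "G d x"
  shows "\<forall>i j. 1 \<le> j \<and> j < i \<and> i \<le> n \<longrightarrow>
    G (d + deg i j - 1) ((e i j - chi i j) * x) \<and> G (d + deg i j - 1) (f i j * x)"
  using assms
proof (induction rule: G.induct)
  case (G_I x d)
  then show ?case by (auto intro: G.G_I I_mult)
next
  case (G_1 d)
  then show ?case using I_e_chi I_f by (auto intro: G.G_I)
next
  case (G_add d x y)
  then show ?case by (auto simp: distrib_left intro!: G.G_add)
next
  case (G_sc d x c)
  have "y * (sc c * x) = sc c * (y * x)" for y
    by (metis sc_comm mult.assoc)
  then show ?case using G_sc by (auto intro!: G.G_sc)
next
  case (G_e k l d x)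
  note lo = G_gen[OF G_e.hyps(4) G_e.IH]
  show ?case
  proof (intro allI impI)
    fix i j assume ij: "1 \<le> j \<and> j < i \<and> i \<le> n"
    have IH: "G (d + deg i j - 1 + deg k l) (e k l * ((e i j - chi i j) * x))"
      "G (d + deg i j - 1 + deg k l) (e k l * (f i j * x))"
      using G_e.IH ij G_e.hyps by (auto intro!: G.G_e)
    have t: "G (d + deg i j - 1 + deg k l) (dl j k (e i l * x))" "G (d + deg i j - 1 + deg k l) (dl l i (e k j * x))"
      "G (d + deg i j - 1 + deg k l) (dl j k (f i l * x))" "G (d + deg i j - 1 + deg k l) (dl l i (f k j * x))"
      using lo[of i l] lo[of k j] ij G_e.hyps by (auto simp: dl_def G_0 deg_def add_ac diff_add_eq)
    have c: "(e i j - chi i j) * (e k l * x) = e k l * ((e i j - chi i j) * x) + dl j k (e i l * x) - dl l i (e k j * x)"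
      unfolding left_diff_distrib mult.assoc[symmetric] right_diff_distrib
      using ij G_e.hyps by (simp add: ee[of i j k l] algebra_simps dl_mult chi_def)
    have c': "f i j * (e k l * x) = e k l * (f i j * x) + dl j k (f i l * x) - dl l i (f k j * x)"
      using ij G_e.hyps unfolding mult.assoc[symmetric] by (simp add: fe[of i j k l] distrib_right left_diff_distrib dl_mult)
    have d: "d + deg k l + deg i j - 1 = d + deg i j - 1 + deg k l" by simp
    show "G (d + deg k l + deg i j - 1) ((e i j - chi i j) * (e k l * x)) \<and>
           G (d + deg k l + deg i j - 1) (f i j * (e k l * x))"
      unfolding d c c' using IH t by (intro conjI G.G_add G_diff)
  qed
next
  case (G_f k l d x)
  note lo = G_gen[OF G_f.hyps(4) G_f.IH]
  show ?case
  proof (intro allI impI)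
    fix i j assume ij: "1 \<le> j \<and> j < i \<and> i \<le> n"
    have IH: "G (d + deg i j - 1 + deg k l) (f k l * ((e i j - chi i j) * x))"
      "G (d + deg i j - 1 + deg k l) (f k l * (f i j * x))"
      using G_f.IH ij G_f.hyps by (auto intro!: G.G_f)
    have t: "G (d + deg i j - 1 + deg k l) (dl j k (e i l * x))" "G (d + deg i j - 1 + deg k l) (dl l i (e k j * x))"
      "G (d + deg i j - 1 + deg k l) (dl j k (f i l * x))" "G (d + deg i j - 1 + deg k l) (dl l i (f k j * x))"
      using lo[of i l] lo[of k j] ij G_f.hyps by (auto simp: dl_def G_0 deg_def add_ac diff_add_eq)
    have c: "(e i j - chi i j) * (f k l * x) = f k l * ((e i j - chi i j) * x) + dl j k (f i l * x) - dl l i (f k j * x)"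
      unfolding left_diff_distrib mult.assoc[symmetric] right_diff_distrib
      using ij G_f.hyps by (simp add: ef[of i j k l] algebra_simps dl_mult chi_def)
    have c': "f i j * (f k l * x) = dl j k (e i l * x) + dl l i (e k j * x) - f k l * (f i j * x)"
      using ij G_f.hyps unfolding mult.assoc[symmetric] by (simp add: ff[of i j k l] distrib_right left_diff_distrib dl_mult)
    have d: "d + deg k l + deg i j - 1 = d + deg i j - 1 + deg k l" by simp
    show "G (d + deg k l + deg i j - 1) ((e i j - chi i j) * (f k l * x)) \<and>
           G (d + deg k l + deg i j - 1) (f i j * (f k l * x))"
      unfolding d c c' using IH t by (intro conjI G.G_add G_diff)
  qed
qed

text \<open>Since \<open>U/I\<close> is only a left module, the degree of a ring element is measured
  by how far left multiplication shifts \<open>G\<close>. In this sense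
  \<open>e i j - chi i j\<close> with \<open>j < i\<close> has a smaller degree than
  \<open>e i j\<close>.\<close>

definition Fil :: "int \<Rightarrow> 'a \<Rightarrow> bool" where
  "Fil d r \<longleftrightarrow> (\<forall>c x. G c x \<longrightarrow> G (c + d) (r * x))"

lemma Fil_G: "Fil d r \<Longrightarrow> G c x \<Longrightarrow> c + d \<le> c' \<Longrightarrow> G c' (r * x)"
  using G_mono[of "c + d" "r * x" c'] by (auto simp: Fil_def)

lemma Fil_mono: "Fil d r \<Longrightarrow> d \<le> d' \<Longrightarrow> Fil d' r"
  using G_mono by (fastforce simp: Fil_def)

lemma Fil_0: "Fil d 0"
  by (simp add: Fil_def G_0)

lemma Fil_1: "0 \<le> d \<Longrightarrow> Fil d 1"
  by (auto simp: Fil_def intro: G_mono)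

lemma Fil_add: "Fil d r \<Longrightarrow> Fil d s \<Longrightarrow> Fil d (r + s)"
  and Fil_diff: "Fil d r \<Longrightarrow> Fil d s \<Longrightarrow> Fil d (r - s)"
  and Fil_minus: "Fil d r \<Longrightarrow> Fil d (- r)"
  by (auto simp: Fil_def distrib_right left_diff_distrib intro: G.G_add G_diff G_minus)

lemma Fil_sgn_if: "Fil d r \<Longrightarrow> Fil d (sgn_if m r)"
  by (simp add: sgn_if_def Fil_minus)

lemma Fil_dl: "(a = b \<Longrightarrow> Fil d r) \<Longrightarrow> Fil d (dl a b r)"
  by (simp add: dl_def Fil_0)

lemma Fil_mult: "Fil p r \<Longrightarrow> Fil q s \<Longrightarrow> p + q \<le> d \<Longrightarrow> Fil d (r * s)"
  unfolding Fil_def mult.assoc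
proof (intro allI impI)
  fix c x assume *: "\<forall>c x. G c x \<longrightarrow> G (c + p) (r * x)" "\<forall>c x. G c x \<longrightarrow> G (c + q) (s * x)" "p + q \<le> d" "G c x"
  then have "G (c + q + p) (r * (s * x))" by blast
  then show "G (c + d) (r * (s * x))" by (rule G_mono) (use * in simp)
qed

lemma Fil_sum: "(\<And>a. a \<in> A \<Longrightarrow> Fil d (h a)) \<Longrightarrow> Fil d (sum h A)"
  by (induction A rule: infinite_finite_induct) (auto simp: Fil_0 Fil_add)

lemma Fil_lower:
  assumes "1 \<le> j" "j < i" "i \<le> n"
  shows "Fil (int j - int i) (e i j - chi i j)" "Fil (int j - int i) (f i j)"
  using G_lower assms unfolding Fil_def by (auto simp: deg_def)

lemma Fil_gen:
  assumes "i \<in> S" "j \<in> S"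
  shows "Fil (int j - int i + 1) (e i j)" "Fil (int j - int i + 1) (f i j)"
  using G_gen[OF _ G_lower] assms unfolding Fil_def by (auto simp: deg_def)

lemma Fil_EF:
  assumes "i \<in> S" "j \<in> S"
  shows "Fil (int m + int j - int i) (E m i j) \<and> Fil (int m + int j - int i) (F m i j)"
  using assms
proof (induction m arbitrary: i)
  case 0
  then show ?case by (auto simp: E_0 F_0 Fil_0 intro!: Fil_dl Fil_1)
next
  case (Suc m)
  then show ?case unfolding E_Suc F_Suc
    by (auto intro!: Fil_sum Fil_add Fil_sgn_if Fil_mult[where p = "int k - int i + 1" and q = "int m + int j - int k" for k]
       Fil_gen)
qed

lemmas Fil_E = Fil_EF[THEN conjunct1] and Fil_F = Fil_EF[THEN conjunct2]

section \<open>The first column of Sergeev's elements and its leading terms\<close>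

definition cE :: "nat \<Rightarrow> nat \<Rightarrow> 'a" where "cE m j = E m j 1"
definition cF :: "nat \<Rightarrow> nat \<Rightarrow> 'a" where "cF m j = F m j 1"

lemma cE_0: "cE 0 j = of_bool (j = 1)" and cF_0: "cF 0 j = 0"
  by (simp_all add: cE_def cF_def E_0 F_0 dl_def)

lemma cE_Suc: "cE (Suc m) j = (\<Sum>a\<in>S. e j a * cE m a + sgn_if m (f j a * cF m a))"
  and cF_Suc: "cF (Suc m) j = (\<Sum>a\<in>S. e j a * cF m a + sgn_if m (f j a * cE m a))"
  unfolding cE_def cF_def E_Suc F_Suc by simp_all

lemma Fil_cE: "j \<in> S \<Longrightarrow> int m + 1 - int j \<le> d \<Longrightarrow> Fil d (cE m j)"
  and Fil_cF: "j \<in> S \<Longrightarrow> int m + 1 - int j \<le> d \<Longrightarrow> Fil d (cF m j)"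
  unfolding cE_def cF_def using Fil_E[of j 1 m] Fil_F[of j 1 m] n by (auto intro: Fil_mono)

lemma sum_split_at:
  fixes h :: "nat \<Rightarrow> 'a"
  assumes "j \<in> S"
  shows "sum h S = sum h {1..<j} + sum h {j..n}"
  using assms sum.atLeastLessThan_concat[of 1 j "Suc n" h] by (auto simp: S_def atLeastLessThanSuc_atLeastAtMost)

lemma sum_chi:
  fixes h :: "nat \<Rightarrow> 'a"
  shows "(\<Sum>k\<in>{1..<j}. chi j k * h k) = (if 2 \<le> j then h (j - 1) else 0)"
proof (cases "2 \<le> j")
  case True
  then obtain i where j: "j = Suc i" "1 \<le> i" by (cases j) auto
  then have "(\<Sum>k\<in>{1..<j}. chi j k * h k) = (\<Sum>k\<in>{1..<j}. if k = i then h k else 0)"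
    by (intro sum.cong) (auto simp: chi_def)
  then show ?thesis using j by (simp add: sum.delta)
qed auto

text \<open>The expected degree is \<open>m + 2 - j\<close>, and the error is one lower. In the
  recursion, entries \<open>e j k\<close> left of the diagonal equal \<open>chi j k\<close> up to a
  drop in degree, as do the \<open>f j k\<close> with 0, and only \<open>k = j - 1\<close>
  contributes a 1.\<close>

lemma column_rec:
  assumes j: "j \<in> S"
  shows "Fil (int m + 1 - int j) (cE (Suc m) j - (if 2 \<le> j then cE m (j - 1) else 0)
      - (\<Sum>k\<in>{j..n}. e j k * cE m k + sgn_if m (f j k * cF m k)))" (is ?E)
    and "Fil (int m + 1 - int j) (cF (Suc m) j - (if 2 \<le> j then cF m (j - 1) else 0)
      - (\<Sum>k\<in>{j..n}. e j k * cF m k + sgn_if m (f j k * cE m k)))" (is ?F)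
proof -
  have "cE (Suc m) j - (if 2 \<le> j then cE m (j - 1) else 0)
      - (\<Sum>k\<in>{j..n}. e j k * cE m k + sgn_if m (f j k * cF m k))
     = (\<Sum>k\<in>{1..<j}. (e j k - chi j k) * cE m k + sgn_if m (f j k * cF m k))"
    unfolding cE_Suc sum_split_at[OF j] sum_chi[symmetric]
    by (simp add: sum.distrib sum_subtractf left_diff_distrib)
  moreover have "Fil (int m + 1 - int j) \<dots>"
    using j by (auto intro!: Fil_sum Fil_add Fil_sgn_if Fil_mult[where p = "int k - int j" and q = "int m + 1 - int k" for k]
       Fil_lower Fil_cE Fil_cF)
  ultimately show ?E by simp
  have "cF (Suc m) j - (if 2 \<le> j then cF m (j - 1) else 0)
      - (\<Sum>k\<in>{j..n}. e j k * cF m k + sgn_if m (f j k * cE m k))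
     = (\<Sum>k\<in>{1..<j}. (e j k - chi j k) * cF m k + sgn_if m (f j k * cE m k))"
    unfolding cF_Suc sum_split_at[OF j] sum_chi[symmetric]
    by (simp add: sum.distrib sum_subtractf left_diff_distrib)
  moreover have "Fil (int m + 1 - int j) \<dots>"
    using j by (auto intro!: Fil_sum Fil_add Fil_sgn_if Fil_mult[where p = "int k - int j" and q = "int m + 1 - int k" for k]
       Fil_lower Fil_cE Fil_cF)
  ultimately show ?F by simp
qed

text \<open>The expected degree is \<open>m + 1 - j\<close>. In \<open>column_rec\<close> the sum
  over \<open>k \<ge> j\<close> is already lower by induction, so the leading value is transported
  along the diagonal from \<open>cE 0 1 = 1\<close>.\<close>

lemma column_low:
  assumes "m < j" "j \<in> S"
  shows "Fil (int m - int j) (cE m j - of_bool (j = Suc m)) \<and> Fil (int m - int j) (cF m j)"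
  using assms
proof (induction m arbitrary: j)
  case 0
  then show ?case by (auto simp: cE_0 cF_0 Fil_0)
next
  case (Suc m)
  then obtain i where i: "j = Suc i" by (cases j) auto
  with Suc.prems have j: "2 \<le> j" "j \<in> S" "i \<in> S" by auto
  have low: "Fil (int m - int k) (cE m k)" "Fil (int m - int k) (cF m k)" if "k \<in> {j..n}" for k
    using Suc.IH[of k] Suc.prems that by auto
  have IH: "Fil (int m + 1 - int j) (cE m (j - 1) - of_bool (j = Suc (Suc m)))" "Fil (int m + 1 - int j) (cF m (j - 1))"
    using Suc.IH[of i] Suc.prems j(3) by (auto simp: i algebra_simps)
  have sums: "Fil (int m + 1 - int j) (\<Sum>k\<in>{j..n}. e j k * cE m k + sgn_if m (f j k * cF m k))"
    "Fil (int m + 1 - int j) (\<Sum>k\<in>{j..n}. e j k * cF m k + sgn_if m (f j k * cE m k))"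
    using j by (auto intro!: Fil_sum Fil_add Fil_sgn_if low Fil_gen
       Fil_mult[where p = "int k - int j + 1" and q = "int m - int k" for k])
  have "Fil (int m + 1 - int j) (cE (Suc m) j - of_bool (j = Suc (Suc m)))"
    using Fil_add[OF Fil_add[OF column_rec(1)[OF j(2), of m] sums(1)] IH(1)] j by (simp add: algebra_simps)
  moreover have "Fil (int m + 1 - int j) (cF (Suc m) j)"
    using Fil_add[OF Fil_add[OF column_rec(2)[OF j(2), of m] sums(2)] IH(2)] j by (simp add: algebra_simps)
  ultimately show ?case by (simp add: algebra_simps)
qed

text \<open>A bracket with a generator changes the row or the column of an element. The column term
  is absent because \<open>i\<close> differs from the column index 1; for \<open>k = n\<close> and
  \<open>j < i \<le> n\<close> the row term disappears too, so the last row supercommutes with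
  \<open>\<mm>\<close>.\<close>

lemma cols:
  assumes "i \<in> S" "j \<in> S" "i \<noteq> 1" and that: "k \<in> S"
  shows "e i j * cE m k = cE m k * e i j + dl j k (cE m i)" 
    and "e i j * cF m k = cF m k * e i j + dl j k (cF m i)" 
    and "f i j * cE m k = cE m k * f i j - sgn_if m (dl j k (cF m i))" 
    and "f i j * cF m k = - (cF m k * f i j) - sgn_if m (dl j k (cE m i))"
  using e_E[OF assms(1,2) that, of 1] e_F[OF assms(1,2) that, of 1] f_E[OF assms(1,2) that, of 1] 
    f_F[OF assms(1,2) that, of 1] assms(3) n unfolding cE_def cF_def by (auto simp: dl_def)

lemma Fil_col_sums:
  assumes "i \<in> S" "k \<in> S" "X = E \<or> X = F" "Y = E \<or> Y = F" "int m + int r + 1 - int i - int k \<le> d"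
  shows "Fil d (up X Y m r i 1 k 1)" "Fil d (up' X Y m r i 1 k 1)"
    "Fil d (dn X Y m r i 1 k 1)" "Fil d (dn' X Y m r i 1 k 1)"
proof -
  have XY: "Fil (int s + 1 - int a) (X s a 1)" "Fil (int s + 1 - int a) (Y s a 1)" if "a \<in> S" for s a
    using assms(3,4) Fil_cE[OF that, of s] Fil_cF[OF that, of s] unfolding cE_def cF_def by auto
  have 1: "Fil d (X s i 1 * Y t k 1)" if "s + t + 1 = m + r" for s t
    by (rule Fil_mult[OF XY(1)[OF assms(1)] XY(2)[OF assms(2)]]) (use that assms in linarith)
  show "Fil d (up X Y m r i 1 k 1)" "Fil d (up' X Y m r i 1 k 1)"
    "Fil d (dn X Y m r i 1 k 1)" "Fil d (dn' X Y m r i 1 k 1)"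
    unfolding up_def up'_def dn_def dn'_def
    by (intro Fil_sum Fil_sgn_if 1; simp)+
qed

text \<open>By \<open>RTT\<close> the total superscript drops by one, so the degree is one below the
  expected \<open>m + r + 2 - i - k\<close>: to leading order the first-column elements
  supercommute.\<close>

lemma Fil_col_comm:
  assumes "i \<in> S" "k \<in> S" "int m + int r + 1 - int i - int k \<le> d"
  shows "Fil d (cE m i * cE r k - cE r k * cE m i)" "Fil d (cF m i * cE r k - cE r k * cF m i)"
    "Fil d (cE m i * cF r k - cF r k * cE m i)" "Fil d (cF m i * cF r k + cF r k * cF m i)"
proof -
  have 1: "1 \<in> S" using n by simp
  note R = RTT[OF assms(1) 1 assms(2) 1, of m r]
  show "Fil d (cE m i * cE r k - cE r k * cE m i)" "Fil d (cF m i * cE r k - cE r k * cF m i)"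
    "Fil d (cE m i * cF r k - cF r k * cE m i)" "Fil d (cF m i * cF r k + cF r k * cF m i)"
    unfolding cE_def cF_def R[THEN conjunct1] R[THEN conjunct2, THEN conjunct1]
      R[THEN conjunct2, THEN conjunct2, THEN conjunct1] R[THEN conjunct2, THEN conjunct2, THEN conjunct2]
    by (intro Fil_add Fil_diff Fil_col_sums assms; simp)+
qed

section \<open>Whittaker vectors\<close>

text \<open>Write \<open>u\<close> for the generators \<open>cE m j\<close>, \<open>cF m j\<close> with \<open>j \<le> m < n\<close> and \<open>z\<close> for those with
  \<open>j = n \<le> m\<close>; both have degree \<open>m - j + 1\<close>. Modulo \<open>G (d - 1)\<close>, \<open>J k d\<close> is spanned by the words of
  degree at most \<open>d\<close> in these generators that contain at least \<open>k\<close> letters \<open>u\<close>.\<close>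

inductive J :: "nat \<Rightarrow> int \<Rightarrow> 'a \<Rightarrow> bool" where
  J_G: "G (d - 1) x \<Longrightarrow> J k d x"
| J_1: "0 \<le> d \<Longrightarrow> J 0 d 1"
| J_uE: "\<lbrakk>1 \<le> j; j \<le> m; m < n; J k d x; k' \<le> Suc k\<rbrakk> \<Longrightarrow> J k' (d + int m + 1 - int j) (cE m j * x)"
| J_uF: "\<lbrakk>1 \<le> j; j \<le> m; m < n; J k d x; k' \<le> Suc k\<rbrakk> \<Longrightarrow> J k' (d + int m + 1 - int j) (cF m j * x)"
| J_zE: "\<lbrakk>n \<le> m; J k d x\<rbrakk> \<Longrightarrow> J k (d + int m + 1 - int n) (cE m n * x)"
| J_zF: "\<lbrakk>n \<le> m; J k d x\<rbrakk> \<Longrightarrow> J k (d + int m + 1 - int n) (cF m n * x)"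
| J_add: "J k d x \<Longrightarrow> J k d y \<Longrightarrow> J k d (x + y)"
| J_sc: "J k d x \<Longrightarrow> J k d (sc c * x)"

lemma J_minus: "J k d x \<Longrightarrow> J k d (- x)"
  using J_sc[of k d x "- 1"] by (simp add: sc_minus_1)

lemma J_diff: "J k d x \<Longrightarrow> J k d y \<Longrightarrow> J k d (x - y)"
  using J_add[of k d x "- y"] J_minus[of k d y] by simp

lemma J_sgn_if: "J k d x \<Longrightarrow> J k d (sgn_if m x)"
  by (simp add: sgn_if_def J_minus)

lemma J_0: "J k d 0"
  by (simp add: G_0 J_G)

lemma J_sum: "(\<And>a. a \<in> A \<Longrightarrow> J k d (h a)) \<Longrightarrow> J k d (sum h A)"
  by (induction A rule: infinite_finite_induct) (auto simp: J_0 J_add)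

lemma J_imp_G: "J k d x \<Longrightarrow> G d x"
proof (induction rule: J.induct)
  case (J_G d x k)
  then show ?case by (rule G_mono) simp
next
  case (J_uE j m k d x k')
  then show ?case by (auto intro: Fil_G[OF Fil_cE])
next
  case (J_uF j m k d x k')
  then show ?case by (auto intro: Fil_G[OF Fil_cF])
next
  case (J_zE m k d x)
  then show ?case using n by (auto intro: Fil_G[OF Fil_cE])
next
  case (J_zF m k d x)
  then show ?case using n by (auto intro: Fil_G[OF Fil_cF])
qed (auto intro: G.intros)

text \<open>Every letter has degree at least 1, so a word with \<open>k\<close> letters
  \<open>u\<close> has degree at least \<open>k\<close>. If \<open>d < k\<close>, only the
  contribution of \<open>G (d - 1)\<close> is left.\<close>

lemma J_large: "J k d x \<Longrightarrow> d < int k \<Longrightarrow> G (d - 1) x"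
proof (induction rule: J.induct)
  case (J_uE j m k d x k')
  then have "G (d - 1) x" by simp
  then show ?case using J_uE.hyps by (auto intro: Fil_G[OF Fil_cE])
next
  case (J_uF j m k d x k')
  then have "G (d - 1) x" by simp
  then show ?case using J_uF.hyps by (auto intro: Fil_G[OF Fil_cF])
next
  case (J_zE m k d x)
  then have "G (d - 1) x" by simp
  then show ?case using n by (auto intro: Fil_G[OF Fil_cE])
next
  case (J_zF m k d x)
  then have "G (d - 1) x" by simp
  then show ?case using n by (auto intro: Fil_G[OF Fil_cF])
qed (auto intro: G.intros)

text \<open>The factor \<open>r\<close> has less than its allotted degree \<open>p\<close>, so the
  product vanishes in the associated graded module and any count of letters may be claimed.\<close>

lemma J_low: "Fil (p - 1) r \<Longrightarrow> J k d x \<Longrightarrow> d + p \<le> c \<Longrightarrow> J k' c (r * x)"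
  by (rule J_G, rule Fil_G[OF _ J_imp_G]) auto

text \<open>In the associated graded algebra \<open>Eu\<close> is a derivation that kills the \<open>z\<close>-generators
  and maps every \<open>u\<close>-generator to itself plus a quadratic term in the \<open>u\<close>'s.\<close>

definition Eu :: 'a where
  "Eu = (\<Sum>p\<in>S. \<Sum>q\<in>{1..<p}. cE (p - 1) q * (e p q - chi p q) + sgn_if p (cF (p - 1) q) * f p q)"

lemma Eu_I:
  assumes "\<And>i j. 1 \<le> j \<Longrightarrow> j < i \<Longrightarrow> i \<le> n \<Longrightarrow> (e i j - chi i j) * y \<in> I \<and> f i j * y \<in> I"
  shows "Eu * y \<in> I"
  unfolding Eu_def sum_distrib_right distrib_right mult.assoc
  by (intro I_sum I_add; rule I_mult) (use assms in auto)

lemma Fil_Eu_sum: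
  assumes "\<And>p q. \<lbrakk>p \<in> S; q \<in> S; q < p\<rbrakk> \<Longrightarrow> Fil (d + int p - int q) (h p q)"
    "\<And>p q. \<lbrakk>p \<in> S; q \<in> S; q < p\<rbrakk> \<Longrightarrow> Fil (d + int p - int q) (h' p q)"
  shows "Fil d (\<Sum>p\<in>S. \<Sum>q\<in>{1..<p}. h p q * (e p q - chi p q) + h' p q * f p q)"
proof (intro Fil_sum Fil_add)
  fix p q assume pq: "p \<in> S" "q \<in> {1..<p}"
  then have q: "q \<in> S" "q < p" by auto
  show "Fil d (h p q * (e p q - chi p q))"
    by (rule Fil_mult[OF assms(1)[OF pq(1) q] Fil_lower(1)]) (use pq in auto)
  show "Fil d (h' p q * f p q)"
    by (rule Fil_mult[OF assms(2)[OF pq(1) q] Fil_lower(2)]) (use pq in auto)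
qed

lemma Fil_Eu: "Fil 0 Eu"
  unfolding Eu_def
  by (intro Fil_Eu_sum Fil_sgn_if Fil_cE Fil_cF) (auto simp: of_nat_diff)

text \<open>By \<open>cols\<close>, \<open>e p q\<close> and \<open>f p q\<close> move a column
  element from row \<open>q\<close> to row \<open>p\<close>, which produces the sum; commuting the
  coefficients of \<open>Eu\<close> with that element costs only lower degree. For
  \<open>j = n\<close> the sum is empty, which is why \<open>Eu\<close> kills the
  \<open>z\<close>-generators.\<close>

lemma Eu_col:
  assumes "j \<in> S"
  shows "Fil (int m - int j) (Eu * cE m j - cE m j * Eu -
      (\<Sum>p\<in>{Suc j..n}. cE (p - 1) j * cE m p - sgn_if (p + m) (cF (p - 1) j * cF m p)))" (is ?E)
    and "Fil (int m - int j) (Eu * cF m j - cF m j * Eu -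
      (\<Sum>p\<in>{Suc j..n}. cE (p - 1) j * cF m p - sgn_if (p + m) (cF (p - 1) j * cE m p)))" (is ?F)
proof -
  have dlsum: "(\<Sum>p\<in>S. \<Sum>q\<in>{1..<p}. dl q j (h p)) = sum h {Suc j..n}" for h :: "nat \<Rightarrow> 'a"
  proof -
    have "(\<Sum>p\<in>S. \<Sum>q\<in>{1..<p}. dl q j (h p)) = (\<Sum>p\<in>S. if j < p then h p else 0)"
      using assms by (intro sum.cong) (auto simp: dl_def sum.delta)
    also have "\<dots> = sum h {Suc j..n}"
      using assms by (intro sum.mono_neutral_cong_right) (auto simp: S_def)
    finally show ?thesis .
  qed
  have 1: "Eu * cE m j - cE m j * Eu - (\<Sum>p\<in>{Suc j..n}. cE (p - 1) j * cE m p - sgn_if (p + m) (cF (p - 1) j * cF m p))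
    = (\<Sum>p\<in>S. \<Sum>q\<in>{1..<p}. (cE (p - 1) q * cE m j - cE m j * cE (p - 1) q) * (e p q - chi p q)
        + sgn_if p (cF (p - 1) q * cE m j - cE m j * cF (p - 1) q) * f p q)"
    unfolding Eu_def sum_distrib_left sum_distrib_right dlsum[symmetric] sum_subtractf[symmetric]
  proof (intro sum.cong refl)
    fix p q assume pq: "p \<in> S" "q \<in> {1..<p}"
    then have "q \<in> S" "p \<noteq> 1" by auto
    note c = cols[OF pq(1) this assms]
    have "(e p q - chi p q) * cE m j = cE m j * (e p q - chi p q) + dl q j (cE m p)"
      by (simp add: left_diff_distrib right_diff_distrib c chi_comm)
    then show "(cE (p - 1) q * (e p q - chi p q) + sgn_if p (cF (p - 1) q) * f p q) * cE m j -
          cE m j * (cE (p - 1) q * (e p q - chi p q) + sgn_if p (cF (p - 1) q) * f p q) -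
          dl q j (cE (p - 1) j * cE m p - sgn_if (p + m) (cF (p - 1) j * cF m p)) =
          (cE (p - 1) q * cE m j - cE m j * cE (p - 1) q) * (e p q - chi p q) +
          sgn_if p (cF (p - 1) q * cE m j - cE m j * cF (p - 1) q) * f p q"
      by (simp add: distrib_right distrib_left mult.assoc sgn_if_mult c sgn_if_add sgn_if_diff left_diff_distrib
        right_diff_distrib dl_mult) (auto simp: dl_def sgn_if_def)
  qed
  show ?E unfolding 1
    using assms by (intro Fil_Eu_sum Fil_sgn_if Fil_col_comm) (auto simp: of_nat_diff)
  have 2: "Eu * cF m j - cF m j * Eu - (\<Sum>p\<in>{Suc j..n}. cE (p - 1) j * cF m p - sgn_if (p + m) (cF (p - 1) j * cE m p))
    = (\<Sum>p\<in>S. \<Sum>q\<in>{1..<p}. (cE (p - 1) q * cF m j - cF m j * cE (p - 1) q) * (e p q - chi p q)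
        + (- sgn_if p (cF (p - 1) q * cF m j + cF m j * cF (p - 1) q)) * f p q)"
    unfolding Eu_def sum_distrib_left sum_distrib_right dlsum[symmetric] sum_subtractf[symmetric]
  proof (intro sum.cong refl)
    fix p q assume pq: "p \<in> S" "q \<in> {1..<p}"
    then have "q \<in> S" "p \<noteq> 1" by auto
    note c = cols[OF pq(1) this assms]
    have "(e p q - chi p q) * cF m j = cF m j * (e p q - chi p q) + dl q j (cF m p)"
      by (simp add: left_diff_distrib right_diff_distrib c chi_comm)
    then show "(cE (p - 1) q * (e p q - chi p q) + sgn_if p (cF (p - 1) q) * f p q) * cF m j -
          cF m j * (cE (p - 1) q * (e p q - chi p q) + sgn_if p (cF (p - 1) q) * f p q) -
          dl q j (cE (p - 1) j * cF m p - sgn_if (p + m) (cF (p - 1) j * cE m p)) =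
          (cE (p - 1) q * cF m j - cF m j * cE (p - 1) q) * (e p q - chi p q) +
          (- sgn_if p (cF (p - 1) q * cF m j + cF m j * cF (p - 1) q)) * f p q"
      by (simp add: distrib_right distrib_left mult.assoc sgn_if_mult c sgn_if_add sgn_if_diff left_diff_distrib
        right_diff_distrib dl_mult) (auto simp: dl_def sgn_if_def)
  qed
  show ?F unfolding 2
    using assms by (intro Fil_Eu_sum Fil_sgn_if Fil_minus Fil_col_comm) (auto simp: of_nat_diff)
qed

text \<open>Split the sum in \<open>Eu_col\<close> by \<open>p\<close>. For \<open>p \<le> m\<close>
  both factors are \<open>u\<close>-generators; for \<open>p > m + 1\<close> the right factor has
  lower degree. At \<open>p = m + 1\<close> the factor \<open>cE m p\<close> is 1 to leading order
  and returns the generator itself, where the sign \<open>sgn_if p\<close> in \<open>Eu\<close>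
  makes \<open>cF m j\<close> return with coefficient +1.\<close>

lemma Eu_commutator_u:
  assumes j: "1 \<le> j" "j \<le> m" "m < n" and x: "J k d x"
  shows "J (Suc (Suc k)) (d + int m + 1 - int j) ((Eu * cE m j - cE m j * Eu - cE m j) * x)" (is ?E)
    and "J (Suc (Suc k)) (d + int m + 1 - int j) ((Eu * cF m j - cF m j * Eu - cF m j) * x)" (is ?F)
proof -
  let ?J = "J (Suc (Suc k)) (d + int m + 1 - int j)"
  have jS: "j \<in> S" and mem: "Suc m \<in> {Suc j..n}" using j by auto
  have low: "?J (r * x)" if "Fil (int m - int j) r" for r
    by (rule J_low[where p = "int m - int j + 1", OF _ x]) (use that in auto)
  have quad: "?J (cX * cY * x)"
    if p: "p \<in> {Suc j..n}" "p \<le> m" and c: "cX = cE (p - 1) j \<or> cX = cF (p - 1) j" "cY = cE m p \<or> cY = cF m p"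
    for p cX cY
  proof -
    have "J (Suc k) (d + int m + 1 - int p) (cY * x)"
      using c(2) p j J_uE[of p m k d x "Suc k"] J_uF[of p m k d x "Suc k"] x by auto
    moreover obtain q where q: "p = Suc q" using p by (cases p) auto
    ultimately have "J (Suc (Suc k)) (d + int m + 1 - int p + int q + 1 - int j) (cX * (cY * x))"
      using c(1) p j J_uE[of j q "Suc k" "d + int m + 1 - int p" "cY * x" "Suc (Suc k)"]
        J_uF[of j q "Suc k" "d + int m + 1 - int p" "cY * x" "Suc (Suc k)"] by auto
    then show ?thesis by (simp add: q mult.assoc)
  qed
  have trm: "?J ((cX * cE m p - cX * of_bool (p = Suc m)) * x)" "?J (cX * cF m p * x)"
    if p: "p \<in> {Suc j..n}" and c: "cX = cE (p - 1) j \<or> cX = cF (p - 1) j"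
    for p cX
  proof -
    have "?J ((cX * cE m p - cX * of_bool (p = Suc m)) * x) \<and> ?J (cX * cF m p * x)"
    proof (cases "p \<le> m")
      case True
      then show ?thesis using quad[OF p _ c] by auto
    next
      case False
      have cX: "Fil (int p - int j) cX"
        using c Fil_cE[OF jS, of "p - 1"] Fil_cF[OF jS, of "p - 1"] p by (auto simp: of_nat_diff)
      have "p \<in> S" "m < p" using p False by auto
      then have "Fil (int m - int p) (cE m p - of_bool (p = Suc m))" "Fil (int m - int p) (cF m p)"
        using column_low[of m p] by auto
      then show ?thesis unfolding right_diff_distrib[symmetric]
        by (intro conjI low Fil_mult[OF cX]) auto
    qed
    then show "?J ((cX * cE m p - cX * of_bool (p = Suc m)) * x)" "?J (cX * cF m p * x)" by auto
  qed
  have delta: "(\<Sum>p\<in>{Suc j..n}. h p * of_bool (p = Suc m)) = h (Suc m)" for h :: "nat \<Rightarrow> 'a"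
  proof -
    have "(\<Sum>p\<in>{Suc j..n}. h p * of_bool (p = Suc m)) = (\<Sum>p\<in>{Suc j..n}. if p = Suc m then h p else 0)"
      by (intro sum.cong) auto
    then show ?thesis using mem by simp
  qed
  have "?J ((\<Sum>p\<in>{Suc j..n}. (cE (p - 1) j * cE m p - cE (p - 1) j * of_bool (p = Suc m))
       - sgn_if (p + m) (cF (p - 1) j * cF m p)) * x)"
    unfolding sum_distrib_right left_diff_distrib[of _ "sgn_if _ _"] sgn_if_mult
    by (intro J_sum J_diff J_sgn_if trm) auto
  then have 1: "?J (((\<Sum>p\<in>{Suc j..n}. cE (p - 1) j * cE m p - sgn_if (p + m) (cF (p - 1) j * cF m p)) - cE m j) * x)"
    unfolding sum_subtractf delta by (simp add: algebra_simps)
  from J_add[OF low[OF Eu_col(1)[OF jS, of m]] 1] show ?E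
    by (simp add: algebra_simps)
  have "?J ((\<Sum>p\<in>{Suc j..n}. cE (p - 1) j * cF m p 
       - sgn_if (p + m) (cF (p - 1) j * cE m p - cF (p - 1) j * of_bool (p = Suc m))) * x)"
    unfolding sum_distrib_right left_diff_distrib[of _ "sgn_if _ _"] sgn_if_mult
    by (intro J_sum J_diff J_sgn_if trm) auto
  moreover have "(\<Sum>p\<in>{Suc j..n}. sgn_if (p + m) (cF (p - 1) j * of_bool (p = Suc m))) = - cF m j"
    using delta[of "\<lambda>p. sgn_if (p + m) (cF (p - 1) j)"] by (simp add: sgn_if_mult) (simp add: sgn_if_def)
  ultimately have 2: "?J (((\<Sum>p\<in>{Suc j..n}. cE (p - 1) j * cF m p - sgn_if (p + m) (cF (p - 1) j * cE m p)) - cF m j) * x)"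
    unfolding sum_subtractf sgn_if_diff by (simp add: algebra_simps)
  from J_add[OF low[OF Eu_col(2)[OF jS, of m]] 2] show ?F
    by (simp add: algebra_simps)
qed

lemma J_antimono: "J k d x \<Longrightarrow> k' \<le> k \<Longrightarrow> J k' d x"
proof (induction arbitrary: k' rule: J.induct)
  case (J_uE j m k d x l)
  show ?case by (rule J.J_uE[OF J_uE.hyps(1-4)]) (use J_uE in simp)
next
  case (J_uF j m k d x l)
  show ?case by (rule J.J_uF[OF J_uF.hyps(1-4)]) (use J_uF in simp)
qed (auto intro: J.intros)

lemma J_of_nat: "J k d x \<Longrightarrow> J k d (of_nat a * x)"
  using J_sc[of k d x "of_nat a"] by (simp add: sc_of_nat)

lemma Eu_eigen: "J k d x \<Longrightarrow> J (Suc k) d (Eu * x - of_nat k * x)"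
proof (induction rule: J.induct)
  case (J_G d x k)
  then show ?case
    using Fil_G[OF Fil_Eu J_G] G_sc[OF J_G, of "of_nat k"] by (auto intro!: J.J_G G_diff simp: sc_of_nat)
next
  case (J_1 d)
  have "Eu * 1 \<in> I"
    by (rule Eu_I) (simp add: I_e_chi I_f)
  then show ?case by (auto intro: J.J_G G_I)
next
  case (J_uE j m k d x k')
  have a: "J (Suc k') (d + int m + 1 - int j) (cE m j * (Eu * x - of_nat k * x))"
    by (rule J.J_uE) (use J_uE in auto)
  have b: "J (Suc k') (d + int m + 1 - int j) ((Eu * cE m j - cE m j * Eu - cE m j) * x)"
    by (rule J_antimono[OF Eu_commutator_u(1)]) (use J_uE in auto)
  \<comment> \<open>The claimed count \<open>k'\<close> may be below \<open>Suc k\<close>. The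
    difference of the two eigenvalues multiplies a word that then qualifies for
    \<open>Suc k'\<close>; if the counts agree, the factor is 0.\<close>
  have c: "J (Suc k') (d + int m + 1 - int j) (of_nat (Suc k - k') * (cE m j * x))"
  proof (cases "k' = Suc k")
    case False
    then show ?thesis
      by (intro J_of_nat, intro J.J_uE[OF J_uE.hyps(1-4)]) (use J_uE.hyps in simp)
  qed (simp add: J_0)
  have "of_nat (Suc k - k') * (cE m j * x) = cE m j * x + of_nat k * (cE m j * x) - of_nat k' * (cE m j * x)"
    using J_uE.hyps by (simp add: of_nat_diff left_diff_distrib distrib_right)
  moreover have "cE m j * (of_nat k * x) = of_nat k * (cE m j * x)"
    by (metis mult_of_nat_commute mult.assoc)
  ultimately have "Eu * (cE m j * x) - of_nat k' * (cE m j * x) = cE m j * (Eu * x - of_nat k * x)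
     + (Eu * cE m j - cE m j * Eu - cE m j) * x + of_nat (Suc k - k') * (cE m j * x)"
    by (simp add: algebra_simps)
  then show ?case using J.J_add[OF J.J_add[OF a b] c] by simp
next
  case (J_uF j m k d x k')
  have a: "J (Suc k') (d + int m + 1 - int j) (cF m j * (Eu * x - of_nat k * x))"
    by (rule J.J_uF) (use J_uF in auto)
  have b: "J (Suc k') (d + int m + 1 - int j) ((Eu * cF m j - cF m j * Eu - cF m j) * x)"
    by (rule J_antimono[OF Eu_commutator_u(2)]) (use J_uF in auto)
  have c: "J (Suc k') (d + int m + 1 - int j) (of_nat (Suc k - k') * (cF m j * x))"
  proof (cases "k' = Suc k")
    case False
    then show ?thesis
      by (intro J_of_nat, intro J.J_uF[OF J_uF.hyps(1-4)]) (use J_uF.hyps in simp)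
  qed (simp add: J_0)
  have "of_nat (Suc k - k') * (cF m j * x) = cF m j * x + of_nat k * (cF m j * x) - of_nat k' * (cF m j * x)"
    using J_uF.hyps by (simp add: of_nat_diff left_diff_distrib distrib_right)
  moreover have "cF m j * (of_nat k * x) = of_nat k * (cF m j * x)"
    by (metis mult_of_nat_commute mult.assoc)
  ultimately have "Eu * (cF m j * x) - of_nat k' * (cF m j * x) = cF m j * (Eu * x - of_nat k * x)
     + (Eu * cF m j - cF m j * Eu - cF m j) * x + of_nat (Suc k - k') * (cF m j * x)"
    by (simp add: algebra_simps)
  then show ?case using J.J_add[OF J.J_add[OF a b] c] by simp
next
  case (J_zE m k d x)
  have "Fil (int m - int n) (Eu * cE m n - cE m n * Eu)"
    using Eu_col(1)[of n m] n by simp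
  then have "J (Suc k) (d + int m + 1 - int n) ((Eu * cE m n - cE m n * Eu) * x)"
    by (intro J_low[where p = "int m - int n + 1", OF _ J_zE.hyps(2)]) auto
  note J.J_add[OF this J.J_zE[OF J_zE.hyps(1) J_zE.IH]]
  moreover have "cE m n * (of_nat k * x) = of_nat k * (cE m n * x)"
    by (metis mult_of_nat_commute mult.assoc)
  ultimately show ?case by (simp add: algebra_simps)
next
  case (J_zF m k d x)
  have "Fil (int m - int n) (Eu * cF m n - cF m n * Eu)"
    using Eu_col(2)[of n m] n by simp
  then have "J (Suc k) (d + int m + 1 - int n) ((Eu * cF m n - cF m n * Eu) * x)"
    by (intro J_low[where p = "int m - int n + 1", OF _ J_zF.hyps(2)]) auto
  note J.J_add[OF this J.J_zF[OF J_zF.hyps(1) J_zF.IH]]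
  moreover have "cF m n * (of_nat k * x) = of_nat k * (cF m n * x)"
    by (metis mult_of_nat_commute mult.assoc)
  ultimately show ?case by (simp add: algebra_simps)
next
  case (J_add k d x y)
  then show ?case using J.J_add[OF J_add.IH] by (simp add: algebra_simps)
next
  case (J_sc k d x c)
  have "Eu * (sc c * x) = sc c * (Eu * x)"
    by (metis sc_comm mult.assoc)
  then show ?case using J.J_sc[OF J_sc.IH, of c]
    by (simp add: right_diff_distrib mult_of_nat_commute mult.assoc)
qed

text \<open>For \<open>m < n\<close> this is a \<open>u\<close>-generator. Otherwise follow
  \<open>column_rec\<close> along the diagonal from \<open>(m, c)\<close> to
  \<open>(m + 1, c + 1)\<close> and so on until row \<open>n\<close>, where a
  \<open>z\<close>-generator is reached. The difference \<open>m - c\<close> stays constant and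
  \<open>k \<le> n \<le> m\<close>, so the correction terms \<open>e (Suc c) k\<close> and
  \<open>f (Suc c) k\<close> fall under the assumption on short generators.\<close>

lemma column_span:
  assumes gens: "\<And>i j x. \<lbrakk>1 \<le> i; i \<le> j; j \<le> n; j - i < m - c; G (d - deg i j) x\<rbrakk> \<Longrightarrow>
      J 0 d (e i j * x) \<and> J 0 d (f i j * x)"
    and lower: "\<And>d' x. d' < d \<Longrightarrow> G d' x \<Longrightarrow> J 0 d' x"
    and c: "1 \<le> c" "c \<le> n" "c \<le> m" and x: "G (d - (int m + 1 - int c)) x"
  shows "J 0 d (cE m c * x) \<and> J 0 d (cF m c * x)"
proof (cases "m < n")
  case True
  have "J 0 (d - (int m + 1 - int c)) x"
    using lower c x by simp
  then show ?thesis
    using J_uE[of c m 0 "d - (int m + 1 - int c)" x 0] J_uF[of c m 0 "d - (int m + 1 - int c)" x 0] c True by simp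
next
  case False
  define t where "t = n - c"
  then have "c + t = n" using c by auto
  moreover have "n \<le> m" using False by simp
  ultimately show ?thesis using gens x c(1)
  proof (induction t arbitrary: c m)
    case 0
    have "J 0 (d - (int m + 1 - int n)) x"
      using lower 0 by simp
    then show ?case
      using J_zE[of m 0 "d - (int m + 1 - int n)" x] J_zF[of m 0 "d - (int m + 1 - int n)" x] 0 by simp
  next
    case (Suc t)
    have c: "1 \<le> c" "Suc c + t = n" "Suc c \<in> S" "c < n" using Suc.prems by auto
    have IH: "J 0 d (cE (Suc m) (Suc c) * x) \<and> J 0 d (cF (Suc m) (Suc c) * x)"
    proof (rule Suc.IH)
      show "G (d - (int (Suc m) + 1 - int (Suc c))) x" using Suc.prems(4) by (simp add: algebra_simps)
    qed (use Suc.prems c in auto)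
    have s: "J 0 d (e (Suc c) k * (cE m k * x)) \<and> J 0 d (f (Suc c) k * (cE m k * x))"
        "J 0 d (e (Suc c) k * (cF m k * x)) \<and> J 0 d (f (Suc c) k * (cF m k * x))"
      if k: "k \<in> {Suc c..n}" for k
    proof -
      have kS: "k \<in> S" using k c by auto
      have "G (d - deg (Suc c) k) (cE m k * x)"
        by (rule Fil_G[OF Fil_cE[OF kS order_refl] Suc.prems(4)]) (simp add: deg_def)
      moreover have "G (d - deg (Suc c) k) (cF m k * x)"
        by (rule Fil_G[OF Fil_cF[OF kS order_refl] Suc.prems(4)]) (simp add: deg_def)
      moreover have "k - Suc c < m - c" using k Suc.prems by auto
      ultimately show "J 0 d (e (Suc c) k * (cE m k * x)) \<and> J 0 d (f (Suc c) k * (cE m k * x))"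
        "J 0 d (e (Suc c) k * (cF m k * x)) \<and> J 0 d (f (Suc c) k * (cF m k * x))"
        using k by (auto intro!: Suc.prems(3)[THEN conjunct1] Suc.prems(3)[THEN conjunct2])
    qed
    have rec: "J 0 d ((cE (Suc m) (Suc c) - cE m c
      - (\<Sum>k\<in>{Suc c..n}. e (Suc c) k * cE m k + sgn_if m (f (Suc c) k * cF m k))) * x)"
      "J 0 d ((cF (Suc m) (Suc c) - cF m c
      - (\<Sum>k\<in>{Suc c..n}. e (Suc c) k * cF m k + sgn_if m (f (Suc c) k * cE m k))) * x)"
      using column_rec[OF c(3), of m] c(1) by (auto intro!: J.J_G Fil_G[OF _ Suc.prems(4)])
    have sums: "J 0 d ((\<Sum>k\<in>{Suc c..n}. e (Suc c) k * cE m k + sgn_if m (f (Suc c) k * cF m k)) * x)"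
      "J 0 d ((\<Sum>k\<in>{Suc c..n}. e (Suc c) k * cF m k + sgn_if m (f (Suc c) k * cE m k)) * x)"
      unfolding sum_distrib_right distrib_right sgn_if_mult mult.assoc
      by (intro J_sum J.J_add J_sgn_if; use s in blast)+
    have "J 0 d (cE m c * x)"
      using J_diff[OF J_diff[OF IH[THEN conjunct1] rec(1)] sums(1)] by (simp add: algebra_simps)
    moreover have "J 0 d (cF m c * x)"
      using J_diff[OF J_diff[OF IH[THEN conjunct2] rec(2)] sums(2)] by (simp add: algebra_simps)
    ultimately show ?case by simp
  qed
qed

text \<open>Induction on \<open>j - i\<close>, solving \<open>column_rec\<close> in row
  \<open>i\<close> with \<open>m = j - 1\<close> for a generator. The term \<open>k = j\<close>
  contains \<open>cE (j - 1) j\<close>, which is 1 to leading order; terms with \<open>k < j\<close>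
  involve shorter generators, and those with \<open>k > j\<close> have lower degree. Both remaining
  column elements have superscript minus row equal to \<open>j - i\<close>, as
  \<open>column_span\<close> requires.\<close>

lemma gen_span:
  assumes lower: "\<And>d' x. d' < d \<Longrightarrow> G d' x \<Longrightarrow> J 0 d' x"
    and ij: "1 \<le> i" "i \<le> j" "j \<le> n" and x: "G (d - deg i j) x"
  shows "J 0 d (e i j * x) \<and> J 0 d (f i j * x)"
  using ij x
proof (induction "j - i" arbitrary: i j x rule: less_induct)
  case less
  obtain m where j: "j = Suc m" using less.prems by (cases j) auto
  have iS: "i \<in> S" using less.prems by auto
  have gens: "J 0 d (e a b * y) \<and> J 0 d (f a b * y)"
    if "1 \<le> a" "a \<le> b" "b \<le> n" "b - a < j - i" "G (d - deg a b) y" for a b y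
    using less.hyps[of b a y] that by blast
  have x: "G (d - (int m + 2 - int i)) x"
    using less.prems(4) by (simp add: j deg_def algebra_simps)
  have top: "J 0 d (cE (Suc m) i * x) \<and> J 0 d (cF (Suc m) i * x)"
    by (rule column_span[OF gens lower]) (use less.prems x in \<open>auto simp: j algebra_simps\<close>)
  have prev: "J 0 d ((if 2 \<le> i then cE m (i - 1) else 0) * x) \<and> J 0 d ((if 2 \<le> i then cF m (i - 1) else 0) * x)"
  proof (cases "2 \<le> i")
    case True
    have "J 0 d (cE m (i - 1) * x) \<and> J 0 d (cF m (i - 1) * x)"
      by (rule column_span[OF gens lower]) (use less.prems x True in \<open>auto simp: j of_nat_diff algebra_simps\<close>)
    then show ?thesis using True by simp
  qed (simp add: J_0)
  have rec: "J 0 d ((cE (Suc m) i - (if 2 \<le> i then cE m (i - 1) else 0)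
    - (\<Sum>k\<in>{i..n}. e i k * cE m k + sgn_if m (f i k * cF m k))) * x)"
    "J 0 d ((cF (Suc m) i - (if 2 \<le> i then cF m (i - 1) else 0)
    - (\<Sum>k\<in>{i..n}. e i k * cF m k + sgn_if m (f i k * cE m k))) * x)"
    using column_rec[OF iS, of m] by (auto intro!: J.J_G Fil_G[OF _ x])
  have s: "J 0 d ((g * cE m k - g * of_bool (k = j)) * x)" "J 0 d (g * cF m k * x)"
    if k: "k \<in> {i..n}" and g: "g = e i k \<or> g = f i k" for k g
  proof -
    have "J 0 d ((g * cE m k - g * of_bool (k = j)) * x) \<and> J 0 d (g * cF m k * x)"
    proof (cases "k \<le> m")
      case True
      have "G (d - deg i k) (cE m k * x)" "G (d - deg i k) (cF m k * x)"
        using k less.prems by (auto intro!: Fil_G[OF Fil_cE[OF _ order_refl] x] Fil_G[OF Fil_cF[OF _ order_refl] x] simp: deg_def)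
      moreover have "k - i < j - i" using True k less.prems by (auto simp: j)
      ultimately show ?thesis
        using gens[of i k "cE m k * x"] gens[of i k "cF m k * x"] g k True less.prems
        by (auto simp: j mult.assoc)
    next
      case False
      have kS: "k \<in> S" "m < k" using k less.prems False by auto
      have "Fil (int k - int i + 1) g" using g Fil_gen[OF iS kS(1)] by auto
      note Fil_G[OF Fil_mult[OF this _ order_refl] x, of _ _ "d - 1"]
      then show ?thesis
        unfolding right_diff_distrib[symmetric] using column_low[OF kS(2,1)]
        by (auto intro!: J.J_G simp: j)
    qed
    then show "J 0 d ((g * cE m k - g * of_bool (k = j)) * x)" "J 0 d (g * cF m k * x)" by auto
  qed
  have delta: "(\<Sum>k\<in>{i..n}. h k * of_bool (k = j)) = h j" for h :: "nat \<Rightarrow> 'a"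
  proof -
    have "(\<Sum>k\<in>{i..n}. h k * of_bool (k = j)) = (\<Sum>k\<in>{i..n}. if k = j then h k else 0)"
      by (intro sum.cong) auto
    then show ?thesis using less.prems by simp
  qed
  have "J 0 d ((\<Sum>k\<in>{i..n}. (e i k * cE m k - e i k * of_bool (k = j)) + sgn_if m (f i k * cF m k)) * x)"
    unfolding sum_distrib_right distrib_right sgn_if_mult
    by (intro J_sum J.J_add J_sgn_if s) auto
  then have "J 0 d (((\<Sum>k\<in>{i..n}. e i k * cE m k + sgn_if m (f i k * cF m k)) - e i j) * x)"
    by (simp add: sum_subtractf sum.distrib delta algebra_simps)
  from J_diff[OF J_diff[OF J_diff[OF top[THEN conjunct1] prev[THEN conjunct1]] rec(1)] this]
  have 1: "J 0 d (e i j * x)" by (simp add: algebra_simps)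
  have "J 0 d ((\<Sum>k\<in>{i..n}. e i k * cF m k + sgn_if m (f i k * cE m k - f i k * of_bool (k = j))) * x)"
    unfolding sum_distrib_right distrib_right sgn_if_mult
    by (intro J_sum J.J_add J_sgn_if s) auto
  then have "J 0 d (((\<Sum>k\<in>{i..n}. e i k * cF m k + sgn_if m (f i k * cE m k)) - sgn_if m (f i j)) * x)"
    by (simp add: sum_subtractf sum.distrib delta sgn_if_diff algebra_simps flip: sgn_if_sum)
  from J_diff[OF J_diff[OF J_diff[OF top[THEN conjunct2] prev[THEN conjunct2]] rec(2)] this]
  have "J 0 d (sgn_if m (f i j * x))" by (simp add: algebra_simps sgn_if_mult)
  then have "J 0 d (f i j * x)" using J_sgn_if[of 0 d "sgn_if m (f i j * x)" m] by simp
  with 1 show ?case by simp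
qed

text \<open>A letter split off from the left has positive degree, so the remaining factor is covered
  by the induction on \<open>d\<close>.\<close>

lemma G_imp_J: "G d x \<Longrightarrow> J 0 d x"
proof (induction "nat (d + 1)" arbitrary: d x rule: less_induct)
  case less
  show ?case
  proof (cases "d < 0")
    case True
    then show ?thesis using less.prems by (auto intro!: J_G G_I dest: G_neg)
  next
    case False
    then have lower: "J 0 d' y" if "d' < d" "G d' y" for d' y
      using less.hyps[of d' y] that by auto
    have "G d' x \<Longrightarrow> d' = d \<Longrightarrow> J 0 d x" for d'
    proof (induction rule: G.induct)
      case (G_e i j d' x)
      then show ?case using gen_span[OF lower, of d i j x] by auto
    next
      case (G_f i j d' x)
      then show ?case using gen_span[OF lower, of d i j x] by auto
    qed (auto intro: J.intros G.G_I)
    then show ?thesis using less.prems by blast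
  qed
qed

section \<open>Whittaker vectors as polynomials in the \<open>z\<close>-generators\<close>

inductive Z :: "'a \<Rightarrow> bool" where
  Z_1: "Z 1"
| Z_E: "n \<le> m \<Longrightarrow> Z x \<Longrightarrow> Z (cE m n * x)"
| Z_F: "n \<le> m \<Longrightarrow> Z x \<Longrightarrow> Z (cF m n * x)"
| Z_add: "Z x \<Longrightarrow> Z y \<Longrightarrow> Z (x + y)"
| Z_sc: "Z x \<Longrightarrow> Z (sc c * x)"

lemma Z_0: "Z 0"
  using Z_sc[OF Z_1, of 0] by (simp add: sc_0)

lemma J_split: "J k d x \<Longrightarrow> k = 0 \<Longrightarrow> \<exists>z. Z z \<and> J 1 d (x - z)"
proof (induction rule: J.induct)
  case (J_G d x k)
  then show ?case using Z_0 J.J_G by force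
next
  case (J_1 d)
  then show ?case using Z_1 J_0 by force
next
  case (J_uE j m k d x k')
  have "J 1 (d + int m + 1 - int j) (cE m j * x)" by (rule J.J_uE[OF J_uE.hyps(1-4)]) simp
  then show ?case using Z_0 by force
next
  case (J_uF j m k d x k')
  have "J 1 (d + int m + 1 - int j) (cF m j * x)" by (rule J.J_uF[OF J_uF.hyps(1-4)]) simp
  then show ?case using Z_0 by force
next
  case (J_zE m k d x)
  then obtain z where "Z z" "J 1 d (x - z)" by auto
  then show ?case
    using J.J_zE[OF J_zE.hyps(1), of 1 d "x - z"] Z_E[OF J_zE.hyps(1), of z] by (auto simp: right_diff_distrib)
next
  case (J_zF m k d x)
  then obtain z where "Z z" "J 1 d (x - z)" by auto
  then show ?case
    using J.J_zF[OF J_zF.hyps(1), of 1 d "x - z"] Z_F[OF J_zF.hyps(1), of z] by (auto simp: right_diff_distrib)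
next
  case (J_add k d x y)
  then obtain z w where "Z z" "J 1 d (x - z)" "Z w" "J 1 d (y - w)" by auto
  then have "Z (z + w)" "J 1 d ((x + y) - (z + w))" 
    using Z_add[of z w] J.J_add[of 1 d "x - z" "y - w"] by (auto simp: algebra_simps)
  then show ?case by blast
next
  case (J_sc k d x c)
  then obtain z where "Z z" "J 1 d (x - z)" by auto
  then have "Z (sc c * z)" "J 1 d (sc c * x - sc c * z)"
    using Z_sc[of z c] J.J_sc[of 1 d "x - z" c] by (auto simp: right_diff_distrib)
  then show ?case by blast
qed

text \<open>The condition that \<open>ad(a) y\<close> lies in \<open>I\<close>, freed from parities:
  \<open>ad(a) y\<close> and \<open>(a - \<chi>(a)) y\<close> differ by a left multiple of
  \<open>a - \<chi>(a)\<close>. The link is made in \<open>scomm_mod\<close> and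
  \<open>Wpre_iff\<close>.\<close>

definition W :: "'a set" where
  "W = {y. \<forall>i j. 1 \<le> j \<longrightarrow> j < i \<longrightarrow> i \<le> n \<longrightarrow> (e i j - chi i j) * y \<in> I \<and> f i j * y \<in> I}"

lemma Z_W: "Z z \<Longrightarrow> z \<in> W"
proof (induction rule: Z.induct)
  case Z_1
  then show ?case by (simp add: W_def I_e_chi I_f)
next
  case (Z_E m x)
  have "(e i j - chi i j) * (cE m n * x) \<in> I \<and> f i j * (cE m n * x) \<in> I"
    if ij: "1 \<le> j" "j < i" "i \<le> n" for i j
  proof -
    have "(e i j - chi i j) * (cE m n * x) = cE m n * ((e i j - chi i j) * x)"
         "f i j * (cE m n * x) = cE m n * (f i j * x)"
      using ij cols(1,3)[of i j n m] unfolding mult.assoc[symmetric] left_diff_distrib right_diff_distrib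
      by (simp_all add: dl_def chi_comm)
    then show ?thesis using Z_E ij by (simp add: W_def I_mult)
  qed
  then show ?case by (auto simp: W_def)
next
  case (Z_F m x)
  have "(e i j - chi i j) * (cF m n * x) \<in> I \<and> f i j * (cF m n * x) \<in> I"
    if ij: "1 \<le> j" "j < i" "i \<le> n" for i j
  proof -
    have "(e i j - chi i j) * (cF m n * x) = cF m n * ((e i j - chi i j) * x)"
         "f i j * (cF m n * x) = - (cF m n * (f i j * x))"
      using ij cols(2,4)[of i j n m] unfolding mult.assoc[symmetric] left_diff_distrib right_diff_distrib
      by (simp_all add: dl_def chi_comm)
    then show ?thesis using Z_F ij by (simp add: W_def I_mult I_minus)
  qed
  then show ?case by (auto simp: W_def)
next
  case (Z_add x y)
  then show ?case by (auto simp: W_def distrib_left intro: I_add)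
next
  case (Z_sc x c)
  have "y * (sc c * x) = sc c * (y * x)" for y
    by (metis sc_comm mult.assoc)
  then show ?case using Z_sc by (auto simp: W_def intro: I_mult)
qed

text \<open>After subtracting the polynomial from \<open>J_split\<close>, the rest has at least one
  letter \<open>u\<close> and is still Whittaker, so \<open>Eu\<close> sends it into
  \<open>I\<close>. By \<open>Eu_eigen\<close> a positive multiple then lies one level deeper;
  dividing by that integer and repeating raises the count beyond \<open>d\<close>, where
  \<open>J_large\<close> lowers the degree.\<close>

lemma W_spanned:
  assumes "G d y" "y \<in> W"
  shows "\<exists>z. Z z \<and> y - z \<in> I"
  using assms
proof (induction "nat (d + 1)" arbitrary: d y rule: less_induct)
  case less
  show ?case
  proof (cases "d < 0")
    case True
    then show ?thesis using less.prems G_neg Z_0 by force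
  next
    case False
    obtain z where z: "Z z" "J 1 d (y - z)"
      using J_split[OF G_imp_J[OF less.prems(1)]] by auto
    have yz: "y - z \<in> W"
      using less.prems(2) Z_W[OF z(1)] by (auto simp: W_def right_diff_distrib intro: I_diff)
    then have Eu: "Eu * (y - z) \<in> I"
      by (intro Eu_I) (auto simp: W_def)
    have "J (Suc k) d (y - z)" for k
    proof (induction k)
      case (Suc k)
      have "J (Suc (Suc k)) d (Eu * (y - z) - (Eu * (y - z) - of_nat (Suc k) * (y - z)))"
        by (intro J_diff[OF J_G[OF G_I[OF Eu]]] Eu_eigen Suc)
      then have "J (Suc (Suc k)) d (sc (inverse (of_nat (Suc k))) * (of_nat (Suc k) * (y - z)))"
        by (intro J_sc) simp
      moreover have "sc (inverse (of_nat (Suc k))) * of_nat (Suc k) = 1"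
        unfolding sc_of_nat[symmetric] sc_mult[symmetric] using of_nat_neq_0[of k, where 'a = complex]
        by (simp add: sc_1 del: of_nat_Suc)
      ultimately show ?case by (simp add: mult.assoc[symmetric] del: of_nat_Suc)
    qed (use z in simp)
    then have "G (d - 1) (y - z)"
      using J_large[of "Suc (nat d)" d "y - z"] False by auto
    from less.hyps[OF _ this yz] False obtain w where "Z w" "y - z - w \<in> I" by auto
    then have "Z (z + w)" "y - (z + w) \<in> I" using Z_add[OF z(1)] by (auto simp: algebra_simps)
    then show ?thesis by blast
  qed
qed

end

section \<open>The Yangian relations\<close>

definition neg_if :: "bool \<Rightarrow> 'a::ab_group_add \<Rightarrow> 'a" where
  "neg_if b x = (if b then - x else x)"

definition ycomm :: "bool \<Rightarrow> 'a::ring \<Rightarrow> 'a \<Rightarrow> 'a" where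
  "ycomm b x y = x * y - neg_if b (y * x)"

text \<open>\<open>yexpr T i j k l m r\<close> is the relation \<open>yrel i j k l (m + 1) (r + 1)\<close>; the shift avoids truncated
  subtraction in the superscripts.\<close>

definition yexpr :: "(nat \<Rightarrow> sg \<Rightarrow> sg \<Rightarrow> 'a::ring) \<Rightarrow> sg \<Rightarrow> sg \<Rightarrow> sg \<Rightarrow> sg \<Rightarrow> nat \<Rightarrow> nat \<Rightarrow> 'a" where
  "yexpr T i j k l m r =
     neg_if (((spar i \<and> spar k) \<noteq> (spar i \<and> spar l)) \<noteq> (spar k \<and> spar l))
       (ycomm ((spar i \<noteq> spar j) \<and> (spar k \<noteq> spar l)) (T (Suc (Suc m)) i j) (T r k l)
        - ycomm ((spar i \<noteq> spar j) \<and> (spar k \<noteq> spar l)) (T m i j) (T (Suc (Suc r)) k l))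
     - (T (Suc m) k j * T r i l + T m k j * T (Suc r) i l
        - T r k j * T (Suc m) i l - T (Suc r) k j * T m i l
        + neg_if (spar k \<noteq> spar l)
            (- (T (Suc m) (sneg k) j * T r (sneg i) l) + T m (sneg k) j * T (Suc r) (sneg i) l
             + T r k (sneg j) * T (Suc m) i (sneg l) - T (Suc r) k (sneg j) * T m i (sneg l)))"

context queer begin

text \<open>Passing from \<open>(m + 2, r)\<close> to \<open>(m, r + 2)\<close> keeps the total
  superscript, so the sums share their first \<open>m\<close> summands. The two that remain become
  the quadratic terms of the Yangian relation.\<close>

lemma double_step:
  "up X Y (Suc (Suc m)) r i j k l = up X Y m (Suc (Suc r)) i j k l
     + X (Suc r) i l * Y m k j + X r i l * Y (Suc m) k j"
  "up' X Y (Suc (Suc m)) r i j k l = up' X Y m (Suc (Suc r)) i j k l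
     + sgn_if (m + r) (X (Suc r) i l * Y m k j - X r i l * Y (Suc m) k j)"
  "dn X Y (Suc (Suc m)) r i j k l = dn X Y m (Suc (Suc r)) i j k l
     + X m i l * Y (Suc r) k j + X (Suc m) i l * Y r k j"
  "dn' X Y (Suc (Suc m)) r i j k l = dn' X Y m (Suc (Suc r)) i j k l
     + X m i l * Y (Suc r) k j - X (Suc m) i l * Y r k j"
proof -
  have 1: "Suc (Suc m) - Suc s + r = m - Suc s + Suc (Suc r)" if "s < m" for s
    using that by simp
  show "up X Y (Suc (Suc m)) r i j k l = up X Y m (Suc (Suc r)) i j k l
     + X (Suc r) i l * Y m k j + X r i l * Y (Suc m) k j"
    unfolding up_def sum.lessThan_Suc using 1 by simp
  show "dn X Y (Suc (Suc m)) r i j k l = dn X Y m (Suc (Suc r)) i j k l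
     + X m i l * Y (Suc r) k j + X (Suc m) i l * Y r k j"
    unfolding dn_def sum.lessThan_Suc using 1 by simp
  show "up' X Y (Suc (Suc m)) r i j k l = up' X Y m (Suc (Suc r)) i j k l
     + sgn_if (m + r) (X (Suc r) i l * Y m k j - X r i l * Y (Suc m) k j)"
    unfolding up'_def sum.lessThan_Suc using 1 by (simp add: sgn_if_diff add.commute)
  have "sgn_if (m + m) x = x" for x :: 'a by (simp add: sgn_if_def)
  then show "dn' X Y (Suc (Suc m)) r i j k l = dn' X Y m (Suc (Suc r)) i j k l
     + X m i l * Y (Suc r) k j - X (Suc m) i l * Y r k j"
    unfolding dn'_def sum.lessThan_Suc using 1 by simp
qed

end

context whittaker begin

text \<open>Stands for \<open>T\<^sub>i\<^sub>j\<close> with superscript \<open>m\<close>. The symmetry \<open>(i, j) \<mapsto> (-i, -j)\<close> contributes another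
  \<open>(-1)^m\<close>, so there is no sign in the column \<open>j = -1\<close>.\<close>

definition YT :: "nat \<Rightarrow> sg \<Rightarrow> sg \<Rightarrow> 'a" where
  "YT m i j = (if j = Pl then sgn_if m else id) ((if i = j then cE else cF) (m + n - 1) n)"

text \<open>An identity in the ring itself, since \<open>YT 0\<close> is an honest Sergeev element
  and not the Kronecker delta. It is the difference of two instances of \<open>RTT\<close> in row
  \<open>n\<close> and column 1; the index choices reduce to the four parities \<open>EE\<close>,
  \<open>FE\<close>, \<open>EF\<close>, \<open>FF\<close>.\<close>

lemma yexpr_YT: "yexpr YT i j k l m r = 0"
proof -
  obtain p where p: "n = Suc p" using n by (cases n) auto
  have 1: "1 \<in> S" "n \<in> S" using n by auto
  define M R where "M = m + p" and "R = r + p"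
  have np: "x + n - 1 = x + p" for x using p by simp
  have T: "YT (Suc (Suc m)) = (\<lambda>i j. (if j = Pl then sgn_if m else id) ((if i = j then cE else cF) (Suc (Suc M)) n))"
    "YT (Suc m) = (\<lambda>i j. (if j = Pl then - sgn_if m else id) ((if i = j then cE else cF) (Suc M) n))"
    "YT m = (\<lambda>i j. (if j = Pl then sgn_if m else id) ((if i = j then cE else cF) M n))"
    "YT (Suc (Suc r)) = (\<lambda>i j. (if j = Pl then sgn_if r else id) ((if i = j then cE else cF) (Suc (Suc R)) n))"
    "YT (Suc r) = (\<lambda>i j. (if j = Pl then - sgn_if r else id) ((if i = j then cE else cF) (Suc R) n))"
    "YT r = (\<lambda>i j. (if j = Pl then sgn_if r else id) ((if i = j then cE else cF) R n))"
    unfolding fun_eq_iff YT_def np by (simp_all add: M_def R_def)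
  \<comment> \<open>The shift \<open>n - 1\<close> enters both superscripts and cancels in the
    sign.\<close>
  have par: "sgn_if (M + R) x = sgn_if (m + r) x" for x :: 'a
    by (auto simp: sgn_if_def M_def R_def)
  note RR = RTT[OF 1(2,1) 1(2,1), of "Suc (Suc M)" R] RTT[OF 1(2,1) 1(2,1), of M "Suc (Suc R)"]
  note RRs = RR[THEN conjunct1] RR[THEN conjunct2, THEN conjunct1]
     RR[THEN conjunct2, THEN conjunct2, THEN conjunct1] RR[THEN conjunct2, THEN conjunct2, THEN conjunct2]
  have EE: "cE (Suc (Suc M)) n * cE R n - cE R n * cE (Suc (Suc M)) n - (cE M n * cE (Suc (Suc R)) n - cE (Suc (Suc R)) n * cE M n)
     = cE (Suc R) n * cE M n + cE R n * cE (Suc M) n - cE M n * cE (Suc R) n - cE (Suc M) n * cE R n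
      - sgn_if (m + r) (cF (Suc R) n * cF M n - cF R n * cF (Suc M) n) - cF M n * cF (Suc R) n + cF (Suc M) n * cF R n"
    unfolding cE_def cF_def RRs double_step par by (simp add: algebra_simps)
  have FE: "cF (Suc (Suc M)) n * cE R n - cE R n * cF (Suc (Suc M)) n - (cF M n * cE (Suc (Suc R)) n - cE (Suc (Suc R)) n * cF M n)
     = cE (Suc R) n * cF M n + cE R n * cF (Suc M) n - cE M n * cF (Suc R) n - cE (Suc M) n * cF R n
      - sgn_if (m + r) (cF (Suc R) n * cE M n - cF R n * cE (Suc M) n) - cF M n * cE (Suc R) n + cF (Suc M) n * cE R n"
    unfolding cE_def cF_def RRs double_step par by (simp add: algebra_simps)
  have EF: "cE (Suc (Suc M)) n * cF R n - cF R n * cE (Suc (Suc M)) n - (cE M n * cF (Suc (Suc R)) n - cF (Suc (Suc R)) n * cE M n)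
     = cF (Suc R) n * cE M n + cF R n * cE (Suc M) n - cF M n * cE (Suc R) n - cF (Suc M) n * cE R n
      + sgn_if (m + r) (cE (Suc R) n * cF M n - cE R n * cF (Suc M) n) + cE M n * cF (Suc R) n - cE (Suc M) n * cF R n"
    unfolding cE_def cF_def RRs double_step par by (simp add: algebra_simps)
  have FF: "cF (Suc (Suc M)) n * cF R n + cF R n * cF (Suc (Suc M)) n - (cF M n * cF (Suc (Suc R)) n + cF (Suc (Suc R)) n * cF M n)
     = cF M n * cF (Suc R) n + cF (Suc M) n * cF R n - cF (Suc R) n * cF M n - cF R n * cF (Suc M) n
      - sgn_if (m + r) (cE (Suc R) n * cE M n - cE R n * cE (Suc M) n) - cE M n * cE (Suc R) n + cE (Suc M) n * cE R n"
    unfolding cE_def cF_def RRs double_step par by (simp add: algebra_simps)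
  have r1: "x - y - z = w \<Longrightarrow> x = y + z + w" and r2: "x + y - z = w \<Longrightarrow> x = - y + z + w" for x y z w :: 'a
    by (auto simp: algebra_simps)
  \<comment> \<open>The four relations, oriented as rewrite rules for the products with the highest
    left superscript.\<close>
  have eqs: "cE (Suc (Suc M)) n * cE R n = cE R n * cE (Suc (Suc M)) n + (cE M n * cE (Suc (Suc R)) n - cE (Suc (Suc R)) n * cE M n)
     + (cE (Suc R) n * cE M n + cE R n * cE (Suc M) n - cE M n * cE (Suc R) n - cE (Suc M) n * cE R n
      - sgn_if (m + r) (cF (Suc R) n * cF M n - cF R n * cF (Suc M) n) - cF M n * cF (Suc R) n + cF (Suc M) n * cF R n)"
    "cF (Suc (Suc M)) n * cE R n = cE R n * cF (Suc (Suc M)) n + (cF M n * cE (Suc (Suc R)) n - cE (Suc (Suc R)) n * cF M n)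
     + (cE (Suc R) n * cF M n + cE R n * cF (Suc M) n - cE M n * cF (Suc R) n - cE (Suc M) n * cF R n
      - sgn_if (m + r) (cF (Suc R) n * cE M n - cF R n * cE (Suc M) n) - cF M n * cE (Suc R) n + cF (Suc M) n * cE R n)"
    "cE (Suc (Suc M)) n * cF R n = cF R n * cE (Suc (Suc M)) n + (cE M n * cF (Suc (Suc R)) n - cF (Suc (Suc R)) n * cE M n)
     + (cF (Suc R) n * cE M n + cF R n * cE (Suc M) n - cF M n * cE (Suc R) n - cF (Suc M) n * cE R n
      + sgn_if (m + r) (cE (Suc R) n * cF M n - cE R n * cF (Suc M) n) + cE M n * cF (Suc R) n - cE (Suc M) n * cF R n)"
    "cF (Suc (Suc M)) n * cF R n = - (cF R n * cF (Suc (Suc M)) n) + (cF M n * cF (Suc (Suc R)) n + cF (Suc (Suc R)) n * cF M n)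
     + (cF M n * cF (Suc R) n + cF (Suc M) n * cF R n - cF (Suc R) n * cF M n - cF R n * cF (Suc M) n
      - sgn_if (m + r) (cE (Suc R) n * cE M n - cE R n * cE (Suc M) n) - cE M n * cE (Suc R) n + cE (Suc M) n * cE R n)"
    by (rule r1[OF EE] r1[OF FE] r1[OF EF] r2[OF FF])+
  show ?thesis
    unfolding yexpr_def T ycomm_def neg_if_def
    by (cases i; cases j; cases k; cases l; cases "even m"; cases "even r")
       (simp_all add: sgn_if_def eqs algebra_simps)
qed

text \<open>Applying \<open>column_low\<close> to the left ideal of all \<open>y\<close> with \<open>y * w \<in> I\<close> shows that \<open>YT 0\<close> acts on
  Whittaker vectors as the Kronecker delta.\<close>

lemma corner:
  assumes w: "w \<in> W"
  shows "(cE (n - 1) n - 1) * w \<in> I" "cF (n - 1) n * w \<in> I"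
proof -
  interpret w: whittaker S e f n sc "{y. y * w \<in> I}"
    by (unfold_locales, fact n, fact S_def, fact sc_add, fact sc_mult, fact sc_1, fact sc_comm)
      (use w in \<open>auto simp: W_def chi_def distrib_right mult.assoc I_0
          intro: I_add I_mult exI[of _ 0]\<close>)
  have "w.Fil (- 1) (cE (n - 1) n - 1) \<and> w.Fil (- 1) (cF (n - 1) n)"
    using w.column_low[of "n - 1" n] n by simp
  then have "w.G (- 1) ((cE (n - 1) n - 1) * 1)" "w.G (- 1) (cF (n - 1) n * 1)"
    using w.Fil_G[OF _ w.G_1[of 0], of "- 1" _ "- 1"] by auto
  then show "(cE (n - 1) n - 1) * w \<in> I" "cF (n - 1) n * w \<in> I"
    using w.G_neg by (auto dest!: w.G_neg)
qed

lemma YT_W: "YT m i j \<in> W"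
proof -
  have "cE (m + n - 1) n \<in> W" "cF (m + n - 1) n \<in> W"
  proof -
    have "(e i j - chi i j) * cE M n = cE M n * (e i j - chi i j)" "f i j * cE M n = cE M n * f i j"
      "(e i j - chi i j) * cF M n = cF M n * (e i j - chi i j)" "f i j * cF M n = - (cF M n * f i j)"
      if "1 \<le> j" "j < i" "i \<le> n" for i j M
      using that cols[of i j n M] by (auto simp: left_diff_distrib right_diff_distrib dl_def chi_comm)
    then show "cE (m + n - 1) n \<in> W" "cF (m + n - 1) n \<in> W"
      by (simp_all add: W_def I_mult I_minus I_e_chi I_f)
  qed
  moreover have "- y \<in> W" if "y \<in> W" for y
    using that I_minus by (fastforce simp: W_def)
  ultimately show ?thesis
    by (auto simp: YT_def sgn_if_def)
qed

text \<open>In a left ideal the right factor can be replaced at once, using \<open>w = 1\<close>.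
  The left factor is replaced afterwards, when it stands in front of the Whittaker vector
  \<open>YT r k l\<close>.\<close>

lemma YT_mult_mod:
  assumes "\<And>m i j w. w \<in> W \<Longrightarrow> (T m i j - YT m i j) * w \<in> I"
  shows "T m i j * T r k l - YT m i j * YT r k l \<in> I"
proof -
  have "1 \<in> W" by (simp add: W_def I_e_chi I_f)
  then have "T m i j * ((T r k l - YT r k l) * 1) + (T m i j - YT m i j) * YT r k l \<in> I"
    by (intro I_add I_mult assms YT_W)
  then show ?thesis by (simp add: algebra_simps)
qed

lemma yexpr_mod:
  assumes "\<And>m i j w. w \<in> W \<Longrightarrow> (T m i j - YT m i j) * w \<in> I"
  shows "yexpr T i j k l m r \<in> I"
proof -
  have neg: "neg_if b x - neg_if b y \<in> I" if "x - y \<in> I" for b x y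
    using that I_minus[OF that] by (auto simp: neg_if_def)
  have diff: "x - y - (x' - y') \<in> I" if "x - x' \<in> I" "y - y' \<in> I" for x y x' y'
    using I_diff[OF that] by (simp add: algebra_simps)
  have add: "x + y - (x' + y') \<in> I" if "x - x' \<in> I" "y - y' \<in> I" for x y x' y'
    using I_add[OF that] by (simp add: algebra_simps)
  have minus: "- x - - x' \<in> I" if "x - x' \<in> I" for x x'
    using I_minus[OF that] by (simp add: algebra_simps)
  have "yexpr T i j k l m r - yexpr YT i j k l m r \<in> I"
    unfolding yexpr_def ycomm_def by (intro neg diff add minus YT_mult_mod[OF assms])
  then show ?thesis by (simp add: yexpr_YT)
qed

end

section \<open>The free algebra\<close>

lemma fa_mul_add_left: "(p + q) \<odot> r = p \<odot> r + q \<odot> r"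
  and fa_mul_add_right: "r \<odot> (p + q) = r \<odot> p + r \<odot> q"
  and fa_mul_diff_left: "(p - q) \<odot> r = p \<odot> r - q \<odot> r"
  and fa_mul_diff_right: "r \<odot> (p - q) = r \<odot> p - r \<odot> q"
  and fa_mul_minus_left: "(- p) \<odot> r = - (p \<odot> r)"
  by (auto simp: fa_mul_def fun_eq_iff algebra_simps sum.distrib sum_subtractf sum_negf)

lemma fa_mul_0 [simp]: "0 \<odot> p = 0" "p \<odot> 0 = 0"
  by (auto simp: fa_mul_def fun_eq_iff)

lemma fa_mul_smul: "(c *\<^sub>f p) \<odot> q = c *\<^sub>f (p \<odot> q)" "p \<odot> (c *\<^sub>f q) = c *\<^sub>f (p \<odot> q)"
  by (auto simp: fa_mul_def fa_smul_def fun_eq_iff sum_distrib_left algebra_simps)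

lemma fa_smul_algebra:
  "c *\<^sub>f (p + q) = c *\<^sub>f p + c *\<^sub>f q" "c *\<^sub>f (p - q) = c *\<^sub>f p - c *\<^sub>f q" "c *\<^sub>f 0 = 0" "1 *\<^sub>f p = p"
  "c *\<^sub>f (d *\<^sub>f p) = (c * d) *\<^sub>f p" "(- 1) *\<^sub>f p = - p" "0 *\<^sub>f p = 0" "c *\<^sub>f (- p) = - (c *\<^sub>f p)" "(- c) *\<^sub>f p = - (c *\<^sub>f p)"
  by (auto simp: fa_smul_def fun_eq_iff algebra_simps)

lemma sum_fun_apply: "sum h A w = (\<Sum>a\<in>A. h a w)"
  by (induction A rule: infinite_finite_induct) auto

lemma fa_smul_sum: "c *\<^sub>f sum h A = (\<Sum>a\<in>A. c *\<^sub>f h a)"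
  by (simp add: fa_smul_def fun_eq_iff sum_fun_apply sum_distrib_left)

lemma fa_scal_mul_left: "fa_scal c \<odot> p = c *\<^sub>f p"
proof
  fix w
  have "(fa_scal c \<odot> p) w = (\<Sum>i\<le>length w. if i = 0 then c * p w else 0)"
    unfolding fa_mul_def fa_scal_def by (intro sum.cong) (auto simp: take_eq_Nil)
  then show "(fa_scal c \<odot> p) w = (c *\<^sub>f p) w" by (simp add: fa_smul_def)
qed

lemma fa_scal_mul_right: "p \<odot> fa_scal c = c *\<^sub>f p"
proof
  fix w
  have "(p \<odot> fa_scal c) w = (\<Sum>i\<le>length w. if i = length w then c * p w else 0)"
    unfolding fa_mul_def fa_scal_def by (intro sum.cong) auto
  then show "(p \<odot> fa_scal c) w = (c *\<^sub>f p) w" by (simp add: fa_smul_def)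
qed

text \<open>Both sides sum over the ways to cut \<open>w\<close> into three pieces; in the proof
  \<open>?g j t\<close> is the summand whose first two pieces have lengths \<open>j\<close> and
  \<open>t\<close>.\<close>

lemma fa_mul_assoc: "p \<odot> q \<odot> r = p \<odot> (q \<odot> r)"
proof
  fix w :: "'a list"
  let ?g = "\<lambda>j t. p (take j w) * q (take t (drop j w)) * r (drop (j + t) w)"
  have "(p \<odot> q \<odot> r) w = (\<Sum>i\<le>length w. \<Sum>j\<le>i. ?g j (i - j))"
    unfolding fa_mul_def sum_distrib_right
    by (intro sum.cong refl) (auto simp: min_def drop_take)
  also have "\<dots> = (\<Sum>j\<le>length w. \<Sum>t\<le>length w - j. ?g j t)"
  proof -
    have "(\<Sum>i\<le>length w. \<Sum>j\<le>i. ?g j (i - j)) = (\<Sum>(i, j)\<in>(SIGMA i:{..length w}. {..i}). ?g j (i - j))"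
      by (rule sum.Sigma) auto
    also have "\<dots> = (\<Sum>(j, t)\<in>(SIGMA j:{..length w}. {..length w - j}). ?g j t)"
      by (rule sum.reindex_bij_witness[where i = "\<lambda>(j, t). (j + t, j)" and j = "\<lambda>(i, j). (j, i - j)"]) auto
    also have "\<dots> = (\<Sum>j\<le>length w. \<Sum>t\<le>length w - j. ?g j t)"
      by (rule sum.Sigma[symmetric]) auto
    finally show ?thesis .
  qed
  also have "\<dots> = (p \<odot> (q \<odot> r)) w"
    unfolding fa_mul_def sum_distrib_left
    by (intro sum.cong refl) (auto simp: mult.assoc add.commute)
  finally show "(p \<odot> q \<odot> r) w = (p \<odot> (q \<odot> r)) w" .
qed

lemma FA_0: "0 \<in> FA X"
  by (simp add: FA_def fa_supp_def)

lemma FA_add: "p \<in> FA X \<Longrightarrow> q \<in> FA X \<Longrightarrow> p + q \<in> FA X"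
proof -
  assume "p \<in> FA X" "q \<in> FA X"
  moreover have "fa_supp (p + q) \<subseteq> fa_supp p \<union> fa_supp q" by (auto simp: fa_supp_def)
  ultimately show ?thesis by (auto simp: FA_def dest: finite_subset)
qed

lemma FA_smul: "p \<in> FA X \<Longrightarrow> c *\<^sub>f p \<in> FA X"
proof -
  assume "p \<in> FA X"
  moreover have "fa_supp (c *\<^sub>f p) \<subseteq> fa_supp p" by (auto simp: fa_supp_def fa_smul_def)
  ultimately show ?thesis by (auto simp: FA_def dest: finite_subset)
qed

lemma FA_minus: "p \<in> FA X \<Longrightarrow> - p \<in> FA X"
  using FA_smul[of p X "- 1"] by (simp add: fa_smul_algebra)

lemma FA_diff: "p \<in> FA X \<Longrightarrow> q \<in> FA X \<Longrightarrow> p - q \<in> FA X"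
  using FA_add[of p X "- q"] by (simp add: FA_minus)

lemma FA_sum: "(\<And>a. a \<in> A \<Longrightarrow> h a \<in> FA X) \<Longrightarrow> sum h A \<in> FA X"
  by (induction A rule: infinite_finite_induct) (auto simp: FA_0 FA_add)

lemma FA_mul: 
  assumes "p \<in> FA X" "q \<in> FA X" shows "p \<odot> q \<in> FA X"
proof -
  have *: "fa_supp (p \<odot> q) \<subseteq> (\<lambda>(u, v). u @ v) ` (fa_supp p \<times> fa_supp q)"
  proof
    fix w assume "w \<in> fa_supp (p \<odot> q)"
    then have "(\<Sum>i\<le>length w. p (take i w) * q (drop i w)) \<noteq> 0"
      by (simp add: fa_supp_def fa_mul_def)
    then obtain i where "p (take i w) * q (drop i w) \<noteq> 0"
      by (rule sum.not_neutral_contains_not_neutral)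
    then show "w \<in> (\<lambda>(u, v). u @ v) ` (fa_supp p \<times> fa_supp q)"
      by (intro image_eqI[of _ _ "(take i w, drop i w)"]) (auto simp: fa_supp_def)
  qed
  moreover have "finite ((\<lambda>(u, v). u @ v) ` (fa_supp p \<times> fa_supp q))"
    using assms by (auto simp: FA_def)
  ultimately have "finite (fa_supp (p \<odot> q))" by (rule finite_subset)
  moreover have "set w \<subseteq> X" if w: "w \<in> fa_supp (p \<odot> q)" for w
  proof -
    obtain u v where "w = u @ v" "u \<in> fa_supp p" "v \<in> fa_supp q" using subsetD[OF * w] by auto
    then show ?thesis using assms by (simp add: FA_def)
  qed
  ultimately show ?thesis by (auto simp: FA_def)
qed

lemma FA_scal: "fa_scal c \<in> FA X"
proof -
  have "fa_supp (fa_scal c :: 'a fa) \<subseteq> {[]}" by (auto simp: fa_supp_def fa_scal_def)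
  then show ?thesis by (auto simp: FA_def dest: finite_subset)
qed

lemma FA_gen: "x \<in> X \<Longrightarrow> fa_gen x \<in> FA X"
proof -
  have "fa_supp (fa_gen x) = {[x]}" by (auto simp: fa_supp_def fa_gen_def)
  then show "x \<in> X \<Longrightarrow> ?thesis" by (auto simp: FA_def)
qed

lemma fa_prodl_Cons: "fa_prodl (x # xs) = x \<odot> fa_prodl xs" and fa_prodl_Nil: "fa_prodl [] = fa_scal 1"
  by (simp_all add: fa_prodl_def)

lemma fa_prodl_append: "fa_prodl (xs @ ys) = fa_prodl xs \<odot> fa_prodl ys"
  by (induction xs) (simp_all add: fa_prodl_Cons fa_prodl_Nil fa_mul_assoc fa_scal_mul_left fa_smul_algebra)

lemma fa_gen_mul: "fa_gen x \<odot> p = (\<lambda>w. case w of [] \<Rightarrow> 0 | y # v \<Rightarrow> if y = x then p v else 0)"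
proof
  fix w
  have "(fa_gen x \<odot> p) w = (\<Sum>i\<le>length w. if i = 1 then (case w of [] \<Rightarrow> 0 | y # v \<Rightarrow> if y = x then p v else 0) else 0)"
    unfolding fa_mul_def
  proof (intro sum.cong refl)
    fix i assume i: "i \<in> {..length w}"
    have "length (take i w) = i" using i by simp
    then have "i = 1" if "take i w = [x]" using that by simp
    then show "fa_gen x (take i w) * p (drop i w) = (if i = 1 then (case w of [] \<Rightarrow> 0 | y # v \<Rightarrow> if y = x then p v else 0) else 0)"
      using i by (cases w) (auto simp: fa_gen_def)
  qed
  then show "(fa_gen x \<odot> p) w = (case w of [] \<Rightarrow> 0 | y # v \<Rightarrow> if y = x then p v else 0)"
    by (cases w) (auto simp: Suc_le_eq)
qed

lemma fa_prodl_gen: "fa_prodl (map fa_gen w) = (\<lambda>v. if v = w then 1 else 0)"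
proof (induction w)
  case Nil
  then show ?case by (simp add: fa_prodl_Nil fa_scal_def)
next
  case (Cons x w)
  then show ?case by (auto simp: fa_prodl_Cons fa_gen_mul fun_eq_iff split: list.splits)
qed

lemma FA_expand: "p \<in> FA X \<Longrightarrow> p = (\<Sum>w\<in>fa_supp p. p w *\<^sub>f fa_prodl (map fa_gen w))"
proof
  fix v assume p: "p \<in> FA X"
  have "(\<Sum>w\<in>fa_supp p. p w *\<^sub>f fa_prodl (map fa_gen w)) v = (\<Sum>w\<in>fa_supp p. if w = v then p v else 0)"
    unfolding fa_prodl_gen sum_fun_apply by (intro sum.cong) (auto simp: fa_smul_def)
  then show "p v = (\<Sum>w\<in>fa_supp p. p w *\<^sub>f fa_prodl (map fa_gen w)) v"
    using p by (auto simp: FA_def sum.delta' fa_supp_def)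
qed

lemma word_FA: "set w \<subseteq> X \<Longrightarrow> fa_prodl (map fa_gen w) \<in> FA X"
  by (induction w) (auto simp: fa_prodl_Cons fa_prodl_Nil FA_scal FA_mul FA_gen)

lemma FA_induct [consumes 1, case_names zero add word]:
  assumes "p \<in> FA X" and "P 0"
    and "\<And>p q. p \<in> FA X \<Longrightarrow> q \<in> FA X \<Longrightarrow> P p \<Longrightarrow> P q \<Longrightarrow> P (p + q)"
    and word: "\<And>c w. set w \<subseteq> X \<Longrightarrow> P (c *\<^sub>f fa_prodl (map fa_gen w))"
  shows "P p"
proof -
  have "P (\<Sum>w\<in>A. p w *\<^sub>f fa_prodl (map fa_gen w))" if "finite A" "A \<subseteq> fa_supp p" for A
    using that
  proof (induction A)
    case (insert w A)
    have *: "set v \<subseteq> X" if "v \<in> insert w A" for v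
      using that insert.prems assms(1) by (auto simp: FA_def)
    then show ?case unfolding sum.insert[OF insert.hyps] using insert
      by (intro assms(3) word FA_smul word_FA FA_sum) auto
  qed (simp add: assms(2))
  moreover have "finite (fa_supp p)" using assms(1) by (simp add: FA_def)
  ultimately have "P (\<Sum>w\<in>fa_supp p. p w *\<^sub>f fa_prodl (map fa_gen w))" by blast
  then show ?thesis using FA_expand[OF assms(1)] by simp
qed

lemma fa_eval_alt: 
  assumes "finite A" "fa_supp p \<subseteq> A"
  shows "fa_eval img p = (\<Sum>w\<in>A. p w *\<^sub>f fa_prodl (map img w))"
proof -
  have "(\<Sum>w\<in>A. p w *\<^sub>f fa_prodl (map img w)) = (\<Sum>w\<in>fa_supp p. p w *\<^sub>f fa_prodl (map img w))"
    using assms by (intro sum.mono_neutral_right) (auto simp: fa_supp_def fa_smul_algebra)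
  then show ?thesis by (simp add: fa_eval_def fa_smul_def fun_eq_iff sum_fun_apply)
qed

lemma fa_eval_add: 
  assumes "p \<in> FA X" "q \<in> FA X"
  shows "fa_eval img (p + q) = fa_eval img p + fa_eval img q"
proof -
  let ?A = "fa_supp p \<union> fa_supp q"
  have A: "finite ?A" using assms by (simp add: FA_def)
  have "fa_supp (p + q) \<subseteq> ?A" by (auto simp: fa_supp_def)
  then have "fa_eval img (p + q) = (\<Sum>w\<in>?A. (p + q) w *\<^sub>f fa_prodl (map img w))"
    by (intro fa_eval_alt A)
  also have "\<dots> = fa_eval img p + fa_eval img q"
    unfolding fa_eval_alt[OF A Un_upper1] fa_eval_alt[OF A Un_upper2] sum.distrib[symmetric]
    by (intro sum.cong refl) (simp add: fa_smul_def fun_eq_iff algebra_simps)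
  finally show ?thesis .
qed

lemma fa_eval_smul: 
  assumes "p \<in> FA X"
  shows "fa_eval img (c *\<^sub>f p) = c *\<^sub>f fa_eval img p"
proof -
  have A: "finite (fa_supp p)" using assms by (simp add: FA_def)
  have "fa_supp (c *\<^sub>f p) \<subseteq> fa_supp p" by (auto simp: fa_supp_def fa_smul_def)
  then have "fa_eval img (c *\<^sub>f p) = (\<Sum>w\<in>fa_supp p. (c *\<^sub>f p) w *\<^sub>f fa_prodl (map img w))"
    by (intro fa_eval_alt A)
  also have "\<dots> = c *\<^sub>f fa_eval img p"
    unfolding fa_eval_alt[OF A order_refl] fa_smul_sum
    by (intro sum.cong refl) (simp add: fa_smul_def fun_eq_iff algebra_simps)
  finally show ?thesis .
qed

lemma fa_eval_minus: "p \<in> FA X \<Longrightarrow> fa_eval img (- p) = - fa_eval img p"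
  using fa_eval_smul[of p X img "- 1"] by (simp add: fa_smul_algebra)

lemma fa_eval_diff: "p \<in> FA X \<Longrightarrow> q \<in> FA X \<Longrightarrow> fa_eval img (p - q) = fa_eval img p - fa_eval img q"
  using fa_eval_add[of p X "- q" img] by (simp add: FA_minus fa_eval_minus)

lemma fa_eval_0: "fa_eval img 0 = 0"
  by (simp add: fa_eval_def fa_supp_def fun_eq_iff)

lemma fa_eval_word: "fa_eval img (fa_prodl (map fa_gen w)) = fa_prodl (map img w)"
proof -
  have "fa_supp (fa_prodl (map fa_gen w)) = {w}" by (auto simp: fa_prodl_gen fa_supp_def)
  then show ?thesis unfolding fa_eval_def by (simp add: fa_prodl_gen)
qed

lemma fa_eval_gen: "fa_eval img (fa_gen x) = img x"
  using fa_eval_word[of img "[x]"] by (simp add: fa_prodl_Cons fa_prodl_Nil fa_scal_mul_right fa_smul_algebra)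

lemma fa_scal_alt: "fa_scal c = c *\<^sub>f fa_scal 1"
  by (simp add: fa_scal_def fa_smul_def fun_eq_iff)

lemma fa_eval_scal: "fa_eval img (fa_scal c) = fa_scal c"
  using fa_eval_smul[OF FA_scal, of img c 1] fa_eval_word[of img "[]"]
  by (simp add: fa_prodl_Nil fa_scal_alt[of c])

lemma fa_eval_mul: 
  assumes "p \<in> FA X" "q \<in> FA X"
  shows "fa_eval img (p \<odot> q) = fa_eval img p \<odot> fa_eval img q"
  using assms(1) 
proof (induction rule: FA_induct)
  case zero
  then show ?case by (simp add: fa_eval_0 del: zero_fun_apply)
next
  case (add p p')
  then have "p \<odot> q \<in> FA X" "p' \<odot> q \<in> FA X" using assms(2) by (auto intro: FA_mul)
  note fa_eval_add[OF this, of img]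
  with add show "fa_eval img ((p + p') \<odot> q) = fa_eval img (p + p') \<odot> fa_eval img q"
    by (simp add: fa_mul_add_left fa_eval_add[OF add.hyps] del: plus_fun_apply)
next
  case (word c w)
  show ?case using assms(2)
  proof (induction rule: FA_induct)
    case zero
    then show ?case by (simp add: fa_eval_0 del: zero_fun_apply)
  next
    case (add p q)
    let ?w = "c *\<^sub>f fa_prodl (map fa_gen w)"
    have "?w \<in> FA X" by (intro FA_smul word_FA word)
    then have "?w \<odot> p \<in> FA X" "?w \<odot> q \<in> FA X" using add.hyps by (auto intro: FA_mul)
    note fa_eval_add[OF this, of img]
    with add show "fa_eval img (?w \<odot> (p + q)) = fa_eval img ?w \<odot> fa_eval img (p + q)"
      by (simp add: fa_mul_add_right fa_eval_add[OF add.hyps] del: plus_fun_apply)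
  next
    case (word d v)
    have "(c *\<^sub>f fa_prodl (map fa_gen w)) \<odot> (d *\<^sub>f fa_prodl (map fa_gen v))
        = (c * d) *\<^sub>f fa_prodl (map fa_gen (w @ v))"
      by (simp add: fa_mul_smul fa_smul_algebra fa_prodl_append mult.commute)
    then have "fa_eval img ((c *\<^sub>f fa_prodl (map fa_gen w)) \<odot> (d *\<^sub>f fa_prodl (map fa_gen v)))
        = (c * d) *\<^sub>f fa_prodl (map img (w @ v))"
      using fa_eval_smul[OF word_FA[OF subset_UNIV]] by (simp only: fa_eval_word)
    then show ?case
      by (simp add: fa_eval_smul[OF word_FA[OF subset_UNIV]] fa_eval_word fa_mul_smul fa_smul_algebra
        fa_prodl_append mult.commute)
  qed
qed

section \<open>The enveloping algebras as a ring\<close>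

lemma tideal_minus: "x \<in> tideal X G \<Longrightarrow> - x \<in> tideal X G"
  using tid_smul[of x X G "- 1"] by (simp add: fa_smul_algebra)

lemma tideal_diff: "x \<in> tideal X G \<Longrightarrow> y \<in> tideal X G \<Longrightarrow> x - y \<in> tideal X G"
  using tid_add[of x X G "- y"] tideal_minus[of y] by simp

lemma lideal_minus: "x \<in> lideal X G \<Longrightarrow> - x \<in> lideal X G"
  using lid_smul[of x X G "- 1"] by (simp add: fa_smul_algebra)

lemma lideal_diff: "x \<in> lideal X G \<Longrightarrow> y \<in> lideal X G \<Longrightarrow> x - y \<in> lideal X G"
  using lid_add[of x X G "- y"] lideal_minus[of y] by simp

lemma tideal_empty: "x \<in> tideal X {} \<Longrightarrow> x = 0"
  by (induction rule: tideal.induct) (auto simp: fa_smul_algebra simp del: zero_fun_apply)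

definition urel :: "(nat \<Rightarrow> qg fa) \<Rightarrow> (nat \<Rightarrow> qg fa) \<Rightarrow> bool" where
  "urel p q \<longleftrightarrow> (\<forall>n. p n \<in> FA (qvalid n) \<and> q n \<in> FA (qvalid n) \<and> p n - q n \<in> tideal (qvalid n) (Ugens n))"

text \<open>The product over all \<open>n\<close> of the algebras \<open>U(Q(n))\<close>: a single type in which every
  \<open>U(Q(n))\<close> embeds, because a type cannot depend on \<open>n\<close>.\<close>

quotient_type U = "nat \<Rightarrow> qg fa" / partial: urel
proof (rule part_equivpI)
  show "\<exists>x. urel x x" by (auto simp: urel_def intro!: exI[of _ "\<lambda>_. 0"] FA_0 tid_zero simp del: zero_fun_apply)
  show "symp urel"
  proof (rule sympI)
    fix p q assume "urel p q"
    then show "urel q p" using tideal_minus by (fastforce simp: urel_def)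
  qed
  show "transp urel"
  proof (rule transpI)
    fix p q r assume "urel p q" "urel q r"
    then show "urel p r" using tid_add[of "p n - q n" "qvalid n" "Ugens n" "q n - r n" for n]
      by (simp add: urel_def)
  qed
qed

lemma urelI: "(\<And>n. p n \<in> FA (qvalid n)) \<Longrightarrow> (\<And>n. q n = p n) \<Longrightarrow> urel p q"
  by (auto simp: urel_def tid_zero simp del: zero_fun_apply)

lemma urelD: "urel p q \<Longrightarrow> p n \<in> FA (qvalid n)" "urel p q \<Longrightarrow> q n \<in> FA (qvalid n)"
  by (auto simp: urel_def)

instantiation U :: ring_1
begin

lift_definition zero_U :: U is "\<lambda>_. 0"
  by (rule urelI) (simp_all add: FA_0 del: zero_fun_apply)
lift_definition one_U :: U is "\<lambda>_. fa_scal 1"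
  by (rule urelI) (simp_all add: FA_scal)
lift_definition plus_U :: "U \<Rightarrow> U \<Rightarrow> U" is "\<lambda>p q n. p n + q n"
  using tid_add by (fastforce simp: urel_def FA_add add_diff_add simp del: plus_fun_apply)
lift_definition uminus_U :: "U \<Rightarrow> U" is "\<lambda>p n. - p n"
  using tideal_minus by (fastforce simp: urel_def FA_minus)
lift_definition minus_U :: "U \<Rightarrow> U \<Rightarrow> U" is "\<lambda>p q n. p n - q n"
proof -
  fix p p' q q' assume *: "urel p p'" "urel q q'"
  have "p n - q n - (p' n - q' n) \<in> tideal (qvalid n) (Ugens n)" for n
  proof -
    have "(p n - p' n) - (q n - q' n) \<in> tideal (qvalid n) (Ugens n)"
      by (rule tideal_diff) (use * in \<open>auto simp: urel_def\<close>)
    then show ?thesis by (simp add: algebra_simps)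
  qed
  then show "urel (\<lambda>n. p n - q n) (\<lambda>n. p' n - q' n)"
    using * by (auto simp: urel_def FA_diff)
qed
lift_definition times_U :: "U \<Rightarrow> U \<Rightarrow> U" is "\<lambda>p q n. p n \<odot> q n"
proof -
  fix p p' q q' assume *: "urel p p'" "urel q q'"
  have "p n \<odot> q n - p' n \<odot> q' n \<in> tideal (qvalid n) (Ugens n)" for n
  proof -
    have "(p n - p' n) \<odot> q n + p' n \<odot> (q n - q' n) \<in> tideal (qvalid n) (Ugens n)"
      using * by (intro tid_add tid_rmul tid_lmul) (auto simp: urel_def)
    then show ?thesis by (simp add: fa_mul_diff_left fa_mul_diff_right)
  qed
  then show "urel (\<lambda>n. p n \<odot> q n) (\<lambda>n. p' n \<odot> q' n)"
    using * by (auto simp: urel_def FA_mul)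
qed

instance
proof
  fix a b c :: U
  show "a * b * c = a * (b * c)"
    by transfer (rule urelI; simp add: urelD FA_mul fa_mul_assoc)
  show "1 * a = a" "a * 1 = a"
    by (transfer, rule urelI; simp add: urelD FA_mul FA_scal fa_scal_mul_left fa_scal_mul_right fa_smul_algebra)+
  show "(a + b) * c = a * c + b * c" "a * (b + c) = a * b + a * c"
    by (transfer, rule urelI; simp add: urelD FA_mul FA_add fa_mul_add_left fa_mul_add_right del: plus_fun_apply)+
  show "a + b + c = a + (b + c)" "a + b = b + a" 
    by (transfer, rule urelI; simp add: urelD FA_add add_ac del: plus_fun_apply)+
  show "0 + a = a" "- a + a = 0"
    by (transfer, rule urelI; simp add: urelD FA_add FA_0 FA_minus del: plus_fun_apply zero_fun_apply)+
  show "a - b = a + - b"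
    by (transfer, rule urelI; simp add: urelD FA_add FA_diff FA_minus del: plus_fun_apply)
  \<comment> \<open>The factor with index 0 has no generators and no relations, so its ideal is zero
    and the unit survives there.\<close>
  show "(0 :: U) \<noteq> 1"
  proof (transfer, rule notI)
    assume "urel (\<lambda>_. 0) (\<lambda>_. fa_scal 1)"
    then have "0 - fa_scal 1 \<in> tideal (qvalid 0) (Ugens 0)" by (simp only: urel_def)
    moreover have "Ugens 0 = {}" by (auto simp: Ugens_def qvalid_def)
    ultimately have "0 - fa_scal 1 = (0 :: qg fa)" using tideal_empty[of "0 - fa_scal 1"] by metis
    then show False by (auto simp: fun_eq_iff fa_scal_def dest: spec[of _ "[]"])
  qed
qed

end

lemma tideal_Kpre: "x \<in> tideal (qvalid n) (Ugens n) \<Longrightarrow> x \<in> Kpre n"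
  by (simp add: Kpre_def lid_gen)

text \<open>Tests the component \<open>n\<close> alone, so whatever happens in the other factors of
  the product is invisible. It respects the quotient because \<open>Kpre n\<close> contains the
  ideal of relations.\<close>

lift_definition inK :: "nat \<Rightarrow> U \<Rightarrow> bool" is "\<lambda>n p. p n \<in> Kpre n"
proof -
  fix n and p q :: "nat \<Rightarrow> qg fa" assume "urel p q"
  then have d: "p n - q n \<in> Kpre n" by (simp add: urel_def tideal_Kpre)
  show "(p n \<in> Kpre n) = (q n \<in> Kpre n)"
  proof
    assume "p n \<in> Kpre n"
    then have "p n - (p n - q n) \<in> Kpre n" using d unfolding Kpre_def by (rule lideal_diff)
    then show "q n \<in> Kpre n" by simp
  next
    assume "q n \<in> Kpre n"
    then have "q n + (p n - q n) \<in> Kpre n" using d unfolding Kpre_def by (rule lid_add)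
    then show "p n \<in> Kpre n" by simp
  qed
qed

text \<open>Respects sums and products on \<open>FA (qvalid n)\<close> but not the unit: the image
  of 1 is the idempotent of the \<open>n\<close>-th factor. The default 0 keeps the representative
  in the domain of \<open>urel\<close>.\<close>

lift_definition emb :: "nat \<Rightarrow> qg fa \<Rightarrow> U" is "\<lambda>n p k. if k = n \<and> p \<in> FA (qvalid n) then p else 0"
  by (rule urelI) (simp_all add: FA_0 del: zero_fun_apply)

lift_definition usc :: "complex \<Rightarrow> U" is "\<lambda>c _. fa_scal c"
  by (rule urelI) (simp_all add: FA_scal)

lemma emb_eq: "p - q \<in> tideal (qvalid n) (Ugens n) \<Longrightarrow> p \<in> FA (qvalid n) \<Longrightarrow> q \<in> FA (qvalid n) \<Longrightarrow> emb n p = emb n q"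
  by transfer (auto simp: urel_def FA_0 tid_zero simp del: zero_fun_apply)

lemma emb_0: "emb n 0 = 0"
  by transfer (rule urelI; simp add: FA_0 del: zero_fun_apply)

lemma emb_add: "p \<in> FA (qvalid n) \<Longrightarrow> q \<in> FA (qvalid n) \<Longrightarrow> emb n (p + q) = emb n p + emb n q"
  by transfer (rule urelI; simp add: FA_0 FA_add del: zero_fun_apply plus_fun_apply)

lemma emb_diff: "p \<in> FA (qvalid n) \<Longrightarrow> q \<in> FA (qvalid n) \<Longrightarrow> emb n (p - q) = emb n p - emb n q"
  by transfer (rule urelI; simp add: FA_0 FA_diff del: zero_fun_apply)

lemma emb_mul: "p \<in> FA (qvalid n) \<Longrightarrow> q \<in> FA (qvalid n) \<Longrightarrow> emb n (p \<odot> q) = emb n p * emb n q"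
  by transfer (rule urelI; simp add: FA_0 FA_mul del: zero_fun_apply)

lemma emb_smul: "p \<in> FA (qvalid n) \<Longrightarrow> emb n (c *\<^sub>f p) = usc c * emb n p"
  by transfer (rule urelI; simp add: FA_0 FA_smul fa_scal_mul_left fa_smul_algebra del: zero_fun_apply)

lemma emb_sum: "(\<And>a. a \<in> A \<Longrightarrow> h a \<in> FA (qvalid n)) \<Longrightarrow> emb n (sum h A) = (\<Sum>a\<in>A. emb n (h a))"
  by (induction A rule: infinite_finite_induct) (simp_all add: emb_0 emb_add FA_sum del: zero_fun_apply plus_fun_apply)

lemma usc_add: "usc (a + b) = usc a + usc b"
  by transfer (rule urelI; simp add: FA_add FA_scal; simp add: fa_scal_def fun_eq_iff)

lemma usc_mult: "usc (a * b) = usc a * usc b"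
  by transfer (rule urelI; simp add: FA_mul FA_scal fa_scal_mul_left; simp add: fa_scal_def fa_smul_def fun_eq_iff)

lemma usc_1: "usc 1 = 1"
  by transfer (rule urelI; simp add: FA_scal)

lemma usc_comm: "x * usc a = usc a * x"
  by transfer (rule urelI; simp add: FA_scal FA_mul urelD fa_scal_mul_left fa_scal_mul_right FA_smul)

lemma usc_0: "usc 0 = 0"
  using usc_add[of 0 0] by simp

lemma usc_minus: "usc (- a) = - usc a"
  using usc_add[of a "- a"] by (simp add: usc_0 eq_neg_iff_add_eq_0 add.commute)

lemma inK_emb: "p \<in> FA (qvalid n) \<Longrightarrow> inK n (emb n p) \<longleftrightarrow> p \<in> Kpre n"
  by transfer simp

lemma inK_0: "inK n 0"
  by transfer (simp add: Kpre_def lid_zero del: zero_fun_apply)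

lemma inK_add: "inK n x \<Longrightarrow> inK n y \<Longrightarrow> inK n (x + y)"
  by transfer (simp add: Kpre_def lid_add del: plus_fun_apply)

lemma inK_mult: "inK n x \<Longrightarrow> inK n (y * x)"
  by transfer (simp add: Kpre_def lid_lmul urelD)

text \<open>Compensates for \<open>emb n\<close> not preserving the unit: the difference vanishes in
  component \<open>n\<close>.\<close>

lemma inK_emb_1: "inK n (emb n (fa_scal 1) * y - y)"
  by transfer (simp add: FA_scal fa_scal_mul_left fa_smul_algebra Kpre_def lid_zero del: zero_fun_apply)

section \<open>The homomorphism\<close>

lemma sgc_smul: "sgc b *\<^sub>f p = neg_if b p"
  by (simp add: sgc_def neg_if_def fa_smul_algebra)

lemma minus_one_smul: "((- 1) ^ m) *\<^sub>f p = sgn_if m p"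
  by (simp add: sgn_if_def fa_smul_algebra minus_one_power_iff)

lemma homog_gen: "homog par (par x) (fa_gen x)"
  by (auto simp: homog_def fa_gen_def word_odd_def)

lemma homog_scal: "homog par False (fa_scal c)"
  by (auto simp: homog_def fa_scal_def word_odd_def)

lemma homog_smul: "homog par s p \<Longrightarrow> homog par s (c *\<^sub>f p)"
  by (auto simp: homog_def fa_smul_def)

lemma homog_0: "homog par s 0"
  by (auto simp: homog_def)

lemma homog_add: "homog par s p \<Longrightarrow> homog par s q \<Longrightarrow> homog par s (p + q)"
  unfolding homog_def by (metis add_0 plus_fun_apply)

lemma homog_sum: "(\<And>a. a \<in> A \<Longrightarrow> homog par s (h a)) \<Longrightarrow> homog par s (sum h A)"
  by (induction A rule: infinite_finite_induct) (auto simp: homog_0 homog_add simp del: plus_fun_apply zero_fun_apply)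

lemma homog_mul:
  assumes "homog par s p" "homog par t q"
  shows "homog par (s \<noteq> t) (p \<odot> q)"
  unfolding homog_def
proof (intro allI impI)
  fix w assume "(p \<odot> q) w \<noteq> 0"
  then have "(\<Sum>i\<le>length w. p (take i w) * q (drop i w)) \<noteq> 0"
    by (simp add: fa_mul_def)
  then obtain i where "p (take i w) * q (drop i w) \<noteq> 0"
    by (rule sum.not_neutral_contains_not_neutral)
  then have "word_odd par (take i w) = s" "word_odd par (drop i w) = t"
    using assms by (auto simp: homog_def)
  moreover have "word_odd par (take i w @ drop i w) = (word_odd par (take i w) \<noteq> word_odd par (drop i w))"
    unfolding word_odd_def filter_append length_append by auto
  ultimately show "word_odd par w = (s \<noteq> t)" by simp
qed

lemma scomm_homog:
  assumes "homog par s a" "homog par t y"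
  shows "scomm par a y = a \<odot> y - neg_if (s \<and> t) (y \<odot> a)"
proof -
  have ev: "fa_ev par a = (if s then 0 else a)" and od: "fa_od par a = (if s then a else 0)"
    using assms(1) by (auto simp: fa_ev_def fa_od_def homog_def fun_eq_iff)
  have "fa_par par y = neg_if t y"
    using assms(2) by (fastforce simp: fa_par_def homog_def neg_if_def fun_eq_iff)
  then show ?thesis
    unfolding scomm_def ev od by (auto simp: neg_if_def fa_mul_minus_left simp del: zero_fun_apply)
qed

lemma FA_par: "p \<in> FA X \<Longrightarrow> fa_par par p \<in> FA X"
proof -
  have "fa_supp (fa_par par p) = fa_supp p" by (auto simp: fa_supp_def fa_par_def)
  then show "p \<in> FA X \<Longrightarrow> ?thesis" by (simp add: FA_def)
qed

lemma scomm_gen: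
  "scomm par (fa_gen x) y = fa_gen x \<odot> y - (if par x then fa_par par y else y) \<odot> fa_gen x"
proof -
  have "fa_ev par (fa_gen x) = (if par x then 0 else fa_gen x)" "fa_od par (fa_gen x) = (if par x then fa_gen x else 0)"
    by (auto simp: fa_ev_def fa_od_def fa_gen_def fun_eq_iff word_odd_def)
  then show ?thesis by (simp add: scomm_def del: zero_fun_apply)
qed

lemma scomm_linear:
  "scomm par (a + b) y = scomm par a y + scomm par b y"
  "scomm par (c *\<^sub>f a) y = c *\<^sub>f scomm par a y"
  "scomm par 0 y = 0"
proof -
  have "fa_ev par (a + b) = fa_ev par a + fa_ev par b" "fa_od par (a + b) = fa_od par a + fa_od par b"
    "fa_ev par (c *\<^sub>f a) = c *\<^sub>f fa_ev par a" "fa_od par (c *\<^sub>f a) = c *\<^sub>f fa_od par a"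
    "fa_ev par 0 = 0" "fa_od par 0 = 0"
    by (auto simp: fa_ev_def fa_od_def fa_smul_def fun_eq_iff)
  then show "scomm par (a + b) y = scomm par a y + scomm par b y"
    "scomm par (c *\<^sub>f a) y = c *\<^sub>f scomm par a y" "scomm par 0 y = 0"
    by (simp_all add: scomm_def fa_mul_add_left fa_mul_add_right fa_mul_smul fa_smul_algebra algebra_simps
        del: plus_fun_apply zero_fun_apply)
qed

lemma fa_eval_FA: 
  assumes "\<And>g. img g \<in> FA X" shows "fa_eval img p \<in> FA X"
proof -
  have w: "fa_prodl (map img w) \<in> FA X" for w
    by (induction w) (auto simp: fa_prodl_Cons fa_prodl_Nil FA_scal FA_mul assms)
  have "fa_eval img p = (\<Sum>w\<in>fa_supp p. p w *\<^sub>f fa_prodl (map img w))"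
    by (simp add: fa_eval_def fun_eq_iff sum_fun_apply fa_smul_def)
  then show ?thesis by (simp add: FA_sum FA_smul w)
qed

section \<open>The enveloping algebra as an instance of the abstract setting\<close>

locale queer_U =
  fixes n :: nat
  assumes n: "1 \<le> n"
begin

definition idx :: "nat set" where "idx = {1..n}"

lemma mem_idx: "i \<in> idx \<longleftrightarrow> 1 \<le> i \<and> i \<le> n"
  by (simp add: idx_def)

definition e :: "nat \<Rightarrow> nat \<Rightarrow> U" where "e i j = emb n (fa_gen (Ee i j))"
definition f :: "nat \<Rightarrow> nat \<Rightarrow> U" where "f i j = emb n (fa_gen (Ff i j))"

lemma gen_FA: "\<lbrakk>1 \<le> i; i \<le> n; 1 \<le> j; j \<le> n\<rbrakk> \<Longrightarrow> fa_gen (Ee i j) \<in> FA (qvalid n) \<and> fa_gen (Ff i j) \<in> FA (qvalid n)"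
  by (auto intro!: FA_gen simp: qvalid_def)

lemma emb_rel:
  assumes "x \<in> qvalid n" "y \<in> qvalid n" "qbr x y \<in> FA (qvalid n)"
  shows "emb n (fa_gen x) * emb n (fa_gen y)
     = neg_if (qpar x \<and> qpar y) (emb n (fa_gen y) * emb n (fa_gen x)) + emb n (qbr x y)"
proof -
  have g: "fa_gen x \<in> FA (qvalid n)" "fa_gen y \<in> FA (qvalid n)" using assms by (auto intro: FA_gen)
  let ?s = "if qpar x \<and> qpar y then - 1 else 1 :: complex"
  have "fa_gen x \<odot> fa_gen y - (?s *\<^sub>f (fa_gen y \<odot> fa_gen x) + qbr x y) \<in> tideal (qvalid n) (Ugens n)"
    unfolding diff_diff_eq[symmetric] by (rule tid_gen) (use assms in \<open>auto simp: Ugens_def\<close>)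
  from emb_eq[OF this] g assms(3)
  have "emb n (fa_gen x \<odot> fa_gen y) = emb n (?s *\<^sub>f (fa_gen y \<odot> fa_gen x) + qbr x y)"
    by (simp add: FA_mul FA_smul FA_add del: plus_fun_apply)
  then show ?thesis
    using g assms(3) by (auto simp: FA_mul FA_smul emb_add emb_mul emb_smul usc_1 usc_minus neg_if_def simp del: plus_fun_apply)
qed

lemma usc_dlt: "usc (dlt a b) * x = dl a b x"
  by (simp add: dlt_def dl_def usc_1 usc_0)

sublocale whittaker idx e f n usc "{x. inK n x}"
proof unfold_locales
  fix i j k l assume "i \<in> idx" "j \<in> idx" "k \<in> idx" "l \<in> idx"
  then have v: "Ee i j \<in> qvalid n" "Ee k l \<in> qvalid n" "Ff i j \<in> qvalid n" "Ff k l \<in> qvalid n"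
    and g: "fa_gen (Ee i l) \<in> FA (qvalid n)" "fa_gen (Ee k j) \<in> FA (qvalid n)"
    "fa_gen (Ff i l) \<in> FA (qvalid n)" "fa_gen (Ff k j) \<in> FA (qvalid n)"
    using gen_FA[of i l] gen_FA[of k j] by (auto simp: qvalid_def mem_idx)
  have q: "qbr (Ee i j) (Ee k l) \<in> FA (qvalid n)" "qbr (Ee i j) (Ff k l) \<in> FA (qvalid n)" "qbr (Ff i j) (Ff k l) \<in> FA (qvalid n)"
    using g by (auto intro!: FA_add FA_diff FA_smul simp del: plus_fun_apply)
  show "e i j * e k l = e k l * e i j + dl j k (e i l) - dl l i (e k j)"
    using emb_rel[OF v(1,2) q(1)] g
    by (simp add: e_def neg_if_def emb_diff emb_smul FA_smul usc_dlt)
  show "e i j * f k l = f k l * e i j + dl j k (f i l) - dl l i (f k j)"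
    using emb_rel[OF v(1,4) q(2)] g
    by (simp add: e_def f_def neg_if_def emb_diff emb_smul FA_smul usc_dlt)
  show "f i j * f k l = - (f k l * f i j) + dl j k (e i l) + dl l i (e k j)"
    using emb_rel[OF v(3,4) q(3)] g
    by (simp add: e_def f_def neg_if_def emb_add emb_smul FA_smul usc_dlt del: plus_fun_apply)
next
  show "x * usc a = usc a * x" for x a by (rule usc_comm)
next
  fix i j :: nat assume ij: "1 \<le> j" "j < i" "i \<le> n"
  then have m: "Ee i j \<in> mgens n" "Ff i j \<in> mgens n" 
    and g: "fa_gen (Ee i j) \<in> FA (qvalid n)" "fa_gen (Ff i j) \<in> FA (qvalid n)"
    using gen_FA[of i j] by (auto simp: mgens_def qvalid_def)
  let ?c = "of_bool (i = Suc j) :: complex"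
  have "fa_gen (Ee i j) - fa_scal ?c \<in> chigens n"
    unfolding chigens_def using m(1) by (auto intro!: exI[of _ "Ee i j"])
  then have "inK n (emb n (fa_gen (Ee i j) - fa_scal ?c))"
    using g by (simp add: inK_emb FA_diff FA_scal Kpre_def lid_gen)
  then have "inK n (emb n (fa_gen (Ee i j)) - emb n (fa_scal ?c))"
    using g by (simp add: emb_diff FA_scal)
  moreover have "inK n (emb n (fa_scal ?c) - of_bool (i = Suc j))"
    using inK_emb_1[of n 1] by (auto simp: emb_0 inK_0 fa_scal_alt[of 0] fa_smul_algebra)
  ultimately have "inK n (emb n (fa_gen (Ee i j)) - emb n (fa_scal ?c) + (emb n (fa_scal ?c) - of_bool (i = Suc j)))"
    by (rule inK_add)
  then show "e i j - of_bool (i = Suc j) \<in> {x. inK n x}"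
    by (simp add: e_def)
  have "fa_gen (Ff i j) - fa_scal 0 \<in> chigens n"
    unfolding chigens_def using m(2) by (auto intro!: exI[of _ "Ff i j"])
  then have "fa_gen (Ff i j) \<in> Kpre n"
    by (simp add: Kpre_def lid_gen fa_scal_alt[of 0] fa_smul_algebra del: zero_fun_apply)
  then show "f i j \<in> {x. inK n x}"
    using g by (simp add: f_def inK_emb)
qed (use n inK_0 in \<open>auto simp: idx_def usc_add usc_mult usc_1 intro: inK_add inK_mult\<close>)

lemma emb_sign: "p \<in> FA (qvalid n) \<Longrightarrow> emb n (sgn_if m p) = sgn_if m (emb n p)"
  using emb_smul[of p n "(- 1) ^ m"] by (simp add: minus_one_smul) (simp add: minus_one_power_iff sgn_if_def usc_1 usc_minus)

text \<open>The index \<open>s\<close> stands for superscript \<open>Suc s\<close>. Membership in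
  \<open>FA\<close> is carried through the induction because \<open>emb\<close> is additive and
  multiplicative only there.\<close>

lemma serg:
  assumes "i \<in> idx" "j \<in> idx"
  shows "(fst (serg n s i j) \<in> FA (qvalid n) \<and> snd (serg n s i j) \<in> FA (qvalid n))
    \<and> (homog qpar False (fst (serg n s i j)) \<and> homog qpar True (snd (serg n s i j)))
    \<and> (emb n (fst (serg n s i j)) = E (Suc s) i j \<and> emb n (snd (serg n s i j)) = F (Suc s) i j)"
  using assms
proof (induction s arbitrary: i)
  case 0
  then have "homog qpar (qpar (Ee i j)) (fa_gen (Ee i j))" "homog qpar (qpar (Ff i j)) (fa_gen (Ff i j))"
    by (intro homog_gen)+
  then show ?case using 0 gen_FA[of i j] by (simp add: E_1 F_1 mem_idx flip: e_def f_def)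
next
  case (Suc s)
  have sg: "((- 1) ^ (Suc s + 2)) *\<^sub>f p = sgn_if (Suc s) p" for p :: "qg fa"
    unfolding minus_one_smul by (simp add: sgn_if_def)
  have FA: "fa_gen (Ee i k) \<in> FA (qvalid n)" "fa_gen (Ff i k) \<in> FA (qvalid n)"
    "fst (serg n s k j) \<in> FA (qvalid n)" "snd (serg n s k j) \<in> FA (qvalid n)" if "k \<in> idx" for k
    using Suc.IH[OF that Suc.prems(2)] gen_FA[of i k] Suc.prems that by (auto simp: mem_idx)
  have ho: "homog qpar False (fa_gen (Ee i k))" "homog qpar True (fa_gen (Ff i k))" for k
    using homog_gen[of qpar "Ee i k"] homog_gen[of qpar "Ff i k"] by simp_all
  have hom: "homog qpar False (fa_gen (Ee i k) \<odot> fst (serg n s k j))" "homog qpar False (fa_gen (Ff i k) \<odot> snd (serg n s k j))"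
    "homog qpar True (fa_gen (Ee i k) \<odot> snd (serg n s k j))" "homog qpar True (fa_gen (Ff i k) \<odot> fst (serg n s k j))"
    if "k \<in> idx" for k
  proof -
    note IH = Suc.IH[OF that Suc.prems(2), THEN conjunct2, THEN conjunct1]
    show "homog qpar False (fa_gen (Ee i k) \<odot> fst (serg n s k j))" "homog qpar False (fa_gen (Ff i k) \<odot> snd (serg n s k j))"
    "homog qpar True (fa_gen (Ee i k) \<odot> snd (serg n s k j))" "homog qpar True (fa_gen (Ff i k) \<odot> fst (serg n s k j))"
      using homog_mul[OF ho(1) IH[THEN conjunct1], of k] homog_mul[OF ho(2) IH[THEN conjunct2], of k]
       homog_mul[OF ho(1) IH[THEN conjunct2], of k] homog_mul[OF ho(2) IH[THEN conjunct1], of k] by simp_all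
  qed
  have sgFA: "sgn_if m p \<in> FA (qvalid n)" if "p \<in> FA (qvalid n)" for m p
    using that by (simp add: sgn_if_def FA_minus)
  have 1: "fst (serg n (Suc s) i j) \<in> FA (qvalid n) \<and> snd (serg n (Suc s) i j) \<in> FA (qvalid n)"
    unfolding serg.simps idx_def[symmetric] sg fst_conv snd_conv
    by (intro conjI FA_sum FA_add FA_mul sgFA FA)
  have 2: "homog qpar False (fst (serg n (Suc s) i j)) \<and> homog qpar True (snd (serg n (Suc s) i j))"
    unfolding serg.simps idx_def[symmetric] fst_conv snd_conv
    by (intro conjI homog_sum homog_add homog_smul hom)
  have IH: "emb n (fst (serg n s k j)) = E (Suc s) k j" "emb n (snd (serg n s k j)) = F (Suc s) k j" if "k \<in> idx" for k
    using Suc.IH[OF that Suc.prems(2)] by auto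
  have "emb n (fst (serg n (Suc s) i j)) = E (Suc (Suc s)) i j"
    unfolding serg.simps idx_def[symmetric] sg fst_conv E_Suc[of "Suc s"]
    by (subst emb_sum, (intro FA_add FA_mul sgFA FA; assumption)[1], intro sum.cong refl)
      (simp add: emb_add emb_mul emb_sign FA FA_mul sgFA IH del: plus_fun_apply sgn_if_simps flip: e_def f_def)
  moreover have "emb n (snd (serg n (Suc s) i j)) = F (Suc (Suc s)) i j"
    unfolding serg.simps idx_def[symmetric] sg snd_conv F_Suc[of "Suc s"]
    by (subst emb_sum, (intro FA_add FA_mul sgFA FA; assumption)[1], intro sum.cong refl)
      (simp add: emb_add emb_mul emb_sign FA FA_mul sgFA IH del: plus_fun_apply sgn_if_simps flip: e_def f_def)
  ultimately have "emb n (fst (serg n (Suc s) i j)) = E (Suc (Suc s)) i j \<and> emb n (snd (serg n (Suc s) i j)) = F (Suc (Suc s)) i j"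
    by blast
  with 1 2 show ?case by blast
qed

text \<open>The generator index \<open>s\<close> means superscript \<open>s + 1\<close>. The column
  \<open>Pl\<close> has the prescribed sign \<open>(-1)^(s + 1)\<close>; in the column
  \<open>Mi\<close> the symmetry relation contributes the same sign once more, and both
  cancel.\<close>

definition img :: "yg \<Rightarrow> qg fa" where
  "img = (\<lambda>(s, i, j). (if j = Pl then sgn_if (Suc s) else id) ((if i = j then sE else sF) n (n + s) n 1))"

lemma sEF:
  "sE n (n + s) n 1 \<in> FA (qvalid n)" "sF n (n + s) n 1 \<in> FA (qvalid n)"
  "homog qpar False (sE n (n + s) n 1)" "homog qpar True (sF n (n + s) n 1)"
  "emb n (sE n (n + s) n 1) = cE (n + s) n" "emb n (sF n (n + s) n 1) = cF (n + s) n"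
  using serg[of n 1 "n + s - 1"] n by (auto simp: sE_def sF_def cE_def cF_def mem_idx)

lemma img_FA: "img g \<in> FA (qvalid n)"
  by (cases g) (auto simp: img_def sgn_if_def sEF FA_minus simp del: One_nat_def)

lemma homog_minus: "homog par s p \<Longrightarrow> homog par s (- p)"
  by (auto simp: homog_def)

lemma img_homog: "homog qpar (ypar g) (img g)"
proof -
  obtain s i j where g: "g = (s, i, j)" by (cases g)
  show ?thesis
    by (cases i; cases j) (auto simp: g img_def sgn_if_def sEF homog_minus simp del: One_nat_def)
qed

lemma emb_img: "emb n (img (s, i, j)) = YT (Suc s) i j"
proof -
  have "Suc s + n - 1 = n + s" by simp
  show ?thesis
    unfolding img_def YT_def prod.case \<open>Suc s + n - 1 = n + s\<close>
    by (cases i; cases j) (simp_all add: emb_sign sEF del: One_nat_def sgn_if_simps)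
qed

definition phi :: "yg fa \<Rightarrow> U" where "phi p = emb n (fa_eval img p)"

lemma eval_FA: "fa_eval img p \<in> FA (qvalid n)"
  by (rule fa_eval_FA) (rule img_FA)

lemma phi_add: "p \<in> FA UNIV \<Longrightarrow> q \<in> FA UNIV \<Longrightarrow> phi (p + q) = phi p + phi q"
  and phi_diff: "p \<in> FA UNIV \<Longrightarrow> q \<in> FA UNIV \<Longrightarrow> phi (p - q) = phi p - phi q"
  and phi_minus: "p \<in> FA UNIV \<Longrightarrow> phi (- p) = - phi p"
  and phi_mul: "p \<in> FA UNIV \<Longrightarrow> q \<in> FA UNIV \<Longrightarrow> phi (p \<odot> q) = phi p * phi q"
  and phi_smul: "p \<in> FA UNIV \<Longrightarrow> phi (c *\<^sub>f p) = usc c * phi p"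
  using emb_smul[OF eval_FA, of "- 1" p] 
  by (simp_all add: phi_def fa_eval_add fa_eval_diff fa_eval_minus fa_eval_mul fa_eval_smul emb_add emb_diff emb_mul emb_smul eval_FA
     fa_smul_algebra usc_minus usc_1 del: plus_fun_apply)

lemma phi_neg_if: "p \<in> FA UNIV \<Longrightarrow> phi (neg_if b p) = neg_if b (phi p)"
  by (simp add: neg_if_def phi_minus)

lemma phi_gen: "phi (fa_gen (s, i, j)) = YT (Suc s) i j"
  by (simp add: phi_def fa_eval_gen emb_img)

lemma emb_one_mod: "inK n (y - emb n (fa_scal 1) * y)"
  using inK_mult[OF inK_emb_1[of n y], of "- 1"] by simp

definition TT :: "nat \<Rightarrow> sg \<Rightarrow> sg \<Rightarrow> U" where "TT m i j = phi (Tel m i j)"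

text \<open>For \<open>m > 0\<close> the two families coincide. For \<open>m = 0\<close> the free
  algebra has the scalar 1 or 0 where \<open>YT\<close> has \<open>cE (n - 1) n\<close> or
  \<open>cF (n - 1) n\<close>, and \<open>corner\<close> compares these on Whittaker
  vectors.\<close>

lemma TT_mod:
  assumes "w \<in> W" shows "(TT m i j - YT m i j) * w \<in> {x. inK n x}"
proof (cases m)
  case (Suc s)
  then show ?thesis by (simp add: TT_def Tel_def phi_gen inK_0)
next
  case 0
  show ?thesis
  proof (cases "i = j")
    case True
    have "inK n (emb n (fa_scal 1) * w - w + - ((cE (n - 1) n - 1) * w))"
      using inK_emb_1[of n w] inK_mult[of n "(cE (n - 1) n - 1) * w" "- 1"] corner(1)[OF assms]
      by (intro inK_add) auto
    moreover have "YT 0 i j = cE (n - 1) n" using True by (simp add: YT_def)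
    ultimately show ?thesis using True 0
      by (simp add: TT_def Tel_def phi_def fa_eval_scal algebra_simps)
  next
    case False
    have "inK n (- (cF (n - 1) n * w))"
      using inK_mult[of n "cF (n - 1) n * w" "- 1"] corner(2)[OF assms] by simp
    moreover have "YT 0 i j = cF (n - 1) n" using False by (simp add: YT_def)
    moreover have "TT 0 i j = 0"
      using False by (simp add: TT_def Tel_def phi_def fa_eval_scal fa_scal_alt[of 0] fa_smul_algebra fa_eval_0 emb_0 del: zero_fun_apply)
    ultimately show ?thesis using 0 by (simp add: algebra_simps)
  qed
qed

lemma Tel_FA: "Tel m i j \<in> FA UNIV"
  by (simp add: Tel_def FA_scal FA_gen)

lemma Tel_homog: "homog ypar (spar i \<noteq> spar j) (Tel m i j)"
proof (cases "m = 0")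
  case True
  then show ?thesis
    by (cases i; cases j) (auto simp: Tel_def homog_scal fa_scal_alt[of 0] fa_smul_algebra homog_0 simp del: zero_fun_apply)
next
  case False
  then show ?thesis using homog_gen[of ypar "(m - 1, i, j)"] by (simp add: Tel_def)
qed

lemma phi_yrel: "phi (yrel i j k l (Suc m) (Suc r)) = yexpr TT i j k l m r"
proof -
  have neg: "neg_if b p \<in> FA UNIV" if "p \<in> FA UNIV" for b and p :: "yg fa"
    using that by (simp add: neg_if_def FA_minus)
  note FAs = Tel_FA FA_mul FA_add FA_diff FA_minus neg
  show ?thesis
    unfolding yrel_def yexpr_def sgc_smul scomm_homog[OF Tel_homog Tel_homog] ycomm_def TT_def
    by (simp only: phi_add phi_diff phi_mul phi_minus phi_neg_if FAs add_Suc_right add_0_right One_nat_def diff_Suc_Suc diff_zero)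
qed

text \<open>The quadratic relations hold modulo the left ideal through \<open>yexpr_mod\<close>; the
  symmetry relations hold exactly, by the choice of signs in \<open>YT\<close>.\<close>

lemma yrels_Kpre:
  assumes "\<rho> \<in> yrels" shows "fa_eval img \<rho> \<in> Kpre n"
proof -
  have "inK n (phi \<rho>)"
    using assms unfolding yrels_def
  proof (elim UnE CollectE exE conjE)
    fix i j k l and m r :: nat assume *: "\<rho> = yrel i j k l m r" "1 \<le> m" "1 \<le> r"
    then obtain m' r' where "m = Suc m'" "r = Suc r'" by (cases m; cases r) auto
    then show "inK n (phi \<rho>)"
      using yexpr_mod[of TT i j k l m' r'] TT_mod by (simp add: * phi_yrel)
  next
    fix m :: nat and i j assume *: "\<rho> = Tel m (sneg i) (sneg j) - (- 1) ^ m *\<^sub>f Tel m i j" "1 \<le> m"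
    then obtain s where m: "m = Suc s" by (cases m) auto
    have "TT m (sneg i) (sneg j) = sgn_if m (TT m i j)"
      unfolding TT_def Tel_def m by (cases i; cases j) (simp_all add: phi_gen YT_def)
    moreover have "phi \<rho> = TT m (sneg i) (sneg j) - phi (sgn_if m (Tel m i j))"
      unfolding * minus_one_smul TT_def
      by (rule phi_diff) (auto simp: Tel_FA sgn_if_def FA_minus)
    moreover have "phi (sgn_if m (Tel m i j)) = sgn_if m (TT m i j)"
      by (simp add: sgn_if_def phi_minus Tel_FA TT_def)
    ultimately show "inK n (phi \<rho>)" by (simp add: inK_0)
  qed
  then show ?thesis by (simp add: phi_def inK_emb eval_FA)
qed

section \<open>Translation of the Whittaker condition\<close>

lemma msp_expand:
  assumes "a \<in> msp n"
  shows "a = (\<Sum>w\<in>fa_supp a. a w *\<^sub>f fa_gen (hd w))" "\<And>w. w \<in> fa_supp a \<Longrightarrow> hd w \<in> mgens n"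
proof -
  have a: "a \<in> FA (mgens n)" and l: "\<And>w. w \<in> fa_supp a \<Longrightarrow> length w = 1"
    using assms by (auto simp: msp_def fa_supp_def)
  have w: "w = [hd w]" if "w \<in> fa_supp a" for w using l[OF that] by (cases w) auto
  show "hd w \<in> mgens n" if "w \<in> fa_supp a" for w
  proof -
    have "set w \<subseteq> mgens n" using a that by (simp add: FA_def)
    moreover have "hd w \<in> set w" by (subst (2) w[OF that]) simp
    ultimately show ?thesis by blast
  qed
  have "fa_prodl (map fa_gen w) = fa_gen (hd w)" if "w \<in> fa_supp a" for w
    by (subst w[OF that]) (simp add: fa_prodl_Cons fa_prodl_Nil fa_scal_mul_right fa_smul_algebra)
  then show "a = (\<Sum>w\<in>fa_supp a. a w *\<^sub>f fa_gen (hd w))"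
    by (subst FA_expand[OF a]) (intro sum.cong; simp)
qed

text \<open>With \<open>y'\<close> the possibly parity-twisted \<open>y\<close>, the supercommutator
  is \<open>(x - \<chi>(x)) y - y' (x - \<chi>(x))\<close>: as \<open>\<chi>\<close> vanishes on odd
  elements, \<open>\<chi>(x) y' = \<chi>(x) y\<close>. The second term lies in the left
  ideal.\<close>

lemma scomm_mod:
  assumes y: "y \<in> FA (qvalid n)" and x: "x \<in> mgens n"
  shows "scomm qpar (fa_gen x) y \<in> Kpre n \<longleftrightarrow> inK n ((emb n (fa_gen x) - of_bool (\<exists>j. x = Ee (Suc j) j)) * emb n y)"
proof -
  let ?c = "of_bool (\<exists>j. x = Ee (Suc j) j) :: complex"
  let ?y = "if qpar x then fa_par qpar y else y"
  have xv: "x \<in> qvalid n" using x by (auto simp: mgens_def)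
  note g = FA_gen[OF xv]
  have "fa_gen x - fa_scal ?c \<in> chigens n" using x by (auto simp: chigens_def)
  then have "fa_gen x - fa_scal ?c \<in> Kpre n" by (simp add: Kpre_def lid_gen)
  then have K: "?y \<odot> (fa_gen x - fa_scal ?c) \<in> Kpre n"
    unfolding Kpre_def by (rule lid_lmul) (simp add: y FA_par)
  have "?c *\<^sub>f ?y = ?c *\<^sub>f y" by (auto simp: fa_smul_algebra)
  then have eq: "scomm qpar (fa_gen x) y = (fa_gen x \<odot> y - ?c *\<^sub>f y) - ?y \<odot> (fa_gen x - fa_scal ?c)"
    unfolding scomm_gen fa_mul_diff_right fa_scal_mul_right by simp
  have "scomm qpar (fa_gen x) y \<in> Kpre n \<longleftrightarrow> fa_gen x \<odot> y - ?c *\<^sub>f y \<in> Kpre n"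
  proof
    assume "scomm qpar (fa_gen x) y \<in> Kpre n"
    then have "scomm qpar (fa_gen x) y + ?y \<odot> (fa_gen x - fa_scal ?c) \<in> Kpre n"
      using K unfolding Kpre_def by (rule lid_add)
    then show "fa_gen x \<odot> y - ?c *\<^sub>f y \<in> Kpre n" unfolding eq by (simp only: diff_add_cancel)
  next
    assume "fa_gen x \<odot> y - ?c *\<^sub>f y \<in> Kpre n"
    then show "scomm qpar (fa_gen x) y \<in> Kpre n"
      using K unfolding eq Kpre_def by (rule lideal_diff)
  qed
  also have "\<dots> \<longleftrightarrow> inK n (emb n (fa_gen x \<odot> y - ?c *\<^sub>f y))"
    by (simp add: inK_emb FA_diff FA_mul FA_smul g y)
  also have "emb n (fa_gen x \<odot> y - ?c *\<^sub>f y) = (emb n (fa_gen x) - of_bool (\<exists>j. x = Ee (Suc j) j)) * emb n y"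
    using y g by (auto simp: emb_diff emb_mul emb_smul FA_mul FA_smul usc_0 usc_1 left_diff_distrib)
  finally show ?thesis .
qed

lemma chi_support: "(\<exists>k. Ee i j = Ee (Suc k) k) \<longleftrightarrow> i = Suc j" "(\<exists>k. Ff i j = Ee (Suc k) k) \<longleftrightarrow> False"
  by auto

lemma Wpre_iff: "y \<in> Wpre n \<longleftrightarrow> y \<in> FA (qvalid n) \<and> emb n y \<in> W"
proof -
  have "emb n y \<in> W \<longleftrightarrow> (\<forall>a\<in>msp n. scomm qpar a y \<in> Kpre n)" if y: "y \<in> FA (qvalid n)"
  proof
    assume L: "emb n y \<in> W"
    have g: "scomm qpar (fa_gen x) y \<in> Kpre n" if x: "x \<in> mgens n" for x
    proof -
      obtain i j where ij: "x = Ee i j \<or> x = Ff i j" "1 \<le> j" "j < i" "i \<le> n"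
        using x by (auto simp: mgens_def qvalid_def)
      then have "(e i j - chi i j) * emb n y \<in> {x. inK n x} \<and> f i j * emb n y \<in> {x. inK n x}"
        using L unfolding W_def by blast
      then show ?thesis
        unfolding scomm_mod[OF y x] using ij(1) by (elim disjE) (simp_all add: chi_support e_def f_def chi_def)
    qed
    show "\<forall>a\<in>msp n. scomm qpar a y \<in> Kpre n"
    proof
      fix a assume a: "a \<in> msp n"
      have "scomm qpar (\<Sum>w\<in>A. a w *\<^sub>f fa_gen (hd w)) y \<in> Kpre n" if "finite A" "A \<subseteq> fa_supp a" for A
        using that
      proof (induction A)
        case empty
        then show ?case by (simp add: scomm_linear Kpre_def lid_zero del: zero_fun_apply)
      next
        case (insert w A)
        then have "a w *\<^sub>f scomm qpar (fa_gen (hd w)) y \<in> Kpre n" "scomm qpar (\<Sum>w\<in>A. a w *\<^sub>f fa_gen (hd w)) y \<in> Kpre n"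
          using g[OF msp_expand(2)[OF a]] unfolding Kpre_def by (auto intro: lid_smul)
        then show ?case unfolding sum.insert[OF insert.hyps] scomm_linear Kpre_def by (rule lid_add)
      qed
      moreover have "finite (fa_supp a)" using a by (auto simp: msp_def FA_def)
      ultimately show "scomm qpar a y \<in> Kpre n" by (subst msp_expand(1)[OF a]) blast
    qed
  next
    assume R: "\<forall>a\<in>msp n. scomm qpar a y \<in> Kpre n"
    have "inK n ((emb n (fa_gen x) - of_bool (\<exists>j. x = Ee (Suc j) j)) * emb n y)" if "x \<in> mgens n" for x
    proof -
      have "fa_gen x w = 0" if "length w \<noteq> 1" for w using that by (auto simp: fa_gen_def)
      then have "fa_gen x \<in> msp n" using that by (simp add: msp_def FA_gen)
      then show ?thesis using R scomm_mod[OF y that] by blast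
    qed
    note R' = this
    have "inK n ((e i j - chi i j) * emb n y) \<and> inK n (f i j * emb n y)" if "1 \<le> j" "j < i" "i \<le> n" for i j
    proof -
      have "Ee i j \<in> mgens n" "Ff i j \<in> mgens n" using that by (auto simp: mgens_def qvalid_def)
      from this[THEN R'] show ?thesis by (simp add: chi_support e_def f_def chi_def)
    qed
    then show "emb n y \<in> W" by (simp add: W_def)
  qed
  then show ?thesis by (auto simp: Wpre_def)
qed

section \<open>Surjectivity\<close>

lemma G_emb: "p \<in> FA (qvalid n) \<Longrightarrow> \<exists>d. G d (emb n p)"
proof (induction rule: FA_induct)
  case zero
  show ?case using G_0 by (simp add: emb_0 del: zero_fun_apply)
next
  case (add p q)
  then obtain c d where "G c (emb n p)" "G d (emb n q)" by auto
  then have "G (max c d) (emb n p + emb n q)" by (intro G_add) (auto intro: G_mono)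
  with add.hyps show ?case by (auto simp: emb_add simp del: plus_fun_apply)
next
  case (word c w)
  then have "\<exists>d. G d (emb n (fa_prodl (map fa_gen w)))"
  proof (induction w)
    case Nil
    \<comment> \<open>The empty word embeds as an idempotent that differs from 1 by an element of
      the ideal.\<close>
    have "G 0 ((emb n (fa_scal 1) * 1 - 1) + 1)"
      using inK_emb_1[of n 1] by (intro G_add G_I G_1) auto
    then show ?case by (auto simp: fa_prodl_Nil)
  next
    case (Cons x w)
    then obtain d where d: "G d (emb n (fa_prodl (map fa_gen w)))" by auto
    obtain i j where ij: "x = Ee i j \<or> x = Ff i j" "i \<in> idx" "j \<in> idx"
      using Cons.prems by (auto simp: qvalid_def mem_idx)
    have "\<exists>c. Fil c (emb n (fa_gen x))"
      using ij(1) Fil_gen[OF ij(2,3)] unfolding e_def f_def by blast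
    then obtain c where "Fil c (emb n (fa_gen x))" by blast
    from Fil_G[OF this d order_refl] show ?case
      using Cons.prems by (auto simp: fa_prodl_Cons emb_mul FA_gen word_FA)
  qed
  then show ?case using word by (auto simp: emb_smul word_FA intro: G_sc)
qed

text \<open>The preimages are taken from the column \<open>Mi\<close>, where \<open>YT\<close>
  carries no sign.\<close>

lemma Z_phi: "Z z \<Longrightarrow> \<exists>p\<in>FA UNIV. inK n (z - phi p)"
proof (induction rule: Z.induct)
  case Z_1
  show ?case using emb_one_mod[of 1] by (intro bexI[of _ "fa_scal 1"] FA_scal) (simp add: phi_def fa_eval_scal)
next
  case (Z_E m x)
  then obtain p where p: "p \<in> FA UNIV" "inK n (x - phi p)" by auto
  obtain s where s: "m = n + s" using Z_E.hyps le_Suc_ex by blast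
  have "phi (fa_gen (s, Mi, Mi) \<odot> p) = cE m n * phi p"
    using p(1) by (simp add: phi_mul FA_gen phi_gen YT_def s add.commute)
  then show ?case using p inK_mult[OF p(2), of "cE m n"]
    by (intro bexI[of _ "fa_gen (s, Mi, Mi) \<odot> p"]) (auto simp: right_diff_distrib FA_mul FA_gen)
next
  case (Z_F m x)
  then obtain p where p: "p \<in> FA UNIV" "inK n (x - phi p)" by auto
  obtain s where s: "m = n + s" using Z_F.hyps le_Suc_ex by blast
  have "phi (fa_gen (s, Pl, Mi) \<odot> p) = cF m n * phi p"
    using p(1) by (simp add: phi_mul FA_gen phi_gen YT_def s add.commute)
  then show ?case using p inK_mult[OF p(2), of "cF m n"]
    by (intro bexI[of _ "fa_gen (s, Pl, Mi) \<odot> p"]) (auto simp: right_diff_distrib FA_mul FA_gen)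
next
  case (Z_add x y)
  then obtain p q where p: "p \<in> FA UNIV" "inK n (x - phi p)" and q: "q \<in> FA UNIV" "inK n (y - phi q)" by auto
  have "inK n ((x + y) - phi (p + q))"
    using inK_add[OF p(2) q(2)] by (simp add: phi_add p q algebra_simps del: plus_fun_apply)
  then show ?case using FA_add[OF p(1) q(1)] by blast
next
  case (Z_sc x c)
  then obtain p where p: "p \<in> FA UNIV" "inK n (x - phi p)" by auto
  have "inK n (usc c * x - phi (c *\<^sub>f p))"
    using inK_mult[OF p(2), of "usc c"] by (simp add: phi_smul p right_diff_distrib)
  then show ?case using FA_smul[OF p(1)] by blast
qed

lemma surjective:
  assumes "y \<in> Wpre n" shows "\<exists>p\<in>FA UNIV. y - fa_eval img p \<in> Kpre n"
proof -
  have y: "y \<in> FA (qvalid n)" "emb n y \<in> W" using assms Wpre_iff by auto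
  obtain d where "G d (emb n y)" using G_emb[OF y(1)] by auto
  then obtain z where z: "Z z" "inK n (emb n y - z)" using W_spanned[OF _ y(2)] by auto
  obtain p where p: "p \<in> FA UNIV" "inK n (z - phi p)" using Z_phi[OF z(1)] by auto
  have "inK n (emb n y - phi p)" using inK_add[OF z(2) p(2)] by simp
  then have "inK n (emb n (y - fa_eval img p))" by (simp add: phi_def emb_diff y eval_FA)
  then show ?thesis using p(1) by (auto simp: inK_emb FA_diff y eval_FA)
qed

lemma img_Wpre: "img g \<in> Wpre n"
  by (cases g) (simp add: Wpre_iff img_FA emb_img YT_W)

lemma img_formula:
  assumes "1 \<le> k"
  shows "img (k - 1, Pl, Pl) - ((- 1) ^ k) *\<^sub>f sE n (n + k - 1) n 1 \<in> Kpre n"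
    and "img (k - 1, Mi, Pl) - ((- 1) ^ k) *\<^sub>f sF n (n + k - 1) n 1 \<in> Kpre n"
  using assms by (simp_all add: img_def minus_one_smul Kpre_def lid_zero del: zero_fun_apply sgn_if_simps)

end

text \<open>Values on generators determine the homomorphism, which sends the class of
  \<open>p\<close> to the class of \<open>fa_eval img p\<close>. The images of the generators are
  Whittaker, and \<open>Kpre n\<close> is stable under right multiplication by elements of
  \<open>Wpre n\<close>; so once the defining relations go to \<open>Kpre n\<close>, the two-sided
  ideal they generate does too.\<close>

theorem theorem6p1:
  fixes n :: nat
  assumes "1 \<le> n"
  shows "\<exists>img :: yg \<Rightarrow> qg fa.
     (\<forall>g. img g \<in> Wpre n \<and> homog qpar (ypar g) (img g)) \<and>
     (\<forall>k\<ge>1. img (k - 1, Pl, Pl) - ((-1)^k) *\<^sub>f sE n (n + k - 1) n 1 \<in> Kpre n) \<and>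
     (\<forall>k\<ge>1. img (k - 1, Mi, Pl) - ((-1)^k) *\<^sub>f sF n (n + k - 1) n 1 \<in> Kpre n) \<and>
     (\<forall>\<rho>\<in>yrels. fa_eval img \<rho> \<in> Kpre n) \<and>
     (\<forall>y\<in>Wpre n. \<exists>p\<in>FA UNIV. y - fa_eval img p \<in> Kpre n)"
proof -
  interpret queer_U n by standard (rule assms)
  show ?thesis
    by (rule exI[of _ img]) (use img_Wpre img_homog img_formula yrels_Kpre surjective in blast)
qed

end
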